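(* Let $p\in\mathbb Z$ with $p>1$ and let $\mathbf p=(p-1,p,p)$. Then the quotient metric $g(\mathbf p)$ on the quaternion Kähler quotient $M(\mathbf p)=\mu_{\mathbf p}^{-1}(0)/S^1(\mathbf p)$ of the quaternionic hyperbolic plane is complete and $U(2)$-invariant, and the total space $M(\mathbf p)$ can be identified (diffeomorphically) with the complex unit disk bundle $\mathcal L_{2p}\to\mathbb{CP}^1$ with first Chern class equal to $2p$.
   Context: Let $\mathbb H$ be the quaternions with standard units $i,j,k$. The quaternionic hyperbolic plane $\mathbb H\mathcal H^2$ is the open unit ball $\{\mathbf x=(x_1,x_2)\in\mathbb H^2:|x_1|^2+|x_2|^2<1\}$ with the Riemannian metric $$g=\frac{1}{1-|\mathbf x|^2}\Bigl(|d\mathbf x|^2+\frac{1}{1-|\mathbf x|^2}|\langle d\mathbf x,\mathbf x\rangle|^2\Bigr),\qquad \langle d\mathbf x,\mathbf x\rangle=\sum_\alpha \overline{dx_\alpha}\,x_\alpha .$$ For $\mathbf p=(p_0,p_1,p_2)\in\mathbb Z^3$ the circle action is $$\varphi^{\mathbf p}_t(x_1,x_2)=(e^{2\pi i p_1t}x_1e^{-2\pi i p_0t},\ e^{2\pi i p_2t}x_2e^{-2\pi i p_0t}),$$ with $t\in[0,1)$ (or, when all weights are odd, the effective quotient circle $t\in[0,1/2)$); the circle is denoted $S^1(\mathbf p)$. The zero set of the moment map is $$\mu_{\mathbf p}^{-1}(0)=\{\mathbf x\in\mathbb H\mathcal H^2:\ -ip_0+p_1\bar x_1ix_1+p_2\bar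 x_2ix_2=0\}.$$ The metric $g(\mathbf p)$ on $M(\mathbf p)=\mu_{\mathbf p}^{-1}(0)/S^1(\mathbf p)$ is obtained by restricting $g$ to $\mu_{\mathbf p}^{-1}(0)$ and making the projection a Riemannian submersion. "$U(2)$-invariant" means that $U(2)$ acts by isometries. For a positive integer $s$, the complex unit disk bundle $\mathcal L_s\to\mathbb{CP}^1$ with first Chern class $s$ is the quotient of $S^3\times\{\alpha\in\mathbb C:|\alpha|<1\}$, where $S^3=\{\mathbf v\in\mathbb C^2:\|\mathbf v\|=1\}$, by the circle action $\tau\cdot(\mathbf v,\alpha)=(\tau\mathbf v,\tau^s\alpha)$, $\tau\in S^1$, with projection to $S^3/S^1\cong\mathbb{CP}^1$. *)

theory Defs
  imports "HOL-Analysis.Analysis" "HOL-Algebra.Group_Action"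
begin

section \<open>Smooth maps on subsets of Euclidean spaces\<close>

text \<open>\<open>Ck_on k S f\<close> is meant for open \<open>S\<close>: \<open>f\<close> is \<open>k\<close> times continuously differentiable on \<open>S\<close>.\<close>

primrec Ck_on :: "nat \<Rightarrow> 'a::euclidean_space set \<Rightarrow> ('a \<Rightarrow> 'b::euclidean_space) \<Rightarrow> bool" where
  "Ck_on 0 S f \<longleftrightarrow> continuous_on S f"
| "Ck_on (Suc k) S f \<longleftrightarrow> (\<forall>x\<in>S. f differentiable at x) \<and>
     (\<forall>v. Ck_on k S (\<lambda>x. frechet_derivative f (at x) v))"

text \<open>On an arbitrary subset, a map is smooth if near every point of the subset it extends to a
  \<open>C\<^sup>\<infinity>\<close> map on an open neighbourhood in the ambient space.\<close>

definition smooth_on :: "'a::euclidean_space set \<Rightarrow> ('a \<Rightarrow> 'b::euclidean_space) \<Rightarrow> bool" where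
  "smooth_on S f \<longleftrightarrow> (\<forall>x\<in>S. \<exists>W F. open W \<and> x \<in> W \<and> (\<forall>k. Ck_on k W F) \<and> (\<forall>y\<in>W \<inter> S. F y = f y))"

text \<open>Embedded submanifolds, through local defining maps with surjective differential.  The target
  of the defining map is a subspace \<open>K\<close> of the ambient space, whose dimension is the codimension.\<close>

definition embedded_submanifold :: "'a::euclidean_space set \<Rightarrow> bool" where
  "embedded_submanifold Z \<longleftrightarrow>
     (\<forall>x\<in>Z. \<exists>W (h :: 'a \<Rightarrow> 'a) K. open W \<and> x \<in> W \<and> subspace K \<and> smooth_on W h \<and> h ` W \<subseteq> K \<and>
        Z \<inter> W = {y\<in>W. h y = 0} \<and> (\<forall>y\<in>Z \<inter> W. range (frechet_derivative h (at y)) = K))"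

definition tangent_space :: "'a::euclidean_space set \<Rightarrow> 'a \<Rightarrow> 'a set" where
  "tangent_space Z x = {v. \<exists>\<gamma> \<epsilon>. \<epsilon> > 0 \<and> smooth_on {-\<epsilon><..<\<epsilon>} \<gamma> \<and> \<gamma> ` {-\<epsilon><..<\<epsilon>} \<subseteq> Z \<and> \<gamma> (0::real) = x \<and>
      (\<gamma> has_vector_derivative v) (at 0)}"


section \<open>Smooth manifolds and Riemannian metrics\<close>

text \<open>A chart is a domain together with a coordinate map.  The underlying set of a manifold is the
  \<open>topspace\<close> of its topology.\<close>

type_synonym ('m, 'e) chart = "'m set \<times> ('m \<Rightarrow> 'e)"

definition local_dom :: "('m, 'e) chart \<Rightarrow> ('n, 'f) chart \<Rightarrow> ('m \<Rightarrow> 'n) \<Rightarrow> 'e set" where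
  "local_dom c c' f = snd c ` {m \<in> fst c. f m \<in> fst c'}"

definition local_rep :: "('m, 'e) chart \<Rightarrow> ('n, 'f) chart \<Rightarrow> ('m \<Rightarrow> 'n) \<Rightarrow> 'e \<Rightarrow> 'f" where
  "local_rep c c' f = (\<lambda>y. snd c' (f (inv_into (fst c) (snd c) y)))"

definition smooth_atlas :: "'m topology \<Rightarrow> ('m, 'e::euclidean_space) chart set \<Rightarrow> bool" where
  "smooth_atlas X A \<longleftrightarrow>
     \<Union> (fst ` A) = topspace X \<and>
     (\<forall>c\<in>A. openin X (fst c) \<and> open (snd c ` fst c) \<and>
        homeomorphic_map (subtopology X (fst c)) (top_of_set (snd c ` fst c)) (snd c)) \<and>
     (\<forall>c\<in>A. \<forall>c'\<in>A. smooth_on (local_dom c c' (\<lambda>m. m)) (local_rep c c' (\<lambda>m. m)))"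

definition smooth_manifold :: "'m topology \<Rightarrow> ('m, 'e::euclidean_space) chart set \<Rightarrow> bool" where
  "smooth_manifold X A \<longleftrightarrow> Hausdorff_space X \<and> second_countable X \<and> smooth_atlas X A"

definition smooth_map ::
  "'m topology \<Rightarrow> ('m, 'e::euclidean_space) chart set \<Rightarrow> 'n topology \<Rightarrow> ('n, 'f::euclidean_space) chart set
    \<Rightarrow> ('m \<Rightarrow> 'n) \<Rightarrow> bool" where
  "smooth_map X A Y B f \<longleftrightarrow> continuous_map X Y f \<and>
     (\<forall>c\<in>A. \<forall>c'\<in>B. smooth_on (local_dom c c' f) (local_rep c c' f))"

definition diffeomorphism ::
  "'m topology \<Rightarrow> ('m, 'e::euclidean_space) chart set \<Rightarrow> 'n topology \<Rightarrow> ('n, 'f::euclidean_space) chart set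
    \<Rightarrow> ('m \<Rightarrow> 'n) \<Rightarrow> bool" where
  "diffeomorphism X A Y B f \<longleftrightarrow> smooth_map X A Y B f \<and>
     (\<exists>f'. smooth_map Y B X A f' \<and> (\<forall>x\<in>topspace X. f' (f x) = x) \<and> (\<forall>y\<in>topspace Y. f (f' y) = y))"

text \<open>A field of bilinear forms is given by its coordinate expressions: \<open>g c m v w\<close> is the value at
  the point \<open>m\<close> on the tangent vectors having components \<open>v\<close> and \<open>w\<close> in the chart \<open>c\<close>.\<close>

type_synonym ('m, 'e) metric_field = "('m, 'e) chart \<Rightarrow> 'm \<Rightarrow> 'e \<Rightarrow> 'e \<Rightarrow> real"

text \<open>The pullback of \<open>h\<close> under \<open>f\<close> is \<open>g\<close>.\<close>

definition preserves_metric ::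
  "('m, 'e::euclidean_space) chart set \<Rightarrow> ('m, 'e) metric_field \<Rightarrow>
   ('n, 'f::euclidean_space) chart set \<Rightarrow> ('n, 'f) metric_field \<Rightarrow> ('m \<Rightarrow> 'n) \<Rightarrow> bool" where
  "preserves_metric A g B h f \<longleftrightarrow>
     (\<forall>c\<in>A. \<forall>c'\<in>B. \<forall>m\<in>fst c. f m \<in> fst c' \<longrightarrow>
        (\<exists>D. (local_rep c c' f has_derivative D) (at (snd c m)) \<and>
             (\<forall>v w. h c' (f m) (D v) (D w) = g c m v w)))"

text \<open>The last condition is the transformation rule of a covariant 2-tensor under a change of charts.\<close>

definition riemannian_metric :: "('m, 'e::euclidean_space) chart set \<Rightarrow> ('m, 'e) metric_field \<Rightarrow> bool" where
  "riemannian_metric A g \<longleftrightarrow>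
     (\<forall>c\<in>A. \<forall>m\<in>fst c. bilinear (g c m) \<and> (\<forall>v w. g c m v w = g c m w v) \<and>
        (\<forall>v. v \<noteq> 0 \<longrightarrow> g c m v v > 0)) \<and>
     (\<forall>c\<in>A. \<forall>v w. smooth_on (snd c ` fst c) (\<lambda>y. g c (inv_into (fst c) (snd c) y) v w)) \<and>
     preserves_metric A g A g (\<lambda>m. m)"

definition riemannian_isometry ::
  "'m topology \<Rightarrow> ('m, 'e::euclidean_space) chart set \<Rightarrow> ('m, 'e) metric_field \<Rightarrow>
   'n topology \<Rightarrow> ('n, 'f::euclidean_space) chart set \<Rightarrow> ('n, 'f) metric_field \<Rightarrow> ('m \<Rightarrow> 'n) \<Rightarrow> bool" where
  "riemannian_isometry X A g Y B h f \<longleftrightarrow> diffeomorphism X A Y B f \<and> preserves_metric A g B h f"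

definition piecewise_C1_curve ::
  "'m topology \<Rightarrow> ('m, 'e::euclidean_space) chart set \<Rightarrow> (real \<Rightarrow> 'm) \<Rightarrow> bool" where
  "piecewise_C1_curve X A \<gamma> \<longleftrightarrow> continuous_map (top_of_set {0..1}) X \<gamma> \<and>
     (\<exists>S. finite S \<and> (\<forall>t\<in>{0<..<1} - S. \<forall>c\<in>A. \<gamma> t \<in> fst c \<longrightarrow>
        (\<exists>\<epsilon>>0. (snd c \<circ> \<gamma>) C1_differentiable_on {t-\<epsilon><..<t+\<epsilon>})))"

text \<open>For a Riemannian metric the speed does not depend on the chart chosen at \<open>\<gamma> t\<close>.\<close>

definition speed ::
  "('m, 'e::euclidean_space) chart set \<Rightarrow> ('m, 'e) metric_field \<Rightarrow> (real \<Rightarrow> 'm) \<Rightarrow> real \<Rightarrow> real" where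
  "speed A g \<gamma> t =
     (let c = SOME c. c \<in> A \<and> \<gamma> t \<in> fst c; v = vector_derivative (snd c \<circ> \<gamma>) (at t)
      in sqrt (g c (\<gamma> t) v v))"

text \<open>The infimum runs over curves of finite length only, as the length has to exist as a real
  integral.  The value 0 off the manifold is a convention required by \<open>Metric_space\<close>.\<close>

definition riemannian_dist ::
  "'m topology \<Rightarrow> ('m, 'e::euclidean_space) chart set \<Rightarrow> ('m, 'e) metric_field \<Rightarrow> 'm \<Rightarrow> 'm \<Rightarrow> real" where
  "riemannian_dist X A g x y =
     (if x \<in> topspace X \<and> y \<in> topspace X
      then Inf {l. \<exists>\<gamma>. piecewise_C1_curve X A \<gamma> \<and> \<gamma> 0 = x \<and> \<gamma> 1 = y \<and> (speed A g \<gamma> has_integral l) {0..1}}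
      else 0)"

definition complete_riemannian ::
  "'m topology \<Rightarrow> ('m, 'e::euclidean_space) chart set \<Rightarrow> ('m, 'e) metric_field \<Rightarrow> bool" where
  "complete_riemannian X A g \<longleftrightarrow> riemannian_metric A g \<and>
     Metric_space (topspace X) (riemannian_dist X A g) \<and>
     Metric_space.mcomplete (topspace X) (riemannian_dist X A g)"


section \<open>Quotients of embedded submanifolds\<close>

definition quotient_topology :: "'a::topological_space set \<Rightarrow> ('a \<Rightarrow> 'm) \<Rightarrow> 'm topology" where
  "quotient_topology Z \<pi> = topology (\<lambda>U. U \<subseteq> \<pi> ` Z \<and> openin (top_of_set Z) {x\<in>Z. \<pi> x \<in> U})"

lemma openin_quotient_topology:
  "openin (quotient_topology Z \<pi>) U \<longleftrightarrow> U \<subseteq> \<pi> ` Z \<and> openin (top_of_set Z) {x\<in>Z. \<pi> x \<in> U}"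
proof -
  let ?P = "\<lambda>U. U \<subseteq> \<pi> ` Z \<and> openin (top_of_set Z) {x\<in>Z. \<pi> x \<in> U}"
  have "istopology ?P"
    unfolding istopology_def
  proof (intro conjI allI impI)
    fix S T assume S: "?P S" and T: "?P T"
    have "{x\<in>Z. \<pi> x \<in> S \<inter> T} = {x\<in>Z. \<pi> x \<in> S} \<inter> {x\<in>Z. \<pi> x \<in> T}"
      by auto
    then show "S \<inter> T \<subseteq> \<pi> ` Z" "openin (top_of_set Z) {x\<in>Z. \<pi> x \<in> S \<inter> T}"
      using S T by (auto intro: openin_Int)
  next
    fix \<K> assume K: "\<forall>K\<in>\<K>. ?P K"
    have "{x\<in>Z. \<pi> x \<in> \<Union>\<K>} = (\<Union>K\<in>\<K>. {x\<in>Z. \<pi> x \<in> K})"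
      by auto
    then show "\<Union>\<K> \<subseteq> \<pi> ` Z" "openin (top_of_set Z) {x\<in>Z. \<pi> x \<in> \<Union>\<K>}"
      using K by (auto intro!: openin_Union)
  qed
  then show ?thesis
    unfolding quotient_topology_def by (simp add: topology_inverse')
qed

text \<open>\<open>A\<close> is a smooth structure on the quotient \<open>\<pi> ` Z\<close> for which the projection \<open>\<pi>\<close> is a smooth
  submersion.  Up to equivalence of atlases there is at most one.\<close>

definition quotient_smooth_structure ::
  "'a::euclidean_space set \<Rightarrow> ('a \<Rightarrow> 'm) \<Rightarrow> ('m, 'e::euclidean_space) chart set \<Rightarrow> bool" where
  "quotient_smooth_structure Z \<pi> A \<longleftrightarrow>
     embedded_submanifold Z \<and> smooth_manifold (quotient_topology Z \<pi>) A \<and>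
     (\<forall>c\<in>A. smooth_on {x\<in>Z. \<pi> x \<in> fst c} (snd c \<circ> \<pi>) \<and>
        (\<forall>x\<in>Z. \<pi> x \<in> fst c \<longrightarrow>
           (\<exists>D. ((snd c \<circ> \<pi>) has_derivative D) (at x within Z) \<and> D ` tangent_space Z x = UNIV)))"

text \<open>Here \<open>g\<close> is a field of bilinear forms on the ambient space, restricted to \<open>Z\<close>; a derivative \<open>D\<close>
  within \<open>Z\<close> is uniquely determined on the tangent space.  The quotient metric \<open>h\<close> is determined by this
  condition: the differential of \<open>\<pi>\<close> is isometric on the \<open>g\<close>-orthogonal complement of its kernel.\<close>

definition horizontal_space ::
  "'a::euclidean_space set \<Rightarrow> ('a \<Rightarrow> 'a \<Rightarrow> 'a \<Rightarrow> real) \<Rightarrow> ('a \<Rightarrow> 'e::zero) \<Rightarrow> 'a \<Rightarrow> 'a set" where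
  "horizontal_space Z g D x =
     {v \<in> tangent_space Z x. \<forall>u\<in>tangent_space Z x. D u = 0 \<longrightarrow> g x u v = 0}"

definition riemannian_submersion ::
  "'a::euclidean_space set \<Rightarrow> ('a \<Rightarrow> 'a \<Rightarrow> 'a \<Rightarrow> real) \<Rightarrow> ('a \<Rightarrow> 'm) \<Rightarrow>
   ('m, 'e::euclidean_space) chart set \<Rightarrow> ('m, 'e) metric_field \<Rightarrow> bool" where
  "riemannian_submersion Z g \<pi> A h \<longleftrightarrow>
     quotient_smooth_structure Z \<pi> A \<and> riemannian_metric A h \<and>
     (\<forall>c\<in>A. \<forall>x\<in>Z. \<pi> x \<in> fst c \<longrightarrow>
        (\<exists>D. ((snd c \<circ> \<pi>) has_derivative D) (at x within Z) \<and>
             (\<forall>v\<in>horizontal_space Z g D x. \<forall>w\<in>horizontal_space Z g D x.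
                h c (\<pi> x) (D v) (D w) = g x v w)))"


section \<open>Quaternions and the quaternionic hyperbolic plane\<close>

text \<open>The quaternion \<open>a + b j\<close> with \<open>a\<close>, \<open>b\<close> complex is the pair \<open>(a, b)\<close>; the multiplication comes
  from \<open>j a = cnj a j\<close>.  Norm, inner product and vector space structure are those of the product type.\<close>

type_synonym quat = "complex \<times> complex"

definition qmult :: "quat \<Rightarrow> quat \<Rightarrow> quat" (infixl \<open>\<odot>\<close> 70) where
  "x \<odot> y = (fst x * fst y - snd x * cnj (snd y), fst x * snd y + snd x * cnj (fst y))"

definition qcnj :: "quat \<Rightarrow> quat" where
  "qcnj x = (cnj (fst x), - snd x)"

definition cq :: "complex \<Rightarrow> quat" where
  "cq z = (z, 0)"

definition qi :: quat where "qi = (\<i>, 0)"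
definition qj :: quat where "qj = (0, 1)"
definition qk :: quat where "qk = (0, \<i>)"

lemma quaternion_units:
  "qi \<odot> qi = cq (-1)" "qj \<odot> qj = cq (-1)" "qk \<odot> qk = cq (-1)"
  "qi \<odot> qj = qk" "qj \<odot> qk = qi" "qk \<odot> qi = qj"
  by (simp_all add: qmult_def cq_def qi_def qj_def qk_def)

text \<open>The quaternionic hyperbolic plane is \<open>ball 0 1\<close> in the type \<open>quat \<times> quat\<close>.\<close>

definition qinner :: "quat \<times> quat \<Rightarrow> quat \<times> quat \<Rightarrow> quat" where
  "qinner v x = qcnj (fst v) \<odot> fst x + qcnj (snd v) \<odot> snd x"

text \<open>The polarization of the quadratic form \<open>g\<close>, see the lemma below.\<close>

definition hyp_metric :: "quat \<times> quat \<Rightarrow> quat \<times> quat \<Rightarrow> quat \<times> quat \<Rightarrow> real" where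
  "hyp_metric x v w =
     1 / (1 - (norm x)\<^sup>2) * (v \<bullet> w + 1 / (1 - (norm x)\<^sup>2) * (qinner v x \<bullet> qinner w x))"

lemma hyp_metric_quadratic:
  "hyp_metric x v v =
     1 / (1 - (norm x)\<^sup>2) * ((norm v)\<^sup>2 + 1 / (1 - (norm x)\<^sup>2) * (norm (qinner v x))\<^sup>2)"
  by (simp add: hyp_metric_def power2_norm_eq_inner)

type_synonym weights = "int \<times> int \<times> int"

definition circle_act :: "weights \<Rightarrow> real \<Rightarrow> quat \<times> quat \<Rightarrow> quat \<times> quat" where
  "circle_act = (\<lambda>(p0, p1, p2) t (x1, x2).
     (cq (exp (2 * pi * \<i> * of_int p1 * of_real t)) \<odot> x1 \<odot> cq (exp (- 2 * pi * \<i> * of_int p0 * of_real t)),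
      cq (exp (2 * pi * \<i> * of_int p2 * of_real t)) \<odot> x2 \<odot> cq (exp (- 2 * pi * \<i> * of_int p0 * of_real t))))"

text \<open>When all weights are odd, restricting \<open>t\<close> to \<open>[0, 1/2)\<close> gives the same orbits.\<close>

definition circle_orbit :: "weights \<Rightarrow> quat \<times> quat \<Rightarrow> (quat \<times> quat) set" where
  "circle_orbit p x = (\<lambda>t. circle_act p t x) ` {0..<1}"

definition moment_map :: "weights \<Rightarrow> quat \<times> quat \<Rightarrow> quat" where
  "moment_map = (\<lambda>(p0, p1, p2) (x1, x2).
     - (of_int p0 *\<^sub>R qi) + of_int p1 *\<^sub>R (qcnj x1 \<odot> qi \<odot> x1) + of_int p2 *\<^sub>R (qcnj x2 \<odot> qi \<odot> x2))"

definition zero_level :: "weights \<Rightarrow> (quat \<times> quat) set" where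
  "zero_level p = {x \<in> ball 0 1. moment_map p x = 0}"

text \<open>The points of \<open>M(p)\<close> are the orbits in \<open>zero_level p\<close>, with the quotient topology.\<close>

definition qk_quotient :: "weights \<Rightarrow> (quat \<times> quat) set topology" where
  "qk_quotient p = quotient_topology (zero_level p) (circle_orbit p)"


section \<open>The action of U(2)\<close>

definition ctranspose :: "complex^2^2 \<Rightarrow> complex^2^2" where
  "ctranspose U = (\<chi> i j. cnj (U $ j $ i))"

definition U2 :: "(complex^2^2) monoid" where
  "U2 = \<lparr>carrier = {U. U ** ctranspose U = mat 1 \<and> ctranspose U ** U = mat 1},
         monoid.mult = (**), one = mat 1\<rparr>"

definition U2_act :: "complex^2^2 \<Rightarrow> quat \<times> quat \<Rightarrow> quat \<times> quat" where
  "U2_act U = (\<lambda>(x1, x2). (cq (U $ 1 $ 1) \<odot> x1 + cq (U $ 1 $ 2) \<odot> x2,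
                            cq (U $ 2 $ 1) \<odot> x1 + cq (U $ 2 $ 2) \<odot> x2))"

text \<open>The induced map on orbits sends an orbit \<open>m\<close> to its image \<open>U2_act U ` m\<close>; it is restricted to the
  quotient because \<open>group_action\<close> expects extensional bijections.\<close>

definition U2_invariant ::
  "(quat \<times> quat) set topology \<Rightarrow> ((quat \<times> quat) set, 'e::euclidean_space) chart set \<Rightarrow>
   ((quat \<times> quat) set, 'e) metric_field \<Rightarrow> bool" where
  "U2_invariant X A g \<longleftrightarrow>
     group_action U2 (topspace X) (\<lambda>U. \<lambda>m\<in>topspace X. U2_act U ` m) \<and>
     (\<forall>U\<in>carrier U2. riemannian_isometry X A g X A g (\<lambda>m. U2_act U ` m))"


section \<open>The unit disk bundle over the complex projective line\<close>

definition disk_total :: "((complex \<times> complex) \<times> complex) set" where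
  "disk_total = sphere 0 1 \<times> ball 0 1"

definition disk_orbit :: "nat \<Rightarrow> (complex \<times> complex) \<times> complex \<Rightarrow> ((complex \<times> complex) \<times> complex) set" where
  "disk_orbit s = (\<lambda>((v1, v2), \<alpha>). {((\<tau> * v1, \<tau> * v2), \<tau> ^ s * \<alpha>) | \<tau>. norm \<tau> = 1})"

definition disk_bundle :: "nat \<Rightarrow> ((complex \<times> complex) \<times> complex) set topology" where
  "disk_bundle s = quotient_topology disk_total (disk_orbit s)"

end

theory Submission
  imports Defs
begin

text \<open>
  Write the points of the quaternionic plane as pairs of quaternions \<open>a\<^sub>k + b\<^sub>k j\<close> with complex \<open>a\<^sub>k\<close>,
  \<open>b\<^sub>k\<close>.  For the weights \<open>(p - 1, p, p)\<close> the moment map vanishes exactly if \<open>b\<close> is orthogonal to \<open>a\<close>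
  in \<open>\<complex>\<^sup>2\<close> and \<open>\<bar>a\<bar>\<^sup>2 - \<bar>b\<bar>\<^sup>2 = 1 - 1/p\<close>, and the circle acts by \<open>(\<tau> a, \<tau>\<^bsup>2p-1\<^esup> b)\<close>.  In particular
  \<open>a\<close> never vanishes, and \<open>b\<close> is a multiple \<open>\<beta>\<close> of the vector \<open>(- cnj v\<^sub>2, cnj v\<^sub>1)\<close> with \<open>v = a / \<bar>a\<bar>\<close>.
  The ball condition says \<open>2 p \<bar>\<beta>\<bar>\<^sup>2 < 1\<close>, so \<open>(v, \<alpha>)\<close> with \<open>\<alpha> = sqrt (2 p) \<beta>\<close> identifies the zero
  level with \<open>S\<^sup>3\<close> times the unit disk (maps \<open>\<Phi>\<close> and \<open>\<Psi>\<close>).  As \<open>(- cnj v\<^sub>2, cnj v\<^sub>1)\<close> is rotated by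
  \<open>cnj \<tau>\<close>, the factor \<open>\<beta>\<close> is rotated by \<open>\<tau>\<^bsup>2p\<^esup>\<close>: the identification is equivariant for the action
  that defines the disk bundle of degree \<open>2 p\<close>, which gives the diffeomorphism.

  The smooth structures on both quotients come from the two standard trivializations over the
  projective line.  Everything about them is proved upstairs, where a chart is an invariant
  coordinate map together with a section (locale \<open>quotient_charts\<close>), and a smooth equivariant map
  upstairs induces a smooth map of the quotients (locale \<open>quotient_charts_pair\<close>); this covers
  coordinate changes, the action of \<open>U(2)\<close> and the diffeomorphism at once.

  For a point \<open>x\<close> let \<open>transverse x\<close> be the hyperbolic inner product of the components orthogonal to
  the orbit.  In a chart the quotient metric is the pullback of \<open>transverse\<close> under the section.  The
  lemma that carries all its properties is \<open>tangent_decomposition\<close>: a tangent vector of the zero level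
  equals, up to a vertical vector, the rotated image of its projection under the section.  Hence the
  coordinate expression does not depend on the choice of the lift, the projection is a Riemannian
  submersion, and linear isometries commuting with the circle, such as the elements of \<open>U(2)\<close>, act
  by isometries (\<open>preserves_metric_induced\<close>).

  Completeness follows without geodesics from \<open>complete_riemannianI\<close>.  An invariant function upstairs
  whose differential is bounded by the hyperbolic norm is Lipschitz on the quotient.  The function
  \<open>- ln (1 - \<bar>x\<bar>\<^sup>2) / 2\<close> is one, and its sublevel sets are compact, so Cauchy sequences stay in a
  compact set; functions separating the orbits show that the distance is definite.
\<close>

section \<open>Calculus of smooth maps\<close>

lemma Ck_on_cong:
  assumes "open S" "\<And>x. x \<in> S \<Longrightarrow> f x = g x" "Ck_on k S f"
  shows "Ck_on k S g"
  using assms(2,3)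
proof (induction k arbitrary: f g)
  case 0
  then show ?case
    by (simp cong: continuous_on_cong)
next
  case (Suc k)
  have d: "g differentiable at x" if "x \<in> S" for x
    using Suc.prems that assms(1) unfolding differentiable_def Ck_on.simps
    by (meson has_derivative_transform_within_open)
  have eq: "frechet_derivative f (at x) v = frechet_derivative g (at x) v" if "x \<in> S" for x v
  proof -
    have "f differentiable at x"
      using Suc.prems(2) that by simp
    then show ?thesis
      using frechet_derivative_transform_within_open[of f x S g] that assms(1) Suc.prems(1) by simp
  qed
  have "Ck_on k S (\<lambda>x. frechet_derivative f (at x) v)" for v
    using Suc.prems(2) by simp
  from Suc.IH[OF eq this] have "Ck_on k S (\<lambda>x. frechet_derivative g (at x) v)" for v .
  then show ?case
    using d by simp
qed

lemma Ck_on_SucI: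
  assumes "open S" "\<And>x. x \<in> S \<Longrightarrow> (f has_derivative f' x) (at x)" "\<And>v. Ck_on k S (\<lambda>x. f' x v)"
  shows "Ck_on (Suc k) S f"
proof -
  have "Ck_on k S (\<lambda>x. frechet_derivative f (at x) v)" for v
    using frechet_derivative_at[OF assms(2)]
    by (intro Ck_on_cong[OF assms(1) _ assms(3)[of v]]) auto
  then show ?thesis
    using assms(2) by (auto simp: differentiable_def)
qed

lemma Ck_on_has_derivative:
  "Ck_on (Suc k) S f \<Longrightarrow> x \<in> S \<Longrightarrow> (f has_derivative frechet_derivative f (at x)) (at x)"
  by (simp add: frechet_derivative_works)

lemma Ck_on_SucD: "Ck_on (Suc k) S f \<Longrightarrow> Ck_on k S f"
proof (induction k arbitrary: f)
  case 0
  then show ?case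
    by (simp add: continuous_at_imp_continuous_on differentiable_imp_continuous_within)
next
  case (Suc k)
  have "Ck_on k S (\<lambda>x. frechet_derivative f (at x) v)" for v
    by (rule Suc.IH) (use Suc.prems in simp)
  then show ?case
    using Suc.prems by simp
qed

lemma Ck_on_mono:
  assumes "T \<subseteq> S"
  shows "Ck_on k S f \<Longrightarrow> Ck_on k T f"
proof (induction k arbitrary: f)
  case 0
  then show ?case
    using assms by (auto intro: continuous_on_subset)
next
  case (Suc k)
  have "Ck_on k T (\<lambda>x. frechet_derivative f (at x) v)" for v
    by (rule Suc.IH) (use Suc.prems in simp)
  then show ?case
    using Suc.prems assms by auto
qed

lemma Ck_on_linear:
  assumes "open S" "bounded_linear L"
  shows "Ck_on k S f \<Longrightarrow> Ck_on k S (\<lambda>x. L (f x))"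
proof (induction k arbitrary: f)
  case 0
  then show ?case
    using assms by (auto intro: bounded_linear.continuous_on)
next
  case (Suc k)
  show ?case
  proof (rule Ck_on_SucI[OF assms(1)])
    show "((\<lambda>x. L (f x)) has_derivative (\<lambda>v. L (frechet_derivative f (at x) v))) (at x)"
      if "x \<in> S" for x
      by (rule bounded_linear.has_derivative[OF assms(2) Ck_on_has_derivative[OF Suc.prems that]])
    show "Ck_on k S (\<lambda>x. L (frechet_derivative f (at x) v))" for v
      by (rule Suc.IH) (use Suc.prems in simp)
  qed
qed

lemma Ck_on_const: "open S \<Longrightarrow> Ck_on k S (\<lambda>x. c)"
proof (induction k arbitrary: c)
  case (Suc k)
  show ?case
    by (rule Ck_on_SucI[where f' = "\<lambda>x v. 0", OF Suc.prems _ Suc.IH[OF Suc.prems]]) simp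
qed simp

lemma Ck_on_id: "open S \<Longrightarrow> Ck_on k S (\<lambda>x. x)"
proof (cases k)
  case (Suc n)
  assume "open S"
  then show ?thesis unfolding Suc
    by (intro Ck_on_SucI[where f' = "\<lambda>x v. v"]) (auto intro: Ck_on_const)
qed auto

lemma Ck_on_add:
  assumes "open S"
  shows "Ck_on k S f \<Longrightarrow> Ck_on k S g \<Longrightarrow> Ck_on k S (\<lambda>x. f x + g x)"
proof (induction k arbitrary: f g)
  case 0
  then show ?case by (auto intro: continuous_intros)
next
  case (Suc k)
  show ?case
  proof (rule Ck_on_SucI[OF assms(1)])
    show "((\<lambda>x. f x + g x) has_derivative (\<lambda>v. frechet_derivative f (at x) v + frechet_derivative g
        (at x) v)) (at x)"
      if "x \<in> S" for x
      using Ck_on_has_derivative[OF Suc.prems(1) that] Ck_on_has_derivative[OF Suc.prems(2) that]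
      by (rule has_derivative_add)
    show "Ck_on k S (\<lambda>x. frechet_derivative f (at x) v + frechet_derivative g (at x) v)" for v
      by (rule Suc.IH) (use Suc.prems in simp_all)
  qed
qed

lemma Ck_on_sum:
  assumes "open S" "finite I" "\<And>i. i \<in> I \<Longrightarrow> Ck_on k S (f i)"
  shows "Ck_on k S (\<lambda>x. \<Sum>i\<in>I. f i x)"
  using assms(2,3) by induction (auto intro: Ck_on_const Ck_on_add assms(1))

lemma Ck_on_bilinear:
  assumes "open S" "bounded_bilinear bil"
  shows "Ck_on k S f \<Longrightarrow> Ck_on k S g \<Longrightarrow> Ck_on k S (\<lambda>x. bil (f x) (g x))"
proof (induction k arbitrary: f g)
  case 0
  then show ?case
    using assms by (auto intro: bounded_bilinear.continuous_on)
next
  case (Suc k)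
  show ?case
  proof (rule Ck_on_SucI[OF assms(1)])
    show "((\<lambda>x. bil (f x) (g x)) has_derivative
        (\<lambda>v. bil (f x) (frechet_derivative g (at x) v) + bil (frechet_derivative f (at x) v) (g x))) (at x)"
      if "x \<in> S" for x
      using Ck_on_has_derivative[OF Suc.prems(1) that] Ck_on_has_derivative[OF Suc.prems(2) that]
      by (rule bounded_bilinear.FDERIV[OF assms(2)])
    show "Ck_on k S (\<lambda>x. bil (f x) (frechet_derivative g (at x) v) +
        bil (frechet_derivative f (at x) v) (g x))" for v
      using Suc.prems Ck_on_SucD[OF Suc.prems(1)] Ck_on_SucD[OF Suc.prems(2)]
      by (intro Ck_on_add assms Suc.IH) simp_all
  qed
qed

text \<open>The chain rule expresses the derivative of a composite through the partial derivatives of the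
  outer map, which are again composites, so that induction on \<open>k\<close> applies.\<close>

lemma Ck_on_compose:
  fixes f :: "'b::euclidean_space \<Rightarrow> 'c::euclidean_space" and g :: "'a::euclidean_space \<Rightarrow> 'b"
  assumes "open S" "open T"
  shows "Ck_on k T f \<Longrightarrow> Ck_on k S g \<Longrightarrow> g ` S \<subseteq> T \<Longrightarrow> Ck_on k S (\<lambda>x. f (g x))"
proof (induction k arbitrary: f g)
  case 0
  then show ?case
    by (auto intro: continuous_on_compose2)
next
  case (Suc k)
  let ?Df = "\<lambda>b x. frechet_derivative f (at x) b" and ?Dg = "\<lambda>v x. frechet_derivative g (at x) v"
  show ?case
  proof (rule Ck_on_SucI[OF assms(1)])
    fix x assume x: "x \<in> S"
    then have gx: "g x \<in> T"
      using Suc.prems by auto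
    let ?D = "frechet_derivative f (at (g x))"
    have f: "(f has_derivative ?D) (at (g x))"
      by (rule Ck_on_has_derivative[OF Suc.prems(1) gx])
    have D: "((\<lambda>x. f (g x)) has_derivative (\<lambda>v. ?D (?Dg v x))) (at x)"
      by (rule has_derivative_compose[OF Ck_on_has_derivative[OF Suc.prems(2) x] f])
    have "?D u = (\<Sum>b\<in>Basis. (u \<bullet> b) *\<^sub>R ?Df b (g x))" for u
    proof -
      have l: "linear ?D"
        by (rule has_derivative_linear[OF f])
      have "?D u = ?D (\<Sum>b\<in>Basis. (u \<bullet> b) *\<^sub>R b)"
        by (simp add: euclidean_representation)
      then show ?thesis
        by (simp add: linear_sum[OF l] linear_cmul[OF l])
    qed
    then show "((\<lambda>x. f (g x)) has_derivative
        (\<lambda>v. \<Sum>b\<in>Basis. (?Dg v x \<bullet> b) *\<^sub>R ?Df b (g x))) (at x)"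
      by (intro has_derivative_eq_rhs[OF D] ext)
  next
    fix v
    have 1: "Ck_on k S (\<lambda>x. ?Df b (g x))" for b
      by (rule Suc.IH[OF _ Ck_on_SucD[OF Suc.prems(2)] Suc.prems(3)]) (use Suc.prems(1) in simp)
    have 2: "Ck_on k S (\<lambda>x. ?Dg v x \<bullet> b)" for b
      by (rule Ck_on_linear[OF assms(1) bounded_linear_inner_left]) (use Suc.prems(2) in simp)
    show "Ck_on k S (\<lambda>x. \<Sum>b\<in>Basis. (?Dg v x \<bullet> b) *\<^sub>R ?Df b (g x))"
      by (intro Ck_on_sum Ck_on_bilinear[OF assms(1) bounded_bilinear_scaleR] 1 2 assms) auto
  qed
qed

lemma Ck_on_Pair:
  assumes "open S" "Ck_on k S f" "Ck_on k S g"
  shows "Ck_on k S (\<lambda>x. (f x, g x))"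
proof -
  have *: "bounded_linear (\<lambda>x::'b. (x, 0::'c))" "bounded_linear (\<lambda>x::'c. (0::'b, x))"
    by (auto intro!: bounded_linear_Pair bounded_linear_ident bounded_linear_zero)
  have "Ck_on k S (\<lambda>x. (f x, 0) + (0, g x))"
    by (intro Ck_on_add assms Ck_on_linear[OF assms(1) *(1)] Ck_on_linear[OF assms(1) *(2)])
  then show ?thesis
    by simp
qed

lemma smooth_onD:
  assumes "smooth_on S f" "x \<in> S"
  obtains W F where "open W" "x \<in> W" "\<forall>k. Ck_on k W F" "\<forall>y\<in>W \<inter> S. F y = f y"
proof -
  from assms obtain W F where "open W \<and> x \<in> W \<and> (\<forall>k. Ck_on k W F) \<and> (\<forall>y\<in>W \<inter> S. F y = f y)"
    unfolding smooth_on_def by blast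
  then show thesis
    by (intro that[of W F]) auto
qed

lemma smooth_onI:
  assumes "\<And>x. x \<in> S \<Longrightarrow> \<exists>W F. open W \<and> x \<in> W \<and> (\<forall>k. Ck_on k W F) \<and> (\<forall>y\<in>W \<inter> S. F y = f y)"
  shows "smooth_on S f"
  unfolding smooth_on_def using assms by (rule ballI)

lemma smooth_on_Ck:
  assumes "open W" "S \<subseteq> W" "\<And>k. Ck_on k W f"
  shows "smooth_on S f"
  unfolding smooth_on_def using assms by (intro ballI exI[of _ W] exI[of _ f]) auto

lemma smooth_on_cong_subset:
  assumes "smooth_on S f" "T \<subseteq> S" "\<And>x. x \<in> T \<Longrightarrow> f x = g x"
  shows "smooth_on T g"
proof (rule smooth_onI)
  fix x assume "x \<in> T"
  with assms(2) have "x \<in> S" ..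
  obtain W F where "open W" "x \<in> W" "\<forall>k. Ck_on k W F" "\<forall>y\<in>W \<inter> S. F y = f y"
    by (rule smooth_onD[OF assms(1) \<open>x \<in> S\<close>]) (rule that)
  then show "\<exists>W F. open W \<and> x \<in> W \<and> (\<forall>k. Ck_on k W F) \<and> (\<forall>y\<in>W \<inter> T. F y = g y)"
    using assms(2,3) by (intro exI[of _ W] exI[of _ F]) auto
qed

lemma smooth_on_cong:
  assumes "smooth_on S f" "\<And>x. x \<in> S \<Longrightarrow> f x = g x"
  shows "smooth_on S g"
  using assms(1) subset_refl assms(2) by (rule smooth_on_cong_subset)

lemma smooth_on_subset:
  assumes "smooth_on S f" "T \<subseteq> S"
  shows "smooth_on T f"
  by (rule smooth_on_cong_subset[OF assms]) (rule refl)

text \<open>Since smoothness on a subset is defined by local extensions, every construction with smooth maps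
  reduces to one with maps on open sets after intersecting finitely many domains of extension.\<close>

lemma smooth_on_compose:
  assumes f: "smooth_on T f" and g: "smooth_on S g" and "g ` S \<subseteq> T"
  shows "smooth_on S (\<lambda>x. f (g x))"
proof (rule smooth_onI)
  fix x assume x: "x \<in> S"
  obtain W G where W: "open W" "x \<in> W" "\<forall>k. Ck_on k W G" "\<forall>y\<in>W \<inter> S. G y = g y"
    by (rule smooth_onD[OF g x]) (rule that)
  have "g x \<in> T"
    using assms x by auto
  obtain V F where V: "open V" "g x \<in> V" "\<forall>k. Ck_on k V F" "\<forall>y\<in>V \<inter> T. F y = f y"
    by (rule smooth_onD[OF f \<open>g x \<in> T\<close>]) (rule that)
  have "continuous_on W G"
    using W(3)[rule_format, of 0] by simp
  then have o: "open (W \<inter> G -` V)"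
    using W V continuous_open_preimage by blast
  have "Ck_on k (W \<inter> G -` V) (\<lambda>x. F (G x))" for k
    by (rule Ck_on_compose[OF o V(1) V(3)[rule_format]]) (use Ck_on_mono[OF _ W(3)[rule_format, of k],
        of "W \<inter> G -` V"] in auto)
  moreover have "x \<in> W \<inter> G -` V"
    using W V x by auto
  moreover have "\<forall>y\<in>W \<inter> G -` V \<inter> S. F (G y) = f (g y)"
    using W V assms by auto
  ultimately show "\<exists>W F. open W \<and> x \<in> W \<and> (\<forall>k. Ck_on k W F) \<and> (\<forall>y\<in>W \<inter> S. F y = f (g y))"
    using o by blast
qed

lemma smooth_on_Pair:
  assumes f: "smooth_on S f" and g: "smooth_on S g"
  shows "smooth_on S (\<lambda>x. (f x, g x))"
proof (rule smooth_onI)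
  fix x assume x: "x \<in> S"
  obtain W G where W: "open W" "x \<in> W" "\<forall>k. Ck_on k W G" "\<forall>y\<in>W \<inter> S. G y = g y"
    by (rule smooth_onD[OF g x]) (rule that)
  obtain V F where V: "open V" "x \<in> V" "\<forall>k. Ck_on k V F" "\<forall>y\<in>V \<inter> S. F y = f y"
    by (rule smooth_onD[OF f x]) (rule that)
  have "Ck_on k (W \<inter> V) (\<lambda>x. (F x, G x))" for k
    using Ck_on_mono[OF _ W(3)[rule_format, of k], of "W \<inter> V"] Ck_on_mono[OF _ V(3)[rule_format, of
        k], of "W \<inter> V"]
      W(1) V(1) by (intro Ck_on_Pair open_Int) simp_all
  then show "\<exists>W Fa. open W \<and> x \<in> W \<and> (\<forall>k. Ck_on k W Fa) \<and> (\<forall>y\<in>W \<inter> S. Fa y = (f y, g y))"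
    using W V by (intro exI[of _ "W \<inter> V"] exI[of _ "\<lambda>x. (F x, G x)"]) auto
qed

named_theorems smooth_intros

lemma smooth_on_id [smooth_intros]: "smooth_on S (\<lambda>x. x)"
  by (rule smooth_on_Ck[OF open_UNIV subset_UNIV Ck_on_id[OF open_UNIV]])

lemma smooth_on_const [smooth_intros]: "smooth_on S (\<lambda>x. c)"
  by (rule smooth_on_Ck[OF open_UNIV subset_UNIV Ck_on_const[OF open_UNIV]])

lemma smooth_on_linear:
  assumes "bounded_linear L" "smooth_on S f"
  shows "smooth_on S (\<lambda>x. L (f x))"
proof -
  have "Ck_on k UNIV L" for k
    using Ck_on_linear[OF open_UNIV assms(1) Ck_on_id[OF open_UNIV]] .
  then have "smooth_on UNIV L"
    by (rule smooth_on_Ck[OF open_UNIV subset_UNIV])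
  then show ?thesis
    using assms(2) subset_UNIV by (rule smooth_on_compose)
qed

lemma smooth_on_bilinear:
  assumes p: "bounded_bilinear bil" and "smooth_on S f" "smooth_on S g"
  shows "smooth_on S (\<lambda>x. bil (f x) (g x))"
proof -
  have "Ck_on k UNIV (\<lambda>x. bil (fst x) (snd x))" for k
    by (intro Ck_on_bilinear[OF open_UNIV p] Ck_on_linear[OF open_UNIV bounded_linear_fst]
        Ck_on_linear[OF open_UNIV bounded_linear_snd] Ck_on_id open_UNIV)
  then have "smooth_on UNIV (\<lambda>x. bil (fst x) (snd x))"
    by (rule smooth_on_Ck[OF open_UNIV subset_refl])
  from smooth_on_compose[OF this smooth_on_Pair[OF assms(2,3)]] show ?thesis
    by simp
qed

declare smooth_on_Pair [smooth_intros]
lemmas smooth_on_fst [smooth_intros] = smooth_on_linear[OF bounded_linear_fst]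
lemmas smooth_on_snd [smooth_intros] = smooth_on_linear[OF bounded_linear_snd]
lemmas smooth_on_Re [smooth_intros] = smooth_on_linear[OF bounded_linear_Re]
lemmas smooth_on_Im [smooth_intros] = smooth_on_linear[OF bounded_linear_Im]
lemmas smooth_on_cnj [smooth_intros] = smooth_on_linear[OF bounded_linear_cnj]
lemmas smooth_on_of_real [smooth_intros] = smooth_on_linear[OF bounded_linear_of_real]
lemmas smooth_on_minus [smooth_intros] = smooth_on_linear[OF bounded_linear_minus[OF bounded_linear_ident]]
lemmas smooth_on_mult [smooth_intros] = smooth_on_bilinear[OF bounded_bilinear_mult]
lemmas smooth_on_scaleR [smooth_intros] = smooth_on_bilinear[OF bounded_bilinear_scaleR]
lemmas smooth_on_inner [smooth_intros] = smooth_on_bilinear[OF bounded_bilinear_inner]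

lemma smooth_on_add [smooth_intros]:
  assumes "smooth_on S f" "smooth_on S g"
  shows "smooth_on S (\<lambda>x. f x + g x)"
  using smooth_on_linear[OF bounded_linear_add[OF bounded_linear_fst bounded_linear_snd]
      smooth_on_Pair[OF assms]]
  by simp

lemma smooth_on_diff [smooth_intros]:
  assumes "smooth_on S f" "smooth_on S g"
  shows "smooth_on S (\<lambda>x. f x - g x)"
  using smooth_on_add[OF assms(1) smooth_on_minus[OF assms(2)]] by simp

lemma smooth_on_power [smooth_intros]:
  fixes f :: "'a::euclidean_space \<Rightarrow> 'b::{euclidean_space, real_normed_algebra_1}"
  assumes "smooth_on S f"
  shows "smooth_on S (\<lambda>x. f x ^ n)"
  by (induction n) (auto intro: smooth_intros assms)

lemma smooth_on_norm_power2 [smooth_intros]: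
  assumes "smooth_on S f"
  shows "smooth_on S (\<lambda>x. (norm (f x))\<^sup>2)"
  unfolding power2_norm_eq_inner by (intro smooth_intros assms)

lemma Ck_on_inverse: "Ck_on k {x::real. x \<noteq> 0} inverse"
proof (induction k)
  case 0
  then show ?case
    by (auto intro!: continuous_intros)
next
  case (Suc k)
  have o: "open {x::real. x \<noteq> 0}"
    by (simp add: open_Collect_neq)
  show ?case
  proof (rule Ck_on_SucI[OF o])
    show "(inverse has_derivative (\<lambda>v. (- v) *\<^sub>R (inverse x * inverse x))) (at x)" if "x \<in> {x. x \<noteq> 0}"
        for x :: real
      using that by (auto intro!: derivative_eq_intros)
    show "Ck_on k {x. x \<noteq> 0} (\<lambda>x::real. (- v) *\<^sub>R (inverse x * inverse x))" for v
      by (intro Ck_on_linear[OF o bounded_linear_scaleR_right] Ck_on_bilinear[OF o bounded_bilinear_mult] Suc)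
  qed
qed

lemma Ck_on_sqrt: "Ck_on k {x::real. x > 0} sqrt"
proof (induction k)
  case 0
  then show ?case
    by (auto intro!: continuous_intros)
next
  case (Suc k)
  have o: "open {x::real. x > 0}" and o': "open {x::real. x \<noteq> 0}"
    by (simp_all add: open_Collect_less open_Collect_neq)
  show ?case
  proof (rule Ck_on_SucI[OF o])
    show "(sqrt has_derivative (\<lambda>v. (v / 2) *\<^sub>R inverse (sqrt x))) (at x)" if "x \<in> {x. x > 0}" for x :: real
      using that by (auto intro!: derivative_eq_intros simp: field_simps)
    show "Ck_on k {x. x > 0} (\<lambda>x::real. (v / 2) *\<^sub>R inverse (sqrt x))" for v
      by (intro Ck_on_linear[OF o bounded_linear_scaleR_right] Ck_on_compose[OF o o' Ck_on_inverse] Suc) auto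
  qed
qed

lemma Ck_on_cis: "Ck_on k UNIV cis"
proof (induction k)
  case 0
  show ?case by (auto intro!: continuous_intros)
next
  case (Suc k)
  show ?case
  proof (rule Ck_on_SucI[OF open_UNIV])
    show "(cis has_derivative (\<lambda>v. (of_real v * \<i>) * cis x)) (at x)" for x
      using has_derivative_cis[OF has_derivative_ident[of "at x"]] by (simp add: scaleR_conv_of_real mult_ac)
    show "Ck_on k UNIV (\<lambda>x. (of_real v * \<i>) * cis x)" for v
      by (rule Ck_on_linear[OF open_UNIV bounded_linear_mult_right Suc])
  qed
qed

lemma smooth_on_inverse [smooth_intros]:
  fixes f :: "'a::euclidean_space \<Rightarrow> real"
  assumes "smooth_on S f" "\<And>x. x \<in> S \<Longrightarrow> f x \<noteq> 0"
  shows "smooth_on S (\<lambda>x. inverse (f x))"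
proof (rule smooth_on_compose[OF smooth_on_Ck[of "{x. x \<noteq> 0}"] assms(1)])
  show "open {x::real. x \<noteq> 0}"
    by (simp add: open_Collect_neq)
  show "{x::real. x \<noteq> 0} \<subseteq> {x. x \<noteq> 0}" ..
qed (use assms(2) in \<open>auto intro: Ck_on_inverse\<close>)

lemma smooth_on_divide [smooth_intros]:
  fixes f :: "'a::euclidean_space \<Rightarrow> real"
  assumes "smooth_on S f" "smooth_on S g" "\<And>x. x \<in> S \<Longrightarrow> g x \<noteq> 0"
  shows "smooth_on S (\<lambda>x. f x / g x)"
  unfolding divide_inverse by (intro smooth_intros assms)

lemma smooth_on_sqrt [smooth_intros]:
  assumes "smooth_on S f" "\<And>x. x \<in> S \<Longrightarrow> f x > 0"
  shows "smooth_on S (\<lambda>x. sqrt (f x))"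
proof (rule smooth_on_compose[OF smooth_on_Ck[of "{x. x > 0}"] assms(1)])
  show "open {x::real. x > 0}"
    by (simp add: open_Collect_less)
  show "{x::real. x > 0} \<subseteq> {x. x > 0}" ..
qed (use assms(2) in \<open>auto intro: Ck_on_sqrt\<close>)

lemma smooth_on_cis [smooth_intros]:
  assumes "smooth_on S f"
  shows "smooth_on S (\<lambda>x. cis (f x))"
  by (rule smooth_on_compose[OF smooth_on_Ck[OF open_UNIV subset_refl Ck_on_cis] assms]) auto

lemma smooth_on_complex_divide [smooth_intros]:
  fixes f :: "'a::euclidean_space \<Rightarrow> complex"
  assumes "smooth_on S f" "smooth_on S g" "\<And>x. x \<in> S \<Longrightarrow> g x \<noteq> 0"
  shows "smooth_on S (\<lambda>x. f x / g x)"
proof -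
  have *: "f x / g x = inverse ((norm (g x))\<^sup>2) *\<^sub>R (f x * cnj (g x))" for x
    by (subst complex_div_cnj) (simp add: scaleR_conv_of_real divide_inverse mult.commute)
  have "smooth_on S (\<lambda>x. inverse ((norm (g x))\<^sup>2) *\<^sub>R (f x * cnj (g x)))"
    by (intro smooth_intros assms) (use assms(3) in auto)
  then show ?thesis
    by (rule smooth_on_cong) (rule *[symmetric])
qed

lemma smooth_on_continuous: "smooth_on S f \<Longrightarrow> continuous_on S f"
  unfolding continuous_on_eq_continuous_within
proof
  fix x assume S: "smooth_on S f" "x \<in> S"
  obtain W F where W: "open W" "x \<in> W" "\<forall>k. Ck_on k W F" "\<forall>y\<in>W \<inter> S. F y = f y"
    by (rule smooth_onD[OF S]) (rule that)
  have "continuous_on W F"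
    using W(3)[rule_format, of 0] by simp
  then have "isCont F x"
    using W(1,2) by (simp add: continuous_on_eq_continuous_at)
  then have "(F \<longlongrightarrow> f x) (at x within S)"
    using W(2,4) S(2) by (simp add: isCont_def tendsto_within_subset[of F _ x UNIV])
  moreover have "eventually (\<lambda>y. F y = f y) (at x within S)"
    unfolding eventually_at_topological using W(1,2,4) by blast
  ultimately show "continuous (at x within S) f"
    unfolding continuous_within by (rule Lim_transform_eventually)
qed

lemma smooth_on_has_derivative_within:
  assumes "smooth_on S f" "x \<in> S"
  obtains D where "(f has_derivative D) (at x within S)"
proof -
  obtain W F where W: "open W" "x \<in> W" "\<forall>k. Ck_on k W F" "\<forall>y\<in>W \<inter> S. F y = f y"
    by (rule smooth_onD[OF assms(1) \<open>x \<in> S\<close>]) (rule that)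
  have "(F has_derivative frechet_derivative F (at x)) (at x within S)"
    by (rule has_derivative_at_withinI[OF Ck_on_has_derivative[OF W(3)[rule_format] W(2)]])
  moreover have "eventually (\<lambda>y. F y = f y) (at x within S)"
    unfolding eventually_at_topological using W(1,2,4) by blast
  moreover have "F x = f x"
    using W(2,4) assms(2) by simp
  ultimately have "(f has_derivative frechet_derivative F (at x)) (at x within S)"
    by (rule has_derivative_transform_eventually[OF _ _ _ assms(2)])
  then show thesis ..
qed

lemma smooth_on_open_Ck:
  assumes "smooth_on S f" "open S" "x \<in> S"
  obtains W where "open W" "x \<in> W" "W \<subseteq> S" "\<forall>k. Ck_on k W f"
proof -
  obtain W F where W: "open W" "x \<in> W" "\<forall>k. Ck_on k W F" "\<forall>y\<in>W \<inter> S. F y = f y"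
    by (rule smooth_onD[OF assms(1) \<open>x \<in> S\<close>]) (rule that)
  have "Ck_on k (W \<inter> S) f" for k
  proof (rule Ck_on_cong)
    show "Ck_on k (W \<inter> S) F"
      by (rule Ck_on_mono[OF _ W(3)[rule_format]]) simp
  qed (use W(1,4) assms(2) in \<open>simp_all add: open_Int\<close>)
  then show thesis
    using W(1,2) assms(2,3) by (intro that[of "W \<inter> S"] open_Int) simp_all
qed

lemma smooth_on_has_derivative:
  assumes "smooth_on S f" "open S" "x \<in> S"
  shows "(f has_derivative frechet_derivative f (at x)) (at x)"
proof -
  obtain W where "open W" "x \<in> W" "W \<subseteq> S" "\<forall>k. Ck_on k W f"
    by (rule smooth_on_open_Ck[OF assms]) (rule that)
  then show ?thesis
    using Ck_on_has_derivative[of 0 W f x] by simp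
qed

lemma smooth_on_frechet_derivative:
  assumes "smooth_on S f" "open S"
  shows "smooth_on S (\<lambda>x. frechet_derivative f (at x) v)"
proof (rule smooth_onI)
  fix x assume x: "x \<in> S"
  obtain W where "open W" "x \<in> W" "W \<subseteq> S" and W: "\<forall>k. Ck_on k W f"
    by (rule smooth_on_open_Ck[OF assms x]) (rule that)
  moreover have "Ck_on k W (\<lambda>x. frechet_derivative f (at x) v)" for k
    using W[rule_format, of "Suc k"] by simp
  ultimately show "\<exists>W F. open W \<and> x \<in> W \<and> (\<forall>k. Ck_on k W F) \<and>
      (\<forall>y\<in>W \<inter> S. F y = frechet_derivative f (at y) v)"
    by (intro exI[of _ W] exI[of _ "\<lambda>x. frechet_derivative f (at x) v"]) simp
qed

section \<open>Charts on quotients of submanifolds\<close>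

lemma topspace_quotient_topology [simp]: "topspace (quotient_topology Z \<pi>) = \<pi> ` Z"
proof
  show "topspace (quotient_topology Z \<pi>) \<subseteq> \<pi> ` Z"
    using openin_topspace[of "quotient_topology Z \<pi>"] unfolding openin_quotient_topology by blast
  have "{x\<in>Z. \<pi> x \<in> \<pi> ` Z} = Z"
    by auto
  then have "openin (quotient_topology Z \<pi>) (\<pi> ` Z)"
    by (simp add: openin_quotient_topology)
  then show "\<pi> ` Z \<subseteq> topspace (quotient_topology Z \<pi>)"
    by (rule openin_subset)
qed

lemma continuous_map_quotient:
  assumes "continuous_map (top_of_set Z) Y (\<lambda>x. f (\<pi> x))"
  shows "continuous_map (quotient_topology Z \<pi>) Y f"
  unfolding continuous_map
proof (intro conjI allI impI)
  show "f ` topspace (quotient_topology Z \<pi>) \<subseteq> topspace Y"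
    using assms by (auto simp: continuous_map_def)
  fix U assume "openin Y U"
  then have "openin (top_of_set Z) {x \<in> Z. f (\<pi> x) \<in> U}"
    using openin_continuous_map_preimage[OF assms] by simp
  moreover have "{x \<in> Z. \<pi> x \<in> {x \<in> topspace (quotient_topology Z \<pi>). f x \<in> U}} = {x \<in> Z. f (\<pi> x) \<in> U}"
    by auto
  ultimately show "openin (quotient_topology Z \<pi>) {x \<in> topspace (quotient_topology Z \<pi>). f x \<in> U}"
    unfolding openin_quotient_topology by auto
qed

lemma continuous_map_projection: "continuous_map (top_of_set Z) (quotient_topology Z \<pi>) \<pi>"
  unfolding continuous_map by (auto simp: openin_quotient_topology)

lemma Hausdorff_quotient_topology:
  fixes F :: "'a::topological_space \<Rightarrow> 'b::metric_space"
  assumes F: "continuous_on Z F" and eq: "\<And>x y. x \<in> Z \<Longrightarrow> y \<in> Z \<Longrightarrow> F x = F y \<longleftrightarrow> \<pi> x = \<pi> y"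
  shows "Hausdorff_space (quotient_topology Z \<pi>)"
proof (rule Hausdorff_space_injective_preimage)
  let ?f = "\<lambda>m. F (inv_into Z \<pi> m)"
  have f: "?f (\<pi> x) = F x" if "x \<in> Z" for x
    using that eq f_inv_into_f[of "\<pi> x" \<pi> Z] inv_into_into[of "\<pi> x" \<pi> Z] by simp
  show "Hausdorff_space (euclidean :: 'b topology)"
    by (simp add: metrizable_imp_Hausdorff_space metrizable_space_euclidean)
  show "continuous_map (quotient_topology Z \<pi>) euclidean ?f"
    by (rule continuous_map_quotient) (use F f in \<open>simp cong: continuous_on_cong\<close>)
  show "inj_on ?f (topspace (quotient_topology Z \<pi>))"
    by (rule inj_onI) (use eq f in auto)
qed

lemma has_derivative_within_openin:
  assumes "(f has_derivative D) (at x within S)" "openin (top_of_set Z) S" "x \<in> S"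
  shows "(f has_derivative D) (at x within Z)"
proof -
  obtain W where W: "open W" "S = Z \<inter> W"
    using assms(2) by (auto simp: openin_open)
  have "at x within S = at x within Z"
    by (rule at_within_nhd[of x W]) (use W assms(3) in auto)
  then show ?thesis
    using assms(1) by simp
qed

text \<open>Derivatives within \<open>Z\<close> are in general not unique, but composed with the derivative of a map into \<open>Z\<close>
  they give a genuine derivative.\<close>

lemma has_derivative_compose_into:
  assumes g: "(g has_derivative g') (at q)" and "open T" "q \<in> T" "g ` T \<subseteq> Z"
    and f: "(f has_derivative f') (at (g q) within Z)"
  shows "((\<lambda>y. f (g y)) has_derivative (\<lambda>v. f' (g' v))) (at q)"
proof -
  have "((\<lambda>y. f (g y)) has_derivative (\<lambda>v. f' (g' v))) (at q within T)"
    by (rule has_derivative_in_compose[OF has_derivative_at_withinI[OF g] has_derivative_subset[OF f assms(4)]])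
  then show ?thesis
    by (simp only: at_within_open[OF assms(3,2)])
qed

lemma tangent_space_image:
  assumes s: "smooth_on T s" "open T" "s ` T \<subseteq> Z" "q \<in> T"
  shows "frechet_derivative s (at q) v \<in> tangent_space Z (s q)"
proof -
  have lim: "((\<lambda>t::real. q + t *\<^sub>R v) \<longlongrightarrow> q) (at 0)"
    by (auto intro!: tendsto_eq_intros)
  have "eventually (\<lambda>t::real. q + t *\<^sub>R v \<in> T) (at 0)"
    by (rule topological_tendstoD[OF lim s(2,4)])
  then obtain \<epsilon> where e: "\<epsilon> > 0" "\<And>t. t \<noteq> 0 \<Longrightarrow> dist t 0 < \<epsilon> \<Longrightarrow> q + t *\<^sub>R v \<in> T"
    by (auto simp: eventually_at)
  have into: "q + t *\<^sub>R v \<in> T" if "t \<in> {-\<epsilon><..<\<epsilon>}" for t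
    using e(2)[of t] s(4) that by (cases "t = 0") (auto simp: dist_real_def)
  have "smooth_on {-\<epsilon><..<\<epsilon>} (\<lambda>t. s (q + t *\<^sub>R v))"
    by (rule smooth_on_compose[OF s(1)]) (use into in \<open>auto intro!: smooth_on_add smooth_on_scaleR
        smooth_on_const smooth_on_id\<close>)
  moreover have "((\<lambda>t. s (q + t *\<^sub>R v)) has_vector_derivative frechet_derivative s (at q) v) (at 0)"
  proof -
    have "((\<lambda>t. q + t *\<^sub>R v) has_vector_derivative v) (at (0::real))"
      by (auto intro!: derivative_eq_intros)
    moreover have "(s has_derivative frechet_derivative s (at q)) (at (q + 0 *\<^sub>R v))"
      using smooth_on_has_derivative[OF s(1,2,4)] by simp
    ultimately show ?thesis
      using vector_derivative_diff_chain_within[of "\<lambda>t. q + t *\<^sub>R v" v 0 UNIV s]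
      by (simp add: o_def has_derivative_at_withinI)
  qed
  ultimately show ?thesis
    unfolding tangent_space_def using e(1) into s(3) by (force intro!: exI[of _ "\<lambda>t. s (q + t *\<^sub>R v)"])
qed

lemma tangent_space_chain:
  assumes v: "v \<in> tangent_space Z x" and f: "(f has_derivative D) (at x within Z)"
  obtains \<gamma> \<epsilon> where "\<epsilon> > 0" "smooth_on {-\<epsilon><..<\<epsilon>} \<gamma>" "\<gamma> ` {-\<epsilon><..<\<epsilon>} \<subseteq> Z" "\<gamma> (0::real) = x"
    "(\<gamma> has_vector_derivative v) (at 0)" "((\<lambda>t. f (\<gamma> t)) has_vector_derivative D v) (at 0)"
proof -
  obtain \<gamma> \<epsilon> where g: "\<epsilon> > 0" "smooth_on {-\<epsilon><..<\<epsilon>} \<gamma>" "\<gamma> ` {-\<epsilon><..<\<epsilon>} \<subseteq> Z" "\<gamma> (0::real) = x"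
    "(\<gamma> has_vector_derivative v) (at 0)"
    using v unfolding tangent_space_def by blast
  have "((\<lambda>t. f (\<gamma> t)) has_derivative (\<lambda>h. D (h *\<^sub>R v))) (at 0)"
    by (rule has_derivative_compose_into[where T = "{-\<epsilon><..<\<epsilon>}" and Z = Z])
      (use g f in \<open>auto simp: has_vector_derivative_def\<close>)
  moreover have "D (h *\<^sub>R v) = h *\<^sub>R D v" for h
    by (rule linear_cmul[OF has_derivative_linear[OF f]])
  ultimately show thesis
    using that[OF g] by (simp add: has_vector_derivative_def)
qed

text \<open>Charts of a quotient \<open>\<pi> ` Z\<close> are best given upstairs: a saturated open set \<open>dom i\<close>, an invariant
  coordinate map \<open>Q i\<close> on it and a section \<open>\<sigma> i\<close> of the coordinate map.  The sections through arbitrary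
  points of a fibre make the projection a submersion; for an orbit map they are the translates of \<open>\<sigma> i\<close>.\<close>

locale quotient_charts =
  fixes Z :: "'a::euclidean_space set" and \<pi> :: "'a \<Rightarrow> 'm" and T :: "'e::euclidean_space set"
    and I :: "'i set" and Q :: "'i \<Rightarrow> 'a \<Rightarrow> 'e" and \<sigma> :: "'i \<Rightarrow> 'e \<Rightarrow> 'a" and dom :: "'i \<Rightarrow> 'a set"
  assumes submanifold: "embedded_submanifold Z"
    and Hausdorff: "Hausdorff_space (quotient_topology Z \<pi>)"
    and open_T: "open T"
    and countable_I: "countable I"
    and openin_dom: "i \<in> I \<Longrightarrow> openin (top_of_set Z) (dom i)"
    and cover: "x \<in> Z \<Longrightarrow> \<exists>i\<in>I. x \<in> dom i"
    and smooth_Q: "i \<in> I \<Longrightarrow> smooth_on (dom i) (Q i)"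
    and Q_into: "i \<in> I \<Longrightarrow> x \<in> dom i \<Longrightarrow> Q i x \<in> T"
    and smooth_\<sigma>: "i \<in> I \<Longrightarrow> smooth_on T (\<sigma> i)"
    and \<sigma>_into: "i \<in> I \<Longrightarrow> y \<in> T \<Longrightarrow> \<sigma> i y \<in> dom i"
    and Q_\<sigma>: "i \<in> I \<Longrightarrow> y \<in> T \<Longrightarrow> Q i (\<sigma> i y) = y"
    and saturated: "i \<in> I \<Longrightarrow> x \<in> dom i \<Longrightarrow> x' \<in> Z \<Longrightarrow> \<pi> x' = \<pi> x \<Longrightarrow> x' \<in> dom i"
    and fibre: "i \<in> I \<Longrightarrow> x \<in> dom i \<Longrightarrow> x' \<in> dom i \<Longrightarrow> \<pi> x = \<pi> x' \<longleftrightarrow> Q i x = Q i x'"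
    and section_through: "i \<in> I \<Longrightarrow> x \<in> dom i \<Longrightarrow>
      \<exists>s. smooth_on T s \<and> s ` T \<subseteq> Z \<and> s (Q i x) = x \<and> (\<forall>y\<in>T. s y \<in> dom i \<and> Q i (s y) = y)"
begin

definition chart :: "'i \<Rightarrow> ('m, 'e) chart" where
  "chart i = (\<pi> ` dom i, \<lambda>m. Q i (SOME x. x \<in> dom i \<and> \<pi> x = m))"

definition atlas :: "('m, 'e) chart set" where
  "atlas = chart ` I"

lemma dom_subset: "i \<in> I \<Longrightarrow> x \<in> dom i \<Longrightarrow> x \<in> Z"
  using openin_subset[OF openin_dom] by auto

lemma chart_coord: "i \<in> I \<Longrightarrow> x \<in> dom i \<Longrightarrow> snd (chart i) (\<pi> x) = Q i x"
proof -
  assume x: "i \<in> I" "x \<in> dom i"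
  let ?x = "SOME x'. x' \<in> dom i \<and> \<pi> x' = \<pi> x"
  have "?x \<in> dom i \<and> \<pi> ?x = \<pi> x"
    by (rule someI[of "\<lambda>x'. x' \<in> dom i \<and> \<pi> x' = \<pi> x" x]) (use x in simp)
  then show ?thesis
    using x fibre[of i ?x x] by (simp add: chart_def)
qed

lemma fst_chart [simp]: "fst (chart i) = \<pi> ` dom i"
  by (simp add: chart_def)

lemma projection_in_chart:
  assumes i: "i \<in> I" and x: "x \<in> Z"
  shows "\<pi> x \<in> \<pi> ` dom i \<longleftrightarrow> x \<in> dom i"
proof
  assume "\<pi> x \<in> \<pi> ` dom i"
  then obtain x' where "x' \<in> dom i" "\<pi> x = \<pi> x'" ..
  then show "x \<in> dom i"
    by (intro saturated[OF i _ x])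
qed simp

lemma \<pi>_\<sigma>_Q: "i \<in> I \<Longrightarrow> x \<in> dom i \<Longrightarrow> \<pi> (\<sigma> i (Q i x)) = \<pi> x"
  by (simp add: fibre \<sigma>_into Q_\<sigma> Q_into)

lemma chart_\<sigma>: "i \<in> I \<Longrightarrow> y \<in> T \<Longrightarrow> snd (chart i) (\<pi> (\<sigma> i y)) = y"
  by (simp add: chart_coord \<sigma>_into Q_\<sigma>)

lemma chart_dom_eq:
  assumes i: "i \<in> I"
  shows "\<pi> ` dom i = (\<lambda>y. \<pi> (\<sigma> i y)) ` T"
proof
  show "(\<lambda>y. \<pi> (\<sigma> i y)) ` T \<subseteq> \<pi> ` dom i"
    using \<sigma>_into[OF i] by auto
  show "\<pi> ` dom i \<subseteq> (\<lambda>y. \<pi> (\<sigma> i y)) ` T"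
  proof
    fix m assume "m \<in> \<pi> ` dom i"
    then obtain x where "x \<in> dom i" "m = \<pi> x"
      by blast
    then show "m \<in> (\<lambda>y. \<pi> (\<sigma> i y)) ` T"
      using \<pi>_\<sigma>_Q[OF i] Q_into[OF i] by (intro image_eqI[of _ _ "Q i x"]) simp_all
  qed
qed

lemma chart_image: "i \<in> I \<Longrightarrow> snd (chart i) ` (\<pi> ` dom i) = T"
  by (simp add: chart_dom_eq image_image chart_\<sigma>)

lemma inv_chart: "i \<in> I \<Longrightarrow> y \<in> T \<Longrightarrow> inv_into (\<pi> ` dom i) (snd (chart i)) y = \<pi> (\<sigma> i y)"
proof (rule inv_into_f_eq)
  assume i: "i \<in> I" "y \<in> T"
  show "inj_on (snd (chart i)) (\<pi> ` dom i)"
    by (rule inj_onI) (use fibre i in \<open>auto simp: chart_coord\<close>)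
  show "\<pi> (\<sigma> i y) \<in> \<pi> ` dom i"
    using i \<sigma>_into by simp
  show "snd (chart i) (\<pi> (\<sigma> i y)) = y"
    using i chart_\<sigma> by simp
qed

lemma openin_chart_dom: "i \<in> I \<Longrightarrow> openin (quotient_topology Z \<pi>) (\<pi> ` dom i)"
proof -
  assume i: "i \<in> I"
  then have "{x\<in>Z. \<pi> x \<in> \<pi> ` dom i} = dom i"
    using projection_in_chart dom_subset by auto
  then show ?thesis
    using i dom_subset openin_dom by (auto simp: openin_quotient_topology)
qed

lemma continuous_map_inv_chart: "i \<in> I \<Longrightarrow> continuous_map (top_of_set T) (quotient_topology Z \<pi>) (\<lambda>y. \<pi> (\<sigma> i y))"
proof -
  assume i: "i \<in> I"
  have "continuous_map (top_of_set T) (top_of_set Z) (\<sigma> i)"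
    using smooth_on_continuous[OF smooth_\<sigma>[OF i]] \<sigma>_into[OF i] dom_subset[OF i] by auto
  from continuous_map_compose[OF this continuous_map_projection, of \<pi>] show ?thesis
    by (simp add: o_def)
qed

lemma homeomorphic_map_chart:
  assumes i: "i \<in> I"
  shows "homeomorphic_map (subtopology (quotient_topology Z \<pi>) (\<pi> ` dom i)) (top_of_set T) (snd (chart i))"
proof (rule homeomorphic_maps_imp_map)
  show "homeomorphic_maps (subtopology (quotient_topology Z \<pi>) (\<pi> ` dom i)) (top_of_set T)
     (snd (chart i)) (\<lambda>y. \<pi> (\<sigma> i y))"
    unfolding homeomorphic_maps_def
  proof (intro conjI)
    let ?X = "subtopology (quotient_topology Z \<pi>) (\<pi> ` dom i)"
    have top: "topspace ?X = \<pi> ` dom i"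
      using dom_subset[OF i] by auto
    show "continuous_map ?X (top_of_set T) (snd (chart i))"
      unfolding continuous_map top
    proof (intro conjI allI impI)
      show "snd (chart i) ` \<pi> ` dom i \<subseteq> topspace (top_of_set T)"
        using chart_image[OF i] by simp
      fix U assume U: "openin (top_of_set T) U"
      have 1: "openin (top_of_set (dom i)) {x \<in> dom i. Q i x \<in> U}"
      proof (rule continuous_openin_preimage[of _ _ T U, unfolded vimage_def, THEN back_subst[of
          "openin (top_of_set (dom i))"]])
        show "continuous_on (dom i) (Q i)"
          by (rule smooth_on_continuous[OF smooth_Q[OF i]])
        show "Q i \<in> dom i \<rightarrow> T"
          using Q_into[OF i] by auto
      qed (use U in auto)
      have eq: "{x \<in> Z. \<pi> x \<in> {m \<in> \<pi> ` dom i. snd (chart i) m \<in> U}} = {x \<in> dom i. Q i x \<in> U}"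
      proof (rule Set.set_eqI)
        fix x
        show "x \<in> {x \<in> Z. \<pi> x \<in> {m \<in> \<pi> ` dom i. snd (chart i) m \<in> U}} \<longleftrightarrow> x \<in> {x \<in> dom i. Q i x \<in> U}"
          using chart_coord[OF i, of x] projection_in_chart[OF i, of x] dom_subset[OF i, of x]
          unfolding mem_Collect_eq by metis
      qed
      have "openin (quotient_topology Z \<pi>) {m \<in> \<pi> ` dom i. snd (chart i) m \<in> U}"
        unfolding openin_quotient_topology eq
        using openin_trans[OF 1 openin_dom[OF i]] dom_subset[OF i] by auto
      then show "openin ?X {m \<in> \<pi> ` dom i. snd (chart i) m \<in> U}"
        using openin_chart_dom[OF i] by (auto simp: openin_open_subtopology)
    qed
    show "continuous_map (top_of_set T) ?X (\<lambda>y. \<pi> (\<sigma> i y))"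
      using continuous_map_inv_chart[OF i] \<sigma>_into[OF i] by (auto simp: continuous_map_in_subtopology)
    show "\<forall>x\<in>topspace ?X. \<pi> (\<sigma> i (snd (chart i) x)) = x"
      unfolding top using chart_coord[OF i] \<pi>_\<sigma>_Q[OF i] by auto
    show "\<forall>y\<in>topspace (top_of_set T). snd (chart i) (\<pi> (\<sigma> i y)) = y"
      using chart_\<sigma>[OF i] by simp
  qed
qed

lemma openin_chart_image:
  assumes i: "i \<in> I" and V: "open V" "V \<subseteq> T"
  shows "openin (quotient_topology Z \<pi>) ((\<lambda>y. \<pi> (\<sigma> i y)) ` V)"
proof -
  let ?X = "subtopology (quotient_topology Z \<pi>) (\<pi> ` dom i)"
  have "openin ?X {m \<in> topspace ?X. snd (chart i) m \<in> V}"
    using openin_continuous_map_preimage[OF homeomorphic_imp_continuous_map[OF homeomorphic_map_chart[OF i]]]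
      V by (simp add: open_openin_trans[OF open_T] open_subset)
  moreover have "{m \<in> topspace ?X. snd (chart i) m \<in> V} = (\<lambda>y. \<pi> (\<sigma> i y)) ` V"
    using V dom_subset[OF i] chart_\<sigma>[OF i] \<sigma>_into[OF i]
    by (auto simp: chart_dom_eq[OF i] chart_\<sigma>[OF i])
  ultimately show ?thesis
    using openin_chart_dom[OF i] by (simp add: openin_open_subtopology)
qed

lemma second_countable_quotient: "second_countable (quotient_topology Z \<pi>)"
proof -
  obtain \<B> :: "'e set set" where B: "countable \<B>" "\<And>C. C \<in> \<B> \<Longrightarrow> open C"
    "\<And>S. open S \<Longrightarrow> \<exists>U. U \<subseteq> \<B> \<and> S = \<Union>U"
    by (rule univ_second_countable) (rule that)
  let ?B = "(\<lambda>(i, C). (\<lambda>y. \<pi> (\<sigma> i y)) ` (C \<inter> T)) ` (I \<times> \<B>)"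
  have "\<exists>V\<in>?B. m \<in> V \<and> V \<subseteq> U" if U: "openin (quotient_topology Z \<pi>) U" "m \<in> U" for U m
  proof -
    obtain x where x: "x \<in> Z" "m = \<pi> x"
      using openin_subset[OF U(1)] U(2) by auto
    obtain i where i: "i \<in> I" "x \<in> dom i" "m = \<pi> x"
      using cover[OF x(1)] x(2) by auto
    let ?S = "{y \<in> T. \<pi> (\<sigma> i y) \<in> U}"
    have "openin (top_of_set T) ?S"
      using openin_continuous_map_preimage[OF continuous_map_inv_chart[OF i(1)] U(1)] by simp
    then have "open ?S"
      by (simp add: openin_open_eq[OF open_T])
    from B(3)[OF this] obtain K where "K \<subseteq> \<B>" "?S = \<Union>K"
      by (elim exE conjE)
    moreover have "Q i x \<in> ?S"
      using i Q_into \<pi>_\<sigma>_Q U by simp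
    ultimately obtain C where C: "C \<in> \<B>" "Q i x \<in> C" "C \<subseteq> ?S"
      by blast
    have "m \<in> (\<lambda>y. \<pi> (\<sigma> i y)) ` (C \<inter> T)"
      using C i Q_into \<pi>_\<sigma>_Q by (intro image_eqI[of _ _ "Q i x"]) auto
    then show ?thesis
      using C i(1) by (intro bexI[of _ "(\<lambda>y. \<pi> (\<sigma> i y)) ` (C \<inter> T)"]) auto
  qed
  moreover have "openin (quotient_topology Z \<pi>) V" if V: "V \<in> ?B" for V
  proof -
    obtain i C where "i \<in> I" "C \<in> \<B>" "V = (\<lambda>y. \<pi> (\<sigma> i y)) ` (C \<inter> T)"
      using V by auto
    then show ?thesis
      using openin_chart_image[of i "C \<inter> T"] B(2) open_T by (simp add: open_Int)
  qed
  ultimately show ?thesis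
    unfolding second_countable_def using B(1) countable_I
    by (intro exI[of _ ?B]) auto
qed

end

text \<open>A map of quotients that is covered by a smooth map upstairs is smooth.  Taking the identity
  upstairs, this contains the smoothness of the coordinate changes.\<close>

locale quotient_charts_pair =
  A: quotient_charts Z \<pi> T I Q \<sigma> dom + B: quotient_charts Z' \<pi>' T' I' Q' \<sigma>' dom'
  for Z :: "'a::euclidean_space set" and \<pi> :: "'a \<Rightarrow> 'm" and T :: "'e::euclidean_space set"
    and I :: "'i set" and Q \<sigma> dom
    and Z' :: "'b::euclidean_space set" and \<pi>' :: "'b \<Rightarrow> 'n" and T' :: "'f::euclidean_space set"
    and I' :: "'j set" and Q' \<sigma>' dom' +
  fixes G :: "'a \<Rightarrow> 'b" and f :: "'m \<Rightarrow> 'n"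
  assumes smooth_G: "smooth_on Z G" and G_into: "x \<in> Z \<Longrightarrow> G x \<in> Z'"
    and induced: "x \<in> Z \<Longrightarrow> f (\<pi> x) = \<pi>' (G x)"
begin

lemma local_rep_induced:
  assumes "i \<in> I" "j \<in> I'" "y \<in> T" "G (\<sigma> i y) \<in> dom' j"
  shows "local_rep (A.chart i) (B.chart j) f y = Q' j (G (\<sigma> i y))"
  using assms A.inv_chart induced[OF A.dom_subset[OF _ A.\<sigma>_into]] B.chart_coord
  by (simp add: local_rep_def)

lemma local_dom_induced:
  assumes i: "i \<in> I" and j: "j \<in> I'"
  shows "local_dom (A.chart i) (B.chart j) f = {y \<in> T. G (\<sigma> i y) \<in> dom' j}"
proof -
  have *: "f (\<pi> (\<sigma> i y)) \<in> \<pi>' ` dom' j \<longleftrightarrow> G (\<sigma> i y) \<in> dom' j" if "y \<in> T" for y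
    using that induced[OF A.dom_subset[OF i A.\<sigma>_into[OF i]]] B.projection_in_chart[OF j]
      G_into[OF A.dom_subset[OF i A.\<sigma>_into[OF i]]] by simp
  show ?thesis
  proof
    show "local_dom (A.chart i) (B.chart j) f \<subseteq> {y \<in> T. G (\<sigma> i y) \<in> dom' j}"
    proof
      fix z assume "z \<in> local_dom (A.chart i) (B.chart j) f"
      then obtain y where y: "y \<in> T" "f (\<pi> (\<sigma> i y)) \<in> \<pi>' ` dom' j" "z = snd (A.chart i) (\<pi> (\<sigma> i y))"
        unfolding local_dom_def A.fst_chart B.fst_chart A.chart_dom_eq[OF i] by blast
      then show "z \<in> {y \<in> T. G (\<sigma> i y) \<in> dom' j}"
        using *[OF y(1)] A.chart_\<sigma>[OF i y(1)] by simp
    qed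
    show "{y \<in> T. G (\<sigma> i y) \<in> dom' j} \<subseteq> local_dom (A.chart i) (B.chart j) f"
    proof
      fix y assume y: "y \<in> {y \<in> T. G (\<sigma> i y) \<in> dom' j}"
      then have "\<pi> (\<sigma> i y) \<in> {m \<in> fst (A.chart i). f m \<in> fst (B.chart j)}"
        using * A.\<sigma>_into[OF i, of y] by simp
      then show "y \<in> local_dom (A.chart i) (B.chart j) f"
        unfolding local_dom_def using A.chart_\<sigma>[OF i, of y] y by (auto intro: rev_image_eqI)
    qed
  qed
qed

lemma open_local_dom:
  assumes i: "i \<in> I" and j: "j \<in> I'"
  shows "open {y \<in> T. G (\<sigma> i y) \<in> dom' j}"
proof -
  obtain W where W: "open W" "dom' j = Z' \<inter> W"
    using B.openin_dom[OF j] by (auto simp: openin_open)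
  have sub: "\<sigma> i ` T \<subseteq> Z"
    using A.\<sigma>_into[OF i] A.dom_subset[OF i] by auto
  have "continuous_on T (\<lambda>y. G (\<sigma> i y))"
    by (rule smooth_on_continuous[OF smooth_on_compose[OF smooth_G A.smooth_\<sigma>[OF i] sub]])
  then have "open (T \<inter> (\<lambda>y. G (\<sigma> i y)) -` W)"
    using A.open_T W(1) continuous_open_preimage by blast
  moreover have "{y \<in> T. G (\<sigma> i y) \<in> dom' j} = T \<inter> (\<lambda>y. G (\<sigma> i y)) -` W"
    using W(2) G_into sub by auto
  ultimately show ?thesis
    by simp
qed

lemma smooth_local_rep:
  assumes i: "i \<in> I" and j: "j \<in> I'"
  shows "smooth_on {y \<in> T. G (\<sigma> i y) \<in> dom' j} (\<lambda>y. Q' j (G (\<sigma> i y)))"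
proof -
  have "smooth_on T (\<lambda>y. G (\<sigma> i y))"
    by (rule smooth_on_compose[OF smooth_G A.smooth_\<sigma>[OF i]])
      (use A.\<sigma>_into[OF i] A.dom_subset[OF i] in auto)
  then have "smooth_on {y \<in> T. G (\<sigma> i y) \<in> dom' j} (\<lambda>y. G (\<sigma> i y))"
    by (rule smooth_on_subset) auto
  from smooth_on_compose[OF B.smooth_Q[OF j] this] show ?thesis
    by auto
qed

lemma smooth_on_local_rep:
  assumes i: "i \<in> I" and j: "j \<in> I'"
  shows "smooth_on (local_dom (A.chart i) (B.chart j) f) (local_rep (A.chart i) (B.chart j) f)"
  unfolding local_dom_induced[OF i j]
  by (rule smooth_on_cong[OF smooth_local_rep[OF i j]]) (use local_rep_induced[OF i j] in simp)

lemma smooth_map_induced: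
  "smooth_map (quotient_topology Z \<pi>) A.atlas (quotient_topology Z' \<pi>') B.atlas f"
  unfolding smooth_map_def
proof (intro conjI ballI)
  have "continuous_map (top_of_set Z) (top_of_set Z') G"
    using smooth_on_continuous[OF smooth_G] G_into by auto
  from continuous_map_compose[OF this continuous_map_projection, of \<pi>']
  have "continuous_map (top_of_set Z) (quotient_topology Z' \<pi>') (\<lambda>x. f (\<pi> x))"
    by (rule continuous_map_eq) (simp add: induced)
  then show "continuous_map (quotient_topology Z \<pi>) (quotient_topology Z' \<pi>') f"
    by (rule continuous_map_quotient)
next
  fix c c' assume "c \<in> A.atlas" "c' \<in> B.atlas"
  then show "smooth_on (local_dom c c' f) (local_rep c c' f)"
    unfolding A.atlas_def B.atlas_def using smooth_on_local_rep by fast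
qed

end

context quotient_charts
begin

sublocale self: quotient_charts_pair Z \<pi> T I Q \<sigma> dom Z \<pi> T I Q \<sigma> dom "\<lambda>x. x" "\<lambda>m. m"
  by unfold_locales (auto intro: smooth_intros)

lemma smooth_manifold_atlas: "smooth_manifold (quotient_topology Z \<pi>) atlas"
  unfolding smooth_manifold_def smooth_atlas_def
proof (intro conjI ballI Hausdorff second_countable_quotient)
  show "\<Union> (fst ` atlas) = topspace (quotient_topology Z \<pi>)"
    using cover dom_subset by (auto simp: atlas_def) blast
  fix c c' assume "c \<in> atlas"
  then obtain i where i: "i \<in> I" "c = chart i"
    by (auto simp: atlas_def)
  show "openin (quotient_topology Z \<pi>) (fst c)"
    using i openin_chart_dom by simp
  show "open (snd c ` fst c)"
    using i open_T chart_image by simp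
  show "homeomorphic_map (subtopology (quotient_topology Z \<pi>) (fst c)) (top_of_set (snd c ` fst c)) (snd c)"
    using i homeomorphic_map_chart chart_image by simp
  assume "c' \<in> atlas"
  then show "smooth_on (local_dom c c' (\<lambda>m. m)) (local_rep c c' (\<lambda>m. m))"
    unfolding atlas_def using i self.smooth_on_local_rep by fast
qed

lemma smooth_chart_projection:
  assumes i: "i \<in> I"
  shows "smooth_on (dom i) (snd (chart i) \<circ> \<pi>)"
  by (rule smooth_on_cong[OF smooth_Q[OF i]]) (use chart_coord[OF i] in simp)

text \<open>The derivative of a section is a right inverse of the derivative of the projection; this makes the
  projection a submersion.\<close>

lemma derivative_section:
  assumes i: "i \<in> I" and D: "((snd (chart i) \<circ> \<pi>) has_derivative D) (at (s q) within Z)"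
    and s: "smooth_on T s" "s ` T \<subseteq> Z" "q \<in> T" "\<And>y. y \<in> T \<Longrightarrow> s y \<in> dom i \<and> Q i (s y) = y"
  shows "D (frechet_derivative s (at q) v) = v"
proof -
  have "((\<lambda>y. (snd (chart i) \<circ> \<pi>) (s y)) has_derivative (\<lambda>v. D (frechet_derivative s (at q) v))) (at q)"
    by (rule has_derivative_compose_into[OF smooth_on_has_derivative[OF s(1) open_T s(3)] open_T s(3,2) D])
  then have "((\<lambda>y. y) has_derivative (\<lambda>v. D (frechet_derivative s (at q) v))) (at q)"
    by (rule has_derivative_transform_within_open[OF _ open_T s(3)]) (use s(4) chart_coord[OF i] in simp)
  from fun_cong[OF has_derivative_unique[OF this has_derivative_ident], of v] show ?thesis .
qed

lemma derivative_chart_projection: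
  assumes i: "i \<in> I" and x: "x \<in> dom i"
  obtains D where "((snd (chart i) \<circ> \<pi>) has_derivative D) (at x within Z)" "D ` tangent_space Z x = UNIV"
proof -
  obtain D where "((snd (chart i) \<circ> \<pi>) has_derivative D) (at x within dom i)"
    by (rule smooth_on_has_derivative_within[OF smooth_chart_projection[OF i] x]) (rule that)
  from has_derivative_within_openin[OF this openin_dom[OF i] x]
  have D: "((snd (chart i) \<circ> \<pi>) has_derivative D) (at x within Z)" .
  obtain s where s: "smooth_on T s" "s ` T \<subseteq> Z" "s (Q i x) = x" "\<forall>y\<in>T. s y \<in> dom i \<and> Q i (s y) = y"
    using section_through[OF i x] by blast
  have q: "Q i x \<in> T"
    using Q_into i x by simp
  have "v \<in> D ` tangent_space Z x" for v
  proof (rule image_eqI)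
    show "v = D (frechet_derivative s (at (Q i x)) v)"
      using derivative_section[OF i _ s(1,2) q, of D v] D s(3,4) by simp
    show "frechet_derivative s (at (Q i x)) v \<in> tangent_space Z x"
      using tangent_space_image[OF s(1) open_T s(2) q, of v] s(3) by simp
  qed
  then show thesis
    using that[OF D] by blast
qed

theorem quotient_smooth_structure_atlas: "quotient_smooth_structure Z \<pi> atlas"
  unfolding quotient_smooth_structure_def
proof (intro conjI ballI impI submanifold smooth_manifold_atlas)
  fix c assume "c \<in> atlas"
  then obtain i where i: "i \<in> I" "c = chart i"
    by (auto simp: atlas_def)
  have "{x \<in> Z. \<pi> x \<in> fst c} = dom i"
    using i projection_in_chart dom_subset by auto
  then show "smooth_on {x \<in> Z. \<pi> x \<in> fst c} (snd c \<circ> \<pi>)"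
    using smooth_chart_projection i by simp
  fix x assume "x \<in> Z" "\<pi> x \<in> fst c"
  then have x: "x \<in> dom i"
    using i projection_in_chart by simp
  show "\<exists>D. (snd c \<circ> \<pi> has_derivative D) (at x within Z) \<and> D ` tangent_space Z x = UNIV"
    using derivative_chart_projection[OF i(1) x] i(2) by metis
qed

text \<open>The charts of the disk bundle are carried over in this way to the quotient of the zero level.\<close>

lemma quotient_charts_transfer:
  fixes Z' :: "'b::euclidean_space set" and \<pi>' :: "'b \<Rightarrow> 'n"
  assumes sub: "embedded_submanifold Z'" and Haus: "Hausdorff_space (quotient_topology Z' \<pi>')"
    and \<Psi>: "smooth_on Z \<Psi>" "\<And>x. x \<in> Z \<Longrightarrow> \<Psi> x \<in> Z'" "\<And>x. x \<in> Z \<Longrightarrow> \<Phi> (\<Psi> x) = x"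
    and \<Phi>: "smooth_on Z' \<Phi>" "\<And>x. x \<in> Z' \<Longrightarrow> \<Phi> x \<in> Z" "\<And>x. x \<in> Z' \<Longrightarrow> \<Psi> (\<Phi> x) = x"
    and fib: "\<And>x y. x \<in> Z' \<Longrightarrow> y \<in> Z' \<Longrightarrow> \<pi>' x = \<pi>' y \<longleftrightarrow> \<pi> (\<Phi> x) = \<pi> (\<Phi> y)"
  shows "quotient_charts Z' \<pi>' T I (\<lambda>i x. Q i (\<Phi> x)) (\<lambda>i y. \<Psi> (\<sigma> i y)) (\<lambda>i. {x \<in> Z'. \<Phi> x \<in> dom i})"
proof
  fix i assume i: "i \<in> I"
  have into: "y \<in> T \<Longrightarrow> \<sigma> i y \<in> Z" for y
    using dom_subset[OF i] \<sigma>_into[OF i] by auto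
  show "openin (top_of_set Z') {x \<in> Z'. \<Phi> x \<in> dom i}"
  proof -
    have "continuous_map (top_of_set Z') (top_of_set Z) \<Phi>"
      using smooth_on_continuous[OF \<Phi>(1)] \<Phi>(2) by auto
    from openin_continuous_map_preimage[OF this openin_dom[OF i]] show ?thesis
      by simp
  qed
  show "smooth_on {x \<in> Z'. \<Phi> x \<in> dom i} (\<lambda>x. Q i (\<Phi> x))"
    by (rule smooth_on_compose[OF smooth_Q[OF i] smooth_on_subset[OF \<Phi>(1)]]) auto
  show "smooth_on T (\<lambda>y. \<Psi> (\<sigma> i y))"
    by (rule smooth_on_compose[OF \<Psi>(1) smooth_\<sigma>[OF i]]) (use into in auto)
  show "\<Psi> (\<sigma> i y) \<in> {x \<in> Z'. \<Phi> x \<in> dom i}" "Q i (\<Phi> (\<Psi> (\<sigma> i y))) = y" if "y \<in> T" for y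
    using that into \<Psi> \<sigma>_into[OF i] Q_\<sigma>[OF i] by auto
  show "Q i (\<Phi> x) \<in> T" if "x \<in> {x \<in> Z'. \<Phi> x \<in> dom i}" for x
    using that Q_into[OF i] by simp
  show "x' \<in> {x \<in> Z'. \<Phi> x \<in> dom i}" if "x \<in> {x \<in> Z'. \<Phi> x \<in> dom i}" "x' \<in> Z'" "\<pi>' x' = \<pi>' x" for x x'
    using that fib saturated[OF i, of "\<Phi> x" "\<Phi> x'"] \<Phi>(2) by simp
  show "\<pi>' x = \<pi>' x' \<longleftrightarrow> Q i (\<Phi> x) = Q i (\<Phi> x')"
    if "x \<in> {x \<in> Z'. \<Phi> x \<in> dom i}" "x' \<in> {x \<in> Z'. \<Phi> x \<in> dom i}" for x x'
    using that fib fibre[OF i] by simp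
  fix x assume x: "x \<in> {x \<in> Z'. \<Phi> x \<in> dom i}"
  then have "\<Phi> x \<in> dom i"
    by simp
  from section_through[OF i this] obtain s where s: "smooth_on T s" "s ` T \<subseteq> Z"
    "s (Q i (\<Phi> x)) = \<Phi> x" "\<forall>y\<in>T. s y \<in> dom i \<and> Q i (s y) = y"
    by blast
  have "smooth_on T (\<lambda>y. \<Psi> (s y))"
    by (rule smooth_on_compose[OF \<Psi>(1) s(1,2)])
  moreover have "(\<lambda>y. \<Psi> (s y)) ` T \<subseteq> Z'" "\<Psi> (s (Q i (\<Phi> x))) = x"
    using s(2,3) \<Psi>(2) \<Phi>(3) x by auto
  moreover have "\<forall>y\<in>T. \<Psi> (s y) \<in> {x \<in> Z'. \<Phi> x \<in> dom i} \<and> Q i (\<Phi> (\<Psi> (s y))) = y"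
    using s(2,4) \<Psi>(2,3) by auto
  ultimately show "\<exists>s. smooth_on T s \<and> s ` T \<subseteq> Z' \<and> s (Q i (\<Phi> x)) = x \<and>
      (\<forall>y\<in>T. s y \<in> {x \<in> Z'. \<Phi> x \<in> dom i} \<and> Q i (\<Phi> (s y)) = y)"
    by (intro exI[of _ "\<lambda>y. \<Psi> (s y)"]) simp
next
  fix x assume "x \<in> Z'"
  then show "\<exists>i\<in>I. x \<in> {x \<in> Z'. \<Phi> x \<in> dom i}"
    using cover[OF \<Phi>(2)] by simp
qed (use sub Haus open_T countable_I in auto)

end

section \<open>Riemannian distance and completeness\<close>

text \<open>The condition imposed on a curve outside the finite set of exceptional times.\<close>

definition regular_at :: "('m, 'e::euclidean_space) chart set \<Rightarrow> (real \<Rightarrow> 'm) \<Rightarrow> real \<Rightarrow> bool" where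
  "regular_at A \<gamma> t \<longleftrightarrow>
     (\<forall>c\<in>A. \<gamma> t \<in> fst c \<longrightarrow> (\<exists>\<epsilon>>0. (snd c \<circ> \<gamma>) C1_differentiable_on {t-\<epsilon><..<t+\<epsilon>}))"

lemma smooth_on_C1_differentiable:
  assumes "smooth_on {a<..<b::real} f"
  shows "f C1_differentiable_on {a<..<b}"
  unfolding C1_differentiable_on_def
proof (intro exI conjI ballI)
  show "(f has_vector_derivative frechet_derivative f (at t) 1) (at t)" if "t \<in> {a<..<b}" for t
  proof -
    have f: "(f has_derivative frechet_derivative f (at t)) (at t)"
      by (rule smooth_on_has_derivative[OF assms _ that]) simp
    have "frechet_derivative f (at t) x = x *\<^sub>R frechet_derivative f (at t) 1" for x
      using linear_cmul[OF has_derivative_linear[OF f], of x 1] by simp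
    then show ?thesis
      unfolding has_vector_derivative_def by (intro has_derivative_eq_rhs[OF f] ext)
  qed
  show "continuous_on {a<..<b} (\<lambda>t. frechet_derivative f (at t) 1)"
    by (rule smooth_on_continuous[OF smooth_on_frechet_derivative[OF assms]]) simp
qed

locale riemannian_manifold =
  fixes X :: "'m topology" and A :: "('m, 'e::euclidean_space) chart set"
    and g :: "('m, 'e) metric_field"
  assumes manifold: "smooth_manifold X A" and metric: "riemannian_metric A g"
begin

lemma openin_chart: "c \<in> A \<Longrightarrow> openin X (fst c)"
  and open_chart_image: "c \<in> A \<Longrightarrow> open (snd c ` fst c)"
  and homeomorphic_chart:
    "c \<in> A \<Longrightarrow> homeomorphic_map (subtopology X (fst c)) (top_of_set (snd c ` fst c)) (snd c)"
  and smooth_transition: "c \<in> A \<Longrightarrow> c' \<in> A \<Longrightarrow>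
    smooth_on (local_dom c c' (\<lambda>m. m)) (local_rep c c' (\<lambda>m. m))"
  using manifold unfolding smooth_manifold_def smooth_atlas_def by blast+

lemma chart_subset: "c \<in> A \<Longrightarrow> fst c \<subseteq> topspace X"
  by (rule openin_subset[OF openin_chart])

lemma topspace_chart: "c \<in> A \<Longrightarrow> topspace (subtopology X (fst c)) = fst c"
  using chart_subset[of c] by (auto simp: topspace_subtopology)

lemma chart_cover:
  assumes "m \<in> topspace X"
  obtains c where "c \<in> A" "m \<in> fst c"
  using assms manifold unfolding smooth_manifold_def smooth_atlas_def by blast

lemma some_chart:
  assumes "m \<in> topspace X"
  shows "(SOME c. c \<in> A \<and> m \<in> fst c) \<in> A \<and> m \<in> fst (SOME c. c \<in> A \<and> m \<in> fst c)"
proof -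
  obtain c where "c \<in> A" "m \<in> fst c"
    by (rule chart_cover[OF assms]) (rule that)
  then show ?thesis
    by (intro someI[of "\<lambda>c. c \<in> A \<and> m \<in> fst c" c] conjI)
qed

lemma bilinear_metric: "c \<in> A \<Longrightarrow> m \<in> fst c \<Longrightarrow> bilinear (g c m)"
  and metric_pos: "c \<in> A \<Longrightarrow> m \<in> fst c \<Longrightarrow> v \<noteq> 0 \<Longrightarrow> g c m v v > 0"
  and smooth_metric: "c \<in> A \<Longrightarrow> smooth_on (snd c ` fst c) (\<lambda>y. g c (inv_into (fst c) (snd c) y) v w)"
  using metric unfolding riemannian_metric_def by blast+

lemma metric_tensorial:
  assumes "c \<in> A" "c' \<in> A" "m \<in> fst c" "m \<in> fst c'"
  obtains D where "(local_rep c c' (\<lambda>m. m) has_derivative D) (at (snd c m))"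
    "\<And>v w. g c' m (D v) (D w) = g c m v w"
proof -
  have "\<exists>D. (local_rep c c' (\<lambda>m. m) has_derivative D) (at (snd c m)) \<and>
             (\<forall>v w. g c' m (D v) (D w) = g c m v w)"
    using metric assms unfolding riemannian_metric_def preserves_metric_def by blast
  then show thesis
    by (elim exE conjE) (rule that, blast+)
qed

lemma metric_scale: "c \<in> A \<Longrightarrow> m \<in> fst c \<Longrightarrow> g c m (a *\<^sub>R v) (a *\<^sub>R v) = a\<^sup>2 * g c m v v"
  using bilinear_lmul[OF bilinear_metric] bilinear_rmul[OF bilinear_metric]
  by (simp add: power2_eq_square)

lemma metric_nonneg: "c \<in> A \<Longrightarrow> m \<in> fst c \<Longrightarrow> g c m v v \<ge> 0"
  using metric_pos[of c m v] metric_scale[of c m 0 0] by (cases "v = 0") auto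

lemma chart_inj: "c \<in> A \<Longrightarrow> inj_on (snd c) (fst c)"
  using homeomorphic_imp_injective_map[OF homeomorphic_chart[of c]] topspace_chart[of c] by simp

lemma inv_chart_coord: "c \<in> A \<Longrightarrow> m \<in> fst c \<Longrightarrow> inv_into (fst c) (snd c) (snd c m) = m"
  by (simp add: chart_inj inv_into_f_f)

lemma inv_chart_into: "y \<in> snd c ` fst c \<Longrightarrow> inv_into (fst c) (snd c) y \<in> fst c"
  and chart_inv_chart: "y \<in> snd c ` fst c \<Longrightarrow> snd c (inv_into (fst c) (snd c) y) = y"
  by (rule inv_into_into, assumption) (rule f_inv_into_f)

lemma openin_chart_preimage:
  assumes c: "c \<in> A" and V: "open V"
  shows "openin X {m \<in> fst c. snd c m \<in> V}"
proof -
  have "openin (top_of_set (snd c ` fst c)) (snd c ` fst c \<inter> V)"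
    using V by (simp add: openin_open_Int)
  from openin_continuous_map_preimage[OF homeomorphic_imp_continuous_map[OF homeomorphic_chart[OF c]] this]
  have "openin (subtopology X (fst c)) {m \<in> fst c. snd c m \<in> snd c ` fst c \<inter> V}"
    unfolding topspace_chart[OF c] .
  moreover have "{m \<in> fst c. snd c m \<in> snd c ` fst c \<inter> V} = {m \<in> fst c. snd c m \<in> V}"
    by auto
  ultimately show ?thesis
    using openin_chart[OF c] by (simp add: openin_open_subtopology)
qed

lemma continuous_map_inv_chart:
  assumes c: "c \<in> A"
  shows "continuous_map (top_of_set (snd c ` fst c)) X (inv_into (fst c) (snd c))"
proof -
  obtain h where h: "homeomorphic_maps (subtopology X (fst c)) (top_of_set (snd c ` fst c)) (snd c) h"
    using homeomorphic_chart[OF c] unfolding homeomorphic_map_maps by (elim exE)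
  note top = topspace_chart[OF c]
  have cont: "continuous_map (top_of_set (snd c ` fst c)) X h"
    using h unfolding homeomorphic_maps_def by (simp add: continuous_map_in_subtopology)
  have eq: "h y = inv_into (fst c) (snd c) y" if "y \<in> snd c ` fst c" for y
  proof -
    have y: "y \<in> topspace (top_of_set (snd c ` fst c))"
      using that by simp
    have "h y \<in> fst c"
      using h y continuous_map_image_subset_topspace[of "top_of_set (snd c ` fst c)" "subtopology X (fst c)" h]
      unfolding homeomorphic_maps_def top by blast
    moreover have "snd c (h y) = y"
      using h y unfolding homeomorphic_maps_def by blast
    ultimately show ?thesis
      using inv_chart_coord[OF c, of "h y"] by simp
  qed
  show ?thesis
    by (rule continuous_map_eq[OF cont]) (use eq in simp)
qed

lemma open_overlap: "c \<in> A \<Longrightarrow> c' \<in> A \<Longrightarrow> open (local_dom c c' (\<lambda>m. m))"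
proof -
  assume c: "c \<in> A" "c' \<in> A"
  have "openin (top_of_set (snd c ` fst c)) {y \<in> snd c ` fst c. inv_into (fst c) (snd c) y \<in> fst c'}"
    using openin_continuous_map_preimage[OF continuous_map_inv_chart[OF c(1)] openin_chart[OF c(2)]] by simp
  moreover have "{y \<in> snd c ` fst c. inv_into (fst c) (snd c) y \<in> fst c'} = local_dom c c' (\<lambda>m. m)"
    unfolding local_dom_def using inv_chart_coord[OF c(1)] by auto
  ultimately show ?thesis
    using openin_open_eq[OF open_chart_image[OF c(1)]] by simp
qed

text \<open>Reversal and concatenation of curves are affine reparametrizations on the pieces.\<close>

lemma regular_reparam:
  assumes reg: "regular_at A \<gamma> (m * t + k)" and m: "m \<noteq> 0" and d: "d > 0"
    and eq: "\<And>s. s \<in> {t-d<..<t+d} \<Longrightarrow> \<gamma>' s = \<gamma> (m * s + k)" and top: "\<gamma>' t \<in> topspace X"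
  shows "regular_at A \<gamma>' t \<and> speed A g \<gamma>' t = \<bar>m\<bar> * speed A g \<gamma> (m * t + k)"
proof -
  have t: "\<gamma>' t = \<gamma> (m * t + k)"
    using eq[of t] d by simp
  have *: "\<exists>\<epsilon>>0. \<exists>E. (snd c \<circ> \<gamma>') C1_differentiable_on {t-\<epsilon><..<t+\<epsilon>} \<and>
      (snd c \<circ> \<gamma> has_vector_derivative E) (at (m * t + k)) \<and>
      (snd c \<circ> \<gamma>' has_vector_derivative m *\<^sub>R E) (at t)" if c: "c \<in> A" "\<gamma>' t \<in> fst c" for c
  proof -
    define u where "u = m * t + k"
    obtain \<epsilon> where e: "\<epsilon> > 0" "(snd c \<circ> \<gamma>) C1_differentiable_on {u-\<epsilon><..<u+\<epsilon>}"
      using reg c t unfolding regular_at_def u_def by auto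
    then obtain D where D: "\<forall>x\<in>{u-\<epsilon><..<u+\<epsilon>}. (snd c \<circ> \<gamma> has_vector_derivative D x) (at x)"
      "continuous_on {u-\<epsilon><..<u+\<epsilon>} D"
      unfolding C1_differentiable_on_def by (elim exE conjE)
    define \<delta> where "\<delta> = min d (\<epsilon> / \<bar>m\<bar>)"
    have \<delta>: "\<delta> > 0"
      using d e m by (simp add: \<delta>_def)
    have into: "m * s + k \<in> {u-\<epsilon><..<u+\<epsilon>}" if "s \<in> {t-\<delta><..<t+\<delta>}" for s
    proof -
      have "\<bar>s - t\<bar> < \<epsilon> / \<bar>m\<bar>"
        using that by (auto simp: \<delta>_def abs_if)
      then have "\<bar>m\<bar> * \<bar>s - t\<bar> < \<epsilon>"
        using m by (simp add: field_simps)
      then have "\<bar>m * (s - t)\<bar> < \<epsilon>"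
        by (simp add: abs_mult)
      then show ?thesis
        by (simp add: u_def algebra_simps abs_less_iff)
    qed
    have deriv: "(snd c \<circ> \<gamma>' has_vector_derivative m *\<^sub>R D (m * s + k)) (at s)" if s: "s \<in> {t-\<delta><..<t+\<delta>}" for s
    proof (rule has_vector_derivative_transform_within_open[OF _ _ s])
      have "((\<lambda>s. m * s + k) has_vector_derivative m) (at s)"
        by (auto intro!: derivative_eq_intros)
      from vector_diff_chain_at[OF this D(1)[rule_format, OF into[OF s]]]
      show "((\<lambda>s. snd c (\<gamma> (m * s + k))) has_vector_derivative m *\<^sub>R D (m * s + k)) (at s)"
        by (simp add: o_def)
      fix y assume "y \<in> {t-\<delta><..<t+\<delta>}"
      then have "y \<in> {t-d<..<t+d}"
        by (auto simp: \<delta>_def)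
      from eq[OF this] show "snd c (\<gamma> (m * y + k)) = (snd c \<circ> \<gamma>') y"
        by simp
    qed simp
    have "continuous_on {t-\<delta><..<t+\<delta>} (\<lambda>s. m *\<^sub>R D (m * s + k))"
      by (intro continuous_intros continuous_on_compose2[OF D(2)]) (use into in auto)
    then have "(snd c \<circ> \<gamma>') C1_differentiable_on {t-\<delta><..<t+\<delta>}"
      unfolding C1_differentiable_on_def using deriv
      by (intro exI[of _ "\<lambda>s. m *\<^sub>R D (m * s + k)"]) simp
    moreover have "(snd c \<circ> \<gamma> has_vector_derivative D u) (at (m * t + k))"
      using D(1) e(1) by (simp add: u_def)
    moreover have "(snd c \<circ> \<gamma>' has_vector_derivative m *\<^sub>R D u) (at t)"
      using deriv[of t] \<delta> by (simp add: u_def)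
    ultimately show ?thesis
      using \<delta> by blast
  qed
  have "regular_at A \<gamma>' t"
    unfolding regular_at_def using * by meson
  moreover have "speed A g \<gamma>' t = \<bar>m\<bar> * speed A g \<gamma> (m * t + k)"
  proof -
    define c where "c = (SOME c. c \<in> A \<and> \<gamma>' t \<in> fst c)"
    have c: "c \<in> A" "\<gamma>' t \<in> fst c"
      using some_chart[OF top] by (auto simp: c_def)
    then obtain E where E: "(snd c \<circ> \<gamma> has_vector_derivative E) (at (m * t + k))"
      "(snd c \<circ> \<gamma>' has_vector_derivative m *\<^sub>R E) (at t)"
      using * by meson
    have "speed A g \<gamma>' t = sqrt (m\<^sup>2 * g c (\<gamma>' t) E E)"
      using vector_derivative_at[OF E(2)] metric_scale[OF c]
      by (simp add: speed_def Let_def c_def[symmetric])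
    moreover have "speed A g \<gamma> (m * t + k) = sqrt (g c (\<gamma>' t) E E)"
      using vector_derivative_at[OF E(1)] by (simp add: speed_def Let_def c_def t)
    ultimately show ?thesis
      by (simp add: real_sqrt_mult)
  qed
  ultimately show ?thesis ..
qed

text \<open>The lengths \<open>l\<close> of the curves from \<open>x\<close> to \<open>y\<close> are the set whose infimum is the distance.\<close>

definition joins :: "(real \<Rightarrow> 'm) \<Rightarrow> 'm \<Rightarrow> 'm \<Rightarrow> real \<Rightarrow> bool" where
  "joins \<gamma> x y l \<longleftrightarrow> piecewise_C1_curve X A \<gamma> \<and> \<gamma> 0 = x \<and> \<gamma> 1 = y \<and> (speed A g \<gamma> has_integral l) {0..1}"

lemma piecewise_C1_curve_iff:
  "piecewise_C1_curve X A \<gamma> \<longleftrightarrow> continuous_map (top_of_set {0..1}) X \<gamma> \<and>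
     (\<exists>S. finite S \<and> (\<forall>t\<in>{0<..<1} - S. regular_at A \<gamma> t))"
  unfolding piecewise_C1_curve_def regular_at_def by blast

lemma joinsE:
  assumes "joins \<gamma> x y l"
  obtains S where "continuous_map (top_of_set {0..1}) X \<gamma>" "finite S"
    "\<forall>t\<in>{0<..<1} - S. regular_at A \<gamma> t" "\<gamma> 0 = x" "\<gamma> 1 = y"
    "(speed A g \<gamma> has_integral l) {0..1}" "\<forall>t\<in>{0..1}. \<gamma> t \<in> topspace X"
proof -
  have c: "continuous_map (top_of_set {0..1}) X \<gamma>"
    using assms by (simp add: joins_def piecewise_C1_curve_iff)
  have "\<forall>t\<in>{0..1}. \<gamma> t \<in> topspace X"
    using continuous_map_image_subset_topspace[OF c] by auto
  then show thesis
    using assms that[OF c] unfolding joins_def piecewise_C1_curve_iff by blast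
qed

lemma joins_topspace: "joins \<gamma> x y l \<Longrightarrow> x \<in> topspace X \<and> y \<in> topspace X"
  by (elim joinsE) auto

lemma joins_nonneg:
  assumes "joins \<gamma> x y l"
  shows "l \<ge> 0"
proof -
  from assms obtain S where i: "(speed A g \<gamma> has_integral l) {0..1}" and top: "\<forall>t\<in>{0..1}. \<gamma> t \<in> topspace X"
    by (rule joinsE) (rule that)
  have "speed A g \<gamma> t \<ge> 0" if "t \<in> {0..1}" for t
    unfolding speed_def Let_def using some_chart[of "\<gamma> t"] metric_nonneg top that by simp
  then show ?thesis
    by (rule has_integral_nonneg[OF i])
qed

lemma joins_refl: "x \<in> topspace X \<Longrightarrow> joins (\<lambda>t. x) x x 0"
proof -
  assume x: "x \<in> topspace X"
  have "speed A g (\<lambda>t. x) t = 0" for t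
  proof -
    let ?c = "SOME c. c \<in> A \<and> x \<in> fst c"
    have "vector_derivative (snd ?c \<circ> (\<lambda>t. x)) (at t) = 0"
      by (rule vector_derivative_at) (simp add: o_def)
    then show ?thesis
      using some_chart[OF x] metric_scale[of ?c x 0 0] by (simp add: speed_def Let_def)
  qed
  then have "speed A g (\<lambda>t. x) = (\<lambda>t. 0)"
    by (rule ext)
  then have "(speed A g (\<lambda>t. x) has_integral 0) {0..1}"
    by simp
  moreover have "regular_at A (\<lambda>t. x) t" for t
    unfolding regular_at_def by (auto simp: o_def intro!: exI[of _ 1])
  ultimately show ?thesis
    using x by (auto simp: joins_def piecewise_C1_curve_iff)
qed

lemma joins_reverse:
  assumes "joins \<gamma> x y l"
  shows "joins (\<lambda>t. \<gamma> (1 - t)) y x l"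
proof -
  from assms obtain S where j: "continuous_map (top_of_set {0..1}) X \<gamma>" "finite S"
    "\<forall>t\<in>{0<..<1} - S. regular_at A \<gamma> t" "\<gamma> 0 = x" "\<gamma> 1 = y"
    "(speed A g \<gamma> has_integral l) {0..1}" "\<forall>t\<in>{0..1}. \<gamma> t \<in> topspace X"
    by (rule joinsE) (rule that)
  let ?S = "(\<lambda>t. 1 - t) ` S"
  have reg: "regular_at A (\<lambda>t. \<gamma> (1 - t)) t \<and> speed A g (\<lambda>t. \<gamma> (1 - t)) t = speed A g \<gamma> (1 - t)"
    if t: "t \<in> {0<..<1} - ?S" for t
  proof -
    have "1 - t \<in> {0<..<1} - S"
      using t by (auto simp: image_iff)
    then show ?thesis
      using j(3,7) regular_reparam[of \<gamma> "-1" t 1 1 "\<lambda>t. \<gamma> (1 - t)"] by simp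
  qed
  have "continuous_map (top_of_set {0..1}) (top_of_set {0..1::real}) (\<lambda>t. 1 - t)"
    by (auto intro!: continuous_intros)
  from continuous_map_compose[OF this j(1)]
  have c: "continuous_map (top_of_set {0..1}) X (\<lambda>t. \<gamma> (1 - t))"
    by (simp add: o_def)
  have "((\<lambda>t. speed A g \<gamma> (1 - t)) has_integral l) {0..1}"
  proof -
    have "(\<lambda>x. - x + 1) ` {0..1::real} = {0..1}"
      by (auto simp: image_iff intro!: bexI[of _ "1 - _"])
    then show ?thesis
      using has_integral_affinity[of "speed A g \<gamma>" l 0 1 "-1" 1] j(6) by (simp add: algebra_simps)
  qed
  then have "(speed A g (\<lambda>t. \<gamma> (1 - t)) has_integral l) {0..1}"
    by (rule has_integral_spike_finite[rotated 2, where S = "insert 0 (insert 1 ?S)"]) (use j(2) reg in auto)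
  moreover have "finite ?S"
    using j(2) by simp
  ultimately show ?thesis
    unfolding joins_def piecewise_C1_curve_iff using c reg j(4,5) by auto
qed

lemma joins_concat:
  assumes "joins \<gamma> x y l" "joins \<gamma>' y z l'"
  shows "joins (\<lambda>t. if t \<le> 1/2 then \<gamma> (2 * t) else \<gamma>' (2 * t - 1)) x z (l + l')"
proof -
  let ?\<gamma> = "\<lambda>t::real. if t \<le> 1/2 then \<gamma> (2 * t) else \<gamma>' (2 * t - 1)"
  from assms(1) obtain S where j: "continuous_map (top_of_set {0..1}) X \<gamma>" "finite S"
    "\<forall>t\<in>{0<..<1} - S. regular_at A \<gamma> t" "\<gamma> 0 = x" "\<gamma> 1 = y"
    "(speed A g \<gamma> has_integral l) {0..1}" "\<forall>t\<in>{0..1}. \<gamma> t \<in> topspace X"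
    by (rule joinsE) (rule that)
  from assms(2) obtain S' where j': "continuous_map (top_of_set {0..1}) X \<gamma>'" "finite S'"
    "\<forall>t\<in>{0<..<1} - S'. regular_at A \<gamma>' t" "\<gamma>' 0 = y" "\<gamma>' 1 = z"
    "(speed A g \<gamma>' has_integral l') {0..1}" "\<forall>t\<in>{0..1}. \<gamma>' t \<in> topspace X"
    by (rule joinsE) (rule that)
  let ?S = "insert (1/2) ((\<lambda>t. t / 2) ` S \<union> (\<lambda>t. (t + 1) / 2) ` S')"
  have reg1: "regular_at A ?\<gamma> t \<and> speed A g ?\<gamma> t = 2 * speed A g \<gamma> (2 * t)"
    if t: "0 < t" "t < 1/2" "t \<notin> ?S" for t
  proof -
    have "t \<in> (\<lambda>t. t / 2) ` S" if "2 * t \<in> S"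
      using that by (intro image_eqI[of _ _ "2 * t"]) simp_all
    then have "2 * t \<in> {0<..<1} - S"
      using t by auto
    then show ?thesis
      using j(3,7) t regular_reparam[of \<gamma> 2 t 0 "1/2 - t" ?\<gamma>] by simp
  qed
  have reg2: "regular_at A ?\<gamma> t \<and> speed A g ?\<gamma> t = 2 * speed A g \<gamma>' (2 * t - 1)"
    if t: "1/2 < t" "t < 1" "t \<notin> ?S" for t
  proof -
    have "t \<in> (\<lambda>t. (t + 1) / 2) ` S'" if "2 * t - 1 \<in> S'"
      using that by (intro image_eqI[of _ _ "2 * t - 1"]) simp_all
    then have "2 * t - 1 \<in> {0<..<1} - S'"
      using t by auto
    then show ?thesis
      using j'(3,7) t regular_reparam[of \<gamma>' 2 t "-1" "t - 1/2" ?\<gamma>] by simp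
  qed
  have c: "continuous_map (top_of_set {0..1}) X ?\<gamma>"
  proof (rule continuous_map_cases_le[where p = "\<lambda>t. t" and q = "\<lambda>t. 1/2"])
    let ?T = "\<lambda>P. subtopology (top_of_set {0..1::real}) {t \<in> topspace (top_of_set {0..1}). P t}"
    have "continuous_map (?T (\<lambda>t. t \<le> 1/2)) (top_of_set {0..1}) (\<lambda>t. 2 * t)"
      unfolding subtopology_subtopology by (auto intro!: continuous_intros)
    from continuous_map_compose[OF this j(1)]
    show "continuous_map (?T (\<lambda>t. t \<le> 1/2)) X (\<lambda>t. \<gamma> (2 * t))"
      by (simp add: o_def)
    have "continuous_map (?T (\<lambda>t. 1/2 \<le> t)) (top_of_set {0..1}) (\<lambda>t. 2 * t - 1)"
      unfolding subtopology_subtopology by (auto intro!: continuous_intros)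
    from continuous_map_compose[OF this j'(1)]
    show "continuous_map (?T (\<lambda>t. 1/2 \<le> t)) X (\<lambda>t. \<gamma>' (2 * t - 1))"
      by (simp add: o_def)
    show "\<gamma> (2 * t) = \<gamma>' (2 * t - 1)" if "t = 1/2" for t
      unfolding that using j(5) j'(4) by simp
  qed auto
  have fin: "finite ?S" "finite (insert 0 (insert 1 ?S))"
    using j(2) j'(2) by simp_all
  have "((\<lambda>t. 2 * speed A g \<gamma> (2 * t)) has_integral l) {0..1/2}"
    using has_integral_mult_right[OF has_integral_affinity'[of "speed A g \<gamma>" l 0 1 2 0], of 2] j(6) by simp
  then have i1: "(speed A g ?\<gamma> has_integral l) {0..1/2}"
    by (rule has_integral_spike_finite[OF fin(2), rotated]) (use reg1 in auto)
  have "((\<lambda>t. 2 * speed A g \<gamma>' (2 * t - 1)) has_integral l') {1/2..1}"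
    using has_integral_mult_right[OF has_integral_affinity'[of "speed A g \<gamma>'" l' 0 1 2 "-1"], of 2]
        j'(6) by simp
  then have i2: "(speed A g ?\<gamma> has_integral l') {1/2..1}"
    by (rule has_integral_spike_finite[OF fin(2), rotated]) (use reg2 in auto)
  have "(speed A g ?\<gamma> has_integral l + l') {0..1}"
    by (rule has_integral_combine[OF _ _ i1 i2]) simp_all
  moreover have "regular_at A ?\<gamma> t" if "t \<in> {0<..<1} - ?S" for t
    using that reg1[of t] reg2[of t] by (cases "t < 1/2") auto
  ultimately show ?thesis
    unfolding joins_def piecewise_C1_curve_iff using c fin(1) j(4) j'(5) by (intro conjI exI[of _ ?S]) auto
qed

abbreviation rdist :: "'m \<Rightarrow> 'm \<Rightarrow> real" where
  "rdist \<equiv> riemannian_dist X A g"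

lemma rdist_eq:
  "x \<in> topspace X \<Longrightarrow> y \<in> topspace X \<Longrightarrow> rdist x y = Inf {l. \<exists>\<gamma>. joins \<gamma> x y l}"
  by (simp add: riemannian_dist_def joins_def)

lemma rdist_le: "joins \<gamma> x y l \<Longrightarrow> rdist x y \<le> l"
proof -
  assume j: "joins \<gamma> x y l"
  have "bdd_below {l. \<exists>\<gamma>. joins \<gamma> x y l}"
    using joins_nonneg by (auto intro!: bdd_belowI[of _ 0])
  then show ?thesis
    using j joins_topspace[OF j] by (auto simp: rdist_eq intro!: cInf_lower)
qed

lemma rdist_ge:
  assumes "joins \<gamma>0 x y l0" "\<And>\<gamma> l. joins \<gamma> x y l \<Longrightarrow> b \<le> l"
  shows "b \<le> rdist x y"
  unfolding rdist_eq[OF joins_topspace[OF assms(1), THEN conjunct1] joins_topspace[OF assms(1), THEN conjunct2]]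
  by (rule cInf_greatest) (use assms in auto)

text \<open>Functions whose differential is bounded by a multiple of the metric are Lipschitz for the
  distance.  They provide all the lower bounds for distances below.\<close>

definition lipschitz_gradient :: "real \<Rightarrow> ('m \<Rightarrow> 'b::euclidean_space) \<Rightarrow> bool" where
  "lipschitz_gradient L f \<longleftrightarrow> continuous_map X euclidean f \<and>
     (\<forall>c\<in>A. \<forall>m\<in>fst c. \<exists>D. ((\<lambda>y. f (inv_into (fst c) (snd c) y)) has_derivative D) (at (snd c m)) \<and>
        (\<forall>v. norm (D v) \<le> L * sqrt (g c m v v)))"

lemma lipschitz_gradient_joins:
  fixes f :: "'m \<Rightarrow> 'b::euclidean_space"
  assumes f: "lipschitz_gradient L f" and "joins \<gamma> x y l"
  shows "norm (f y - f x) \<le> L * l"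
proof -
  from assms(2) obtain S where j: "continuous_map (top_of_set {0..1}) X \<gamma>" "finite S"
    "\<forall>t\<in>{0<..<1} - S. regular_at A \<gamma> t" "\<gamma> 0 = x" "\<gamma> 1 = y"
    "(speed A g \<gamma> has_integral l) {0..1}" "\<forall>t\<in>{0..1}. \<gamma> t \<in> topspace X"
    by (rule joinsE) (rule that)
  have "\<exists>E. ((\<lambda>t. f (\<gamma> t)) has_vector_derivative E) (at t) \<and> norm E \<le> L * speed A g \<gamma> t"
    if t: "t \<in> {0<..<1} - S" for t
  proof -
    define c where "c = (SOME c. c \<in> A \<and> \<gamma> t \<in> fst c)"
    have "\<gamma> t \<in> topspace X"
      using j(7) t by simp
    from some_chart[OF this] have c: "c \<in> A" "\<gamma> t \<in> fst c"
      by (auto simp: c_def)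
    obtain D where D: "((\<lambda>y. f (inv_into (fst c) (snd c) y)) has_derivative D) (at (snd c (\<gamma> t)))"
      "\<forall>v. norm (D v) \<le> L * sqrt (g c (\<gamma> t) v v)"
      using f c unfolding lipschitz_gradient_def by blast
    have "regular_at A \<gamma> t"
      using j(3) t by (rule bspec)
    then obtain \<epsilon> where e: "\<epsilon> > 0" "(snd c \<circ> \<gamma>) C1_differentiable_on {t-\<epsilon><..<t+\<epsilon>}"
      using c unfolding regular_at_def by auto
    obtain E' where "\<forall>s\<in>{t-\<epsilon><..<t+\<epsilon>}. (snd c \<circ> \<gamma> has_vector_derivative E' s) (at s)"
      using e(2) unfolding C1_differentiable_on_def by (elim exE conjE)
    then have E: "(snd c \<circ> \<gamma> has_vector_derivative E' t) (at t)"
      using e(1) by simp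
    define E where "E = E' t"
    note E = E[folded E_def]
    have "openin (top_of_set {0..1}) {s \<in> {0..1}. \<gamma> s \<in> fst c}"
      using openin_continuous_map_preimage[OF j(1) openin_chart[OF c(1)]] by simp
    then obtain W where W: "open W" "{s \<in> {0..1}. \<gamma> s \<in> fst c} = {0..1} \<inter> W"
      unfolding openin_open by (elim exE conjE)
    have "t \<in> {s \<in> {0..1}. \<gamma> s \<in> fst c}"
      using t c(2) by simp
    then have tW: "t \<in> W \<inter> {0<..<1}"
      using t unfolding W(2) by simp
    have "((\<lambda>y. f (inv_into (fst c) (snd c) y)) \<circ> (snd c \<circ> \<gamma>) has_vector_derivative D E) (at t)"
    proof (rule vector_derivative_diff_chain_within[OF E has_derivative_at_withinI])
      show "((\<lambda>y. f (inv_into (fst c) (snd c) y)) has_derivative D) (at ((snd c \<circ> \<gamma>) t))"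
        using D(1) by (simp only: o_apply)
    qed
    then have "((\<lambda>t. f (\<gamma> t)) has_vector_derivative D E) (at t)"
    proof (rule has_vector_derivative_transform_within_open[OF _ _ tW])
      fix s assume "s \<in> W \<inter> {0<..<1}"
      then have "s \<in> {s \<in> {0..1}. \<gamma> s \<in> fst c}"
        unfolding W(2) by simp
      then have "\<gamma> s \<in> fst c"
        by simp
      then show "((\<lambda>y. f (inv_into (fst c) (snd c) y)) \<circ> (snd c \<circ> \<gamma>)) s = f (\<gamma> s)"
        using inv_chart_coord[OF c(1)] by simp
    qed (use W(1) in \<open>simp add: open_Int\<close>)
    moreover have "speed A g \<gamma> t = sqrt (g c (\<gamma> t) E E)"
      using vector_derivative_at[OF E] by (simp add: speed_def Let_def c_def)
    ultimately show ?thesis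
      using D(2) by (intro exI[of _ "D E"]) simp
  qed
  then obtain E where E: "\<And>t. t \<in> {0<..<1} - S \<Longrightarrow> ((\<lambda>t. f (\<gamma> t)) has_vector_derivative E t) (at t)"
    "\<And>t. t \<in> {0<..<1} - S \<Longrightarrow> norm (E t) \<le> L * speed A g \<gamma> t"
    by metis
  \<comment> \<open>At the finitely many exceptional times nothing is known about \<open>E\<close>, and both integrands are set to 0.\<close>
  define E' where "E' t = (if t \<in> {0<..<1} - S then E t else 0)" for t
  have "continuous_map (top_of_set {0..1}) euclidean (f \<circ> \<gamma>)"
    using f by (intro continuous_map_compose[OF j(1)]) (simp add: lipschitz_gradient_def)
  then have "(E has_integral (f (\<gamma> 1) - f (\<gamma> 0))) {0..1}"
    by (intro fundamental_theorem_of_calculus_interior_strong[OF j(2) _ E(1)]) (simp_all add: o_def)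
  then have i: "(E' has_integral (f y - f x)) {0..1}"
    unfolding j(4,5)
    by (rule has_integral_spike_finite[rotated 2, where S = "insert 0 (insert 1 S)"])
      (use j(2) in \<open>auto simp: E'_def\<close>)
  define s where "s t = (if t \<in> {0<..<1} - S then L * speed A g \<gamma> t else 0)" for t
  have i': "(s has_integral L * l) {0..1}"
    by (rule has_integral_spike_finite[OF _ _ has_integral_mult_right[OF j(6)], where S = "insert 0
        (insert 1 S)"])
      (use j(2) in \<open>auto simp: s_def\<close>)
  have "norm (integral {0..1} E') \<le> integral {0..1} s"
    by (rule integral_norm_bound_integral) (use i i' E(2) in \<open>auto simp: E'_def s_def integrable_on_def\<close>)
  then show ?thesis
    using integral_unique[OF i] integral_unique[OF i'] by simp
qed

text \<open>Segments in a chart provide curves with an estimate of their length.  The speed is defined with an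
  arbitrary chart at each point, so the tensor rule is needed to evaluate it in the given one.\<close>

lemma joins_segment:
  assumes c: "c \<in> A" and K: "K \<subseteq> snd c ` fst c" "convex K" "y \<in> K" "y' \<in> K"
  obtains \<gamma> l where "joins \<gamma> (inv_into (fst c) (snd c) y) (inv_into (fst c) (snd c) y') l"
    "\<And>C. (\<And>z. z \<in> K \<Longrightarrow> sqrt (g c (inv_into (fst c) (snd c) z) (y' - y) (y' - y)) \<le> C) \<Longrightarrow> l \<le> C"
proof -
  define w where "w = y' - y"
  define \<gamma> where "\<gamma> t = inv_into (fst c) (snd c) (y + t *\<^sub>R w)" for t :: real
  let ?s = "\<lambda>t. sqrt (g c (\<gamma> t) w w)"
  have inK: "y + t *\<^sub>R w \<in> K" if "t \<in> {0..1}" for t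
  proof -
    have "(1 - t) *\<^sub>R y + t *\<^sub>R y' \<in> K"
      using that K(2,3,4) by (intro convexD) auto
    then show ?thesis
      by (simp add: w_def algebra_simps)
  qed
  have into: "\<gamma> t \<in> fst c" "snd c (\<gamma> t) = y + t *\<^sub>R w" if "t \<in> {0..1}" for t
    using inK[OF that] K(1) inv_chart_into[of "y + t *\<^sub>R w" c] chart_inv_chart[of "y + t *\<^sub>R w" c]
    by (auto simp: \<gamma>_def)
  have cl: "continuous_on {0..1} (\<lambda>t. y + t *\<^sub>R w)"
    by (intro continuous_intros)
  have cont: "continuous_map (top_of_set {0..1}) X \<gamma>"
  proof -
    have "continuous_map (top_of_set {0..1}) (top_of_set (snd c ` fst c)) (\<lambda>t. y + t *\<^sub>R w)"
      using cl inK K(1) by auto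
    from continuous_map_compose[OF this continuous_map_inv_chart[OF c]] show ?thesis
      by (simp add: o_def \<gamma>_def[abs_def])
  qed
  have *: "regular_at A \<gamma> t \<and> speed A g \<gamma> t = ?s t" if t: "t \<in> {0<..<1}" for t
  proof -
    have t': "t \<in> {0..1}"
      using t by simp
    have reg: "\<exists>\<epsilon>>0. (snd c' \<circ> \<gamma>) C1_differentiable_on {t-\<epsilon><..<t+\<epsilon>}"
      and der: "(local_rep c c' (\<lambda>m. m) has_derivative D) (at (snd c (\<gamma> t))) \<Longrightarrow>
        (snd c' \<circ> \<gamma> has_vector_derivative D w) (at t)"
      if c': "c' \<in> A" "\<gamma> t \<in> fst c'" for c' D
    proof -
      let ?U = "local_dom c c' (\<lambda>m. m)" and ?F = "local_rep c c' (\<lambda>m. m)"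
      have "open ((\<lambda>t. y + t *\<^sub>R w) -` ?U)"
        by (intro open_vimage open_overlap c c' continuous_intros)
      then have o: "open ((\<lambda>t. y + t *\<^sub>R w) -` ?U \<inter> {0<..<1})"
        by (simp add: open_Int)
      moreover have tU: "t \<in> (\<lambda>t. y + t *\<^sub>R w) -` ?U \<inter> {0<..<1}"
        using t c'(2) into[OF t'] by (auto simp: local_dom_def intro!: rev_image_eqI[of "\<gamma> t"])
      ultimately obtain \<epsilon> where e: "\<epsilon> > 0" "ball t \<epsilon> \<subseteq> (\<lambda>t. y + t *\<^sub>R w) -` ?U \<inter> {0<..<1}"
        by (rule openE)
      have ball: "ball t \<epsilon> = {t-\<epsilon><..<t+\<epsilon>}"
        by (auto simp: dist_real_def)
      have eq: "?F (y + s *\<^sub>R w) = (snd c' \<circ> \<gamma>) s" for s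
        by (simp add: local_rep_def \<gamma>_def)
      have "smooth_on {t-\<epsilon><..<t+\<epsilon>} (\<lambda>s. ?F (y + s *\<^sub>R w))"
      proof (rule smooth_on_compose[OF smooth_transition[OF c c'(1)]])
        show "smooth_on {t-\<epsilon><..<t+\<epsilon>} (\<lambda>s. y + s *\<^sub>R w)"
          by (intro smooth_intros)
        show "(\<lambda>s. y + s *\<^sub>R w) ` {t-\<epsilon><..<t+\<epsilon>} \<subseteq> ?U"
          using e(2) unfolding ball by auto
      qed
      then have "(\<lambda>s. ?F (y + s *\<^sub>R w)) C1_differentiable_on {t-\<epsilon><..<t+\<epsilon>}"
        by (rule smooth_on_C1_differentiable)
      then have "(snd c' \<circ> \<gamma>) C1_differentiable_on {t-\<epsilon><..<t+\<epsilon>}"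
        unfolding eq by (simp add: o_def)
      with e(1) show "\<exists>\<epsilon>>0. (snd c' \<circ> \<gamma>) C1_differentiable_on {t-\<epsilon><..<t+\<epsilon>}"
        by blast
      assume D: "(?F has_derivative D) (at (snd c (\<gamma> t)))"
      have "((\<lambda>t. y + t *\<^sub>R w) has_vector_derivative w) (at t)"
        by (auto intro!: derivative_eq_intros)
      moreover have "(?F has_derivative D) (at (y + t *\<^sub>R w) within range (\<lambda>t. y + t *\<^sub>R w))"
        using D unfolding into(2)[OF t'] by (rule has_derivative_at_withinI)
      ultimately have "(?F \<circ> (\<lambda>t. y + t *\<^sub>R w) has_vector_derivative D w) (at t)"
        by (rule vector_derivative_diff_chain_within)
      moreover have "?F \<circ> (\<lambda>t. y + t *\<^sub>R w) = snd c' \<circ> \<gamma>"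
        by (rule ext) (simp only: eq o_apply)
      ultimately show "(snd c' \<circ> \<gamma> has_vector_derivative D w) (at t)"
        by simp
    qed
    have "speed A g \<gamma> t = ?s t"
    proof -
      define c' where "c' = (SOME c. c \<in> A \<and> \<gamma> t \<in> fst c)"
      have c': "c' \<in> A" "\<gamma> t \<in> fst c'"
        using some_chart[of "\<gamma> t"] chart_subset[OF c] into(1)[OF t'] by (auto simp: c'_def)
      obtain D where D: "(local_rep c c' (\<lambda>m. m) has_derivative D) (at (snd c (\<gamma> t)))"
        "\<And>v w. g c' (\<gamma> t) (D v) (D w) = g c (\<gamma> t) v w"
        by (rule metric_tensorial[OF c c'(1) into(1)[OF t'] c'(2)]) (rule that)
      show ?thesis
        using vector_derivative_at[OF der[OF c' D(1)]] D(2) by (simp add: speed_def Let_def c'_def)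
    qed
    then show ?thesis
      using reg unfolding regular_at_def by simp
  qed
  have "continuous_on {0..1} ?s"
  proof (intro continuous_on_real_sqrt continuous_on_compose2[OF smooth_on_continuous[OF
      smooth_metric[OF c, of w w]] cl, folded \<gamma>_def])
    show "(\<lambda>t. y + t *\<^sub>R w) ` {0..1} \<subseteq> snd c ` fst c"
      using inK K(1) by auto
  qed
  then have int: "?s integrable_on {0..1}"
    by (rule integrable_continuous_real)
  then have "(?s has_integral integral {0..1} ?s) {0..1}"
    by (rule integrable_integral)
  then have "(speed A g \<gamma> has_integral integral {0..1} ?s) {0..1}"
    by (rule has_integral_spike_finite[rotated 2, where S = "{0, 1}"]) (use * in auto)
  then have "joins \<gamma> (inv_into (fst c) (snd c) y) (inv_into (fst c) (snd c) y') (integral {0..1} ?s)"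
    unfolding joins_def piecewise_C1_curve_iff using cont *
    by (intro conjI exI[of _ "{}"]) (simp_all add: \<gamma>_def w_def)
  moreover have "integral {0..1} ?s \<le> C"
    if "\<And>z. z \<in> K \<Longrightarrow> sqrt (g c (inv_into (fst c) (snd c) z) (y' - y) (y' - y)) \<le> C" for C
  proof -
    have "integral {0..1} ?s \<le> integral {0..1} (\<lambda>t::real. C)"
      by (rule integral_le[OF int]) (use that inK in \<open>auto simp: \<gamma>_def w_def\<close>)
    then show ?thesis
      by simp
  qed
  ultimately show thesis
    by (rule that)
qed

lemma joins_in_convex_chart:
  assumes c: "c \<in> A" "convex (snd c ` fst c)" "x \<in> fst c" "y \<in> fst c"
  shows "\<exists>\<gamma> l. joins \<gamma> x y l"
proof -
  obtain \<gamma> l where "joins \<gamma> (inv_into (fst c) (snd c) (snd c x)) (inv_into (fst c) (snd c) (snd c y)) l"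
    by (rule joins_segment[OF c(1) subset_refl c(2), of "snd c x" "snd c y"]) (use c in auto)
  then show ?thesis
    using inv_chart_coord[OF c(1)] c(3,4) by auto
qed

lemma metric_bounded_on_compact:
  assumes c: "c \<in> A" and K: "compact K" "K \<subseteq> snd c ` fst c"
  obtains C where "C > 0" "\<And>y v. y \<in> K \<Longrightarrow> sqrt (g c (inv_into (fst c) (snd c) y) v v) \<le> C * norm v"
proof -
  let ?g = "\<lambda>y. g c (inv_into (fst c) (snd c) y)"
  let ?B = "\<lambda>y. \<Sum>a\<in>Basis. \<Sum>b\<in>Basis. \<bar>?g y a b\<bar>"
  have "continuous_on K ?B"
    by (intro continuous_on_sum continuous_on_rabs
        continuous_on_subset[OF smooth_on_continuous[OF smooth_metric[OF c]] K(2)])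
  from compact_imp_bounded[OF compact_continuous_image[OF this K(1)]]
  obtain M where M: "M > 0" "\<forall>y\<in>K. \<bar>?B y\<bar> \<le> M"
    by (auto simp: bounded_pos)
  have "sqrt (?g y v v) \<le> sqrt M * norm v" if y: "y \<in> K" for y v
  proof -
    have in_c: "inv_into (fst c) (snd c) y \<in> fst c"
      using K(2) y by (intro inv_chart_into) auto
    have bil: "bilinear (?g y)"
      by (rule bilinear_metric[OF c in_c])
    have "?g y v v = ?g y (\<Sum>a\<in>Basis. (v \<bullet> a) *\<^sub>R a) (\<Sum>b\<in>Basis. (v \<bullet> b) *\<^sub>R b)"
      by (simp add: euclidean_representation)
    also have "\<dots> = (\<Sum>(a, b)\<in>Basis \<times> Basis. ?g y ((v \<bullet> a) *\<^sub>R a) ((v \<bullet> b) *\<^sub>R b))"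
      by (rule bilinear_sum[OF bil])
    also have "\<dots> = (\<Sum>a\<in>Basis. \<Sum>b\<in>Basis. (v \<bullet> a) * ((v \<bullet> b) * ?g y a b))"
      by (simp add: sum.cartesian_product bilinear_lmul[OF bil] bilinear_rmul[OF bil] mult.left_commute)
    also have "\<dots> \<le> (\<Sum>a\<in>Basis. \<Sum>b\<in>Basis. (norm v)\<^sup>2 * \<bar>?g y a b\<bar>)"
    proof (intro sum_mono)
      fix a b :: 'e assume ab: "a \<in> Basis" "b \<in> Basis"
      have "(v \<bullet> a) * ((v \<bullet> b) * ?g y a b) \<le> \<bar>v \<bullet> a\<bar> * (\<bar>v \<bullet> b\<bar> * \<bar>?g y a b\<bar>)"
        by (metis abs_ge_self abs_mult)
      also have "\<dots> \<le> norm v * (norm v * \<bar>?g y a b\<bar>)"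
        using Basis_le_norm[OF ab(1), of v] Basis_le_norm[OF ab(2), of v] by (intro mult_mono) auto
      finally show "(v \<bullet> a) * ((v \<bullet> b) * ?g y a b) \<le> (norm v)\<^sup>2 * \<bar>?g y a b\<bar>"
        by (simp add: power2_eq_square)
    qed
    also have "\<dots> = (norm v)\<^sup>2 * ?B y"
      by (simp add: sum_distrib_left)
    also have "\<dots> \<le> (norm v)\<^sup>2 * M"
      using M(2) y by (intro mult_left_mono) auto
    finally have "sqrt (?g y v v) \<le> sqrt ((norm v)\<^sup>2 * M)"
      by (rule real_sqrt_le_mono)
    then show ?thesis
      by (simp add: real_sqrt_mult mult.commute)
  qed
  then show thesis
    using M(1) by (intro that[of "sqrt M"]) simp_all
qed

text \<open>The manifold topology is at least as fine as the metric topology: coordinate balls contain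
  short segments.\<close>

lemma rdist_locally_small:
  assumes m: "m \<in> topspace X" and r: "r > 0"
  obtains V where "openin X V" "m \<in> V" "\<And>m'. m' \<in> V \<Longrightarrow> rdist m m' < r"
proof -
  obtain c where c: "c \<in> A" "m \<in> fst c"
    by (rule chart_cover[OF m]) (rule that)
  let ?y = "snd c m"
  obtain \<delta> where d: "\<delta> > 0" "cball ?y \<delta> \<subseteq> snd c ` fst c"
    using open_chart_image[OF c(1)] c(2) open_contains_cball by blast
  obtain C where C: "C > 0" "\<And>y v. y \<in> cball ?y \<delta> \<Longrightarrow> sqrt (g c (inv_into (fst c) (snd c) y) v v) \<le> C * norm v"
    by (rule metric_bounded_on_compact[OF c(1) compact_cball d(2)]) (rule that)
  define e where "e = min \<delta> (r / C)"
  show thesis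
  proof (rule that)
    show "openin X {m' \<in> fst c. snd c m' \<in> ball ?y e}"
      by (rule openin_chart_preimage[OF c(1)]) simp
    show "m \<in> {m' \<in> fst c. snd c m' \<in> ball ?y e}"
      using c(2) d(1) C(1) r by (simp add: e_def)
    fix m' assume m': "m' \<in> {m' \<in> fst c. snd c m' \<in> ball ?y e}"
    then have y': "snd c m' \<in> cball ?y \<delta>" and less: "norm (snd c m' - ?y) < r / C"
      by (auto simp: e_def dist_norm norm_minus_commute)
    obtain \<gamma> l where jl: "joins \<gamma> (inv_into (fst c) (snd c) ?y) (inv_into (fst c) (snd c) (snd c m')) l"
      "\<And>B. (\<And>z. z \<in> cball ?y \<delta> \<Longrightarrow>
          sqrt (g c (inv_into (fst c) (snd c) z) (snd c m' - ?y) (snd c m' - ?y)) \<le> B) \<Longrightarrow> l \<le> B"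
      by (rule joins_segment[OF c(1) d(2) convex_cball, of ?y "snd c m'"]) (use d(1) y' in auto)
    have "l \<le> C * norm (snd c m' - ?y)"
      by (rule jl(2)) (rule C(2))
    also have "\<dots> < r"
      using less C(1) by (simp add: field_simps)
    finally have "l < r" .
    moreover have "joins \<gamma> m m' l"
      using jl(1) inv_chart_coord[OF c(1)] c(2) m' by simp
    ultimately show "rdist m m' < r"
      using rdist_le by fastforce
  qed
qed

text \<open>If the manifold is connected by curves of finite length and carries a proper function with
  bounded gradient, bounded sets are relatively compact, and completeness follows as for Euclidean
  space.  Point separation by functions with bounded gradient makes the distance definite.\<close>

theorem complete_riemannianI:
  fixes \<rho> :: "'m \<Rightarrow> real" and F :: "'m \<Rightarrow> 'b::euclidean_space"
  assumes joined: "\<And>x y. x \<in> topspace X \<Longrightarrow> y \<in> topspace X \<Longrightarrow> \<exists>\<gamma> l. joins \<gamma> x y l"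
    and F: "lipschitz_gradient L F" "inj_on F (topspace X)"
    and \<rho>: "lipschitz_gradient 1 \<rho>" and proper: "\<And>R. compactin X {m \<in> topspace X. \<rho> m \<le> R}"
  shows "complete_riemannian X A g"
proof -
  interpret Metric_space "topspace X" rdist
  proof
    fix x y z
    show nonneg: "0 \<le> rdist x y" for x y
    proof (cases "x \<in> topspace X \<and> y \<in> topspace X")
      case True
      then obtain \<gamma> l where "joins \<gamma> x y l"
        using joined by blast
      then show ?thesis
        by (rule rdist_ge) (rule joins_nonneg)
    qed (auto simp: riemannian_dist_def)
    show "rdist x y = rdist y x"
    proof -
      have "{l. \<exists>\<gamma>. joins \<gamma> x y l} = {l. \<exists>\<gamma>. joins \<gamma> y x l}"
        using joins_reverse by blast
      then show ?thesis
        by (cases "x \<in> topspace X \<and> y \<in> topspace X") (simp_all add: rdist_eq, auto simp: riemannian_dist_def)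
    qed
    assume x: "x \<in> topspace X" and y: "y \<in> topspace X"
    obtain \<gamma> l where j: "joins \<gamma> x y l"
      using joined x y by blast
    show "rdist x y = 0 \<longleftrightarrow> x = y"
    proof
      assume 0: "rdist x y = 0"
      \<comment> \<open>\<open>L\<close> may be zero or negative, but \<open>\<bar>L\<bar> + 1\<close> is a positive Lipschitz constant as well.\<close>
      have "norm (F y - F x) / (\<bar>L\<bar> + 1) \<le> rdist x y"
      proof (rule rdist_ge[OF j])
        fix \<gamma> l assume j: "joins \<gamma> x y l"
        have "norm (F y - F x) \<le> L * l"
          by (rule lipschitz_gradient_joins[OF F(1) j])
        also have "\<dots> \<le> (\<bar>L\<bar> + 1) * l"
          using joins_nonneg[OF j] by (intro mult_right_mono) auto
        finally show "norm (F y - F x) / (\<bar>L\<bar> + 1) \<le> l"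
          by (subst pos_divide_le_eq) (auto simp: mult.commute)
      qed
      then have "norm (F y - F x) / (\<bar>L\<bar> + 1) \<le> 0"
        using 0 by simp
      then have "norm (F y - F x) \<le> 0"
        by (subst (asm) pos_divide_le_eq) auto
      then show "x = y"
        using F(2) x y by (auto dest: inj_onD)
    next
      assume "x = y"
      then show "rdist x y = 0"
        using rdist_le[OF joins_refl[OF x]] nonneg[of x y] by simp
    qed
    assume z: "z \<in> topspace X"
    obtain \<gamma>' l' where j': "joins \<gamma>' y z l'"
      using joined y z by blast
    have *: "rdist x z - l \<le> rdist y z" if jl: "joins \<gamma> x y l" for \<gamma> l
    proof (rule rdist_ge[OF j'])
      fix \<gamma>' l' assume "joins \<gamma>' y z l'"
      from rdist_le[OF joins_concat[OF jl this]] show "rdist x z - l \<le> l'"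
        by simp
    qed
    have "rdist x z - rdist y z \<le> rdist x y"
      by (rule rdist_ge[OF j]) (use * in force)
    then show "rdist x z \<le> rdist x y + rdist y z"
      by simp
  qed
  have id: "continuous_map X mtopology (\<lambda>m. m)"
    unfolding continuous_map
  proof (intro conjI allI impI)
    fix U assume U: "openin mtopology U"
    have "\<exists>V. openin X V \<and> m \<in> V \<and> V \<subseteq> U" if m: "m \<in> U" for m
    proof -
      have mt: "m \<in> topspace X"
        using openin_subset[OF U] m by auto
      obtain r where r: "r > 0" "mball m r \<subseteq> U"
        using U m unfolding openin_mtopology by blast
      obtain V where V: "openin X V" "m \<in> V" "\<And>m'. m' \<in> V \<Longrightarrow> rdist m m' < r"
        by (rule rdist_locally_small[OF mt r(1)]) (rule that)
      have "V \<subseteq> mball m r"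
        using openin_subset[OF V(1)] V(3) mt by auto
      then show ?thesis
        using V(1,2) r(2) by blast
    qed
    then have "openin X U"
      by (subst openin_subopen) blast
    moreover have "{x \<in> topspace X. x \<in> U} = U"
      using openin_subset[OF U] by auto
    ultimately show "openin X {x \<in> topspace X. x \<in> U}"
      by simp
  qed simp
  have "mcomplete"
    unfolding mcomplete_def
  proof (intro allI impI)
    fix \<sigma> assume Cauchy: "MCauchy \<sigma>"
    then have ran: "\<sigma> n \<in> topspace X" for n
      by (auto simp: MCauchy_def)
    obtain N where N: "\<forall>n n'. N \<le> n \<longrightarrow> N \<le> n' \<longrightarrow> rdist (\<sigma> n) (\<sigma> n') < 1"
      using Cauchy unfolding MCauchy_def by (metis zero_less_one)
    \<comment> \<open>The tail of the sequence after \<open>N\<close> stays in this compact set.\<close>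
    let ?K = "{m \<in> topspace X. \<rho> m \<le> \<rho> (\<sigma> N) + 1}"
    have "\<sigma> (N + n) \<in> ?K" for n
    proof -
      obtain \<gamma> l where j: "joins \<gamma> (\<sigma> N) (\<sigma> (N + n)) l"
        using joined[OF ran ran] by blast
      have "norm (\<rho> (\<sigma> (N + n)) - \<rho> (\<sigma> N)) \<le> rdist (\<sigma> N) (\<sigma> (N + n))"
        using lipschitz_gradient_joins[OF \<rho>] by (intro rdist_ge[OF j]) simp
      also have "\<dots> < 1"
        using N by simp
      finally show ?thesis
        using ran[of "N + n"] by (auto simp: abs_if split: if_splits)
    qed
    then have "range (\<lambda>n. \<sigma> (N + n)) \<subseteq> ?K"
      by blast
    moreover have "compactin mtopology ?K"
      using image_compactin[OF proper id] by simp
    ultimately obtain x r where r: "strict_mono r" "limitin mtopology ((\<lambda>n. \<sigma> (N + n)) \<circ> r) x sequentially"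
      unfolding compactin_sequentially by meson
    have "strict_mono (\<lambda>n. N + r n)"
      using r(1) by (simp add: strict_mono_def)
    moreover have "limitin mtopology (\<sigma> \<circ> (\<lambda>n. N + r n)) x sequentially"
      using r(2) by (simp add: o_def)
    ultimately show "\<exists>x. limitin mtopology \<sigma> x sequentially"
      using MCauchy_convergent_subsequence[OF Cauchy] by blast
  qed
  then show ?thesis
    unfolding complete_riemannian_def using metric Metric_space_axioms by blast
qed

end

section \<open>Charts of the disk bundle\<close>

lemma smooth_on_sgn [smooth_intros]:
  fixes f :: "'a::euclidean_space \<Rightarrow> complex"
  assumes "smooth_on S f" "\<And>x. x \<in> S \<Longrightarrow> f x \<noteq> 0"
  shows "smooth_on S (\<lambda>x. sgn (f x))"
proof -
  have "smooth_on S (\<lambda>x. inverse (sqrt ((norm (f x))\<^sup>2)) *\<^sub>R f x)"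
    by (intro smooth_intros assms) (use assms(2) in simp_all)
  then show ?thesis
    by (simp add: sgn_div_norm)
qed

lemma norm_complex_pair: "norm (a :: complex, b :: complex) = sqrt ((norm a)\<^sup>2 + (norm b)\<^sup>2)"
  by (simp add: norm_Pair)

lemma mem_disk_total:
  "((v1, v2), \<alpha>) \<in> disk_total \<longleftrightarrow> (norm v1)\<^sup>2 + (norm v2)\<^sup>2 = 1 \<and> norm \<alpha> < 1"
  by (simp add: disk_total_def norm_complex_pair)

text \<open>The disk factor is open, so a single real equation for \<open>v\<close> cuts out the total space; its values
  are placed on a real line of the ambient space, as the definition of a submanifold asks for a
  subspace.\<close>

lemma embedded_submanifold_disk_total: "embedded_submanifold disk_total"
  unfolding embedded_submanifold_def
proof
  fix x assume "x \<in> disk_total"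
  define h :: "(complex \<times> complex) \<times> complex \<Rightarrow> (complex \<times> complex) \<times> complex"
    where "h y = ((of_real ((norm (fst y))\<^sup>2 - 1), 0), 0)" for y
  define K :: "((complex \<times> complex) \<times> complex) set" where "K = range (\<lambda>r. ((of_real r, 0), 0))"
  have K: "subspace K"
    unfolding K_def by (intro linear_subspace_image linearI subspace_UNIV) (auto simp: scaleR_conv_of_real)
  have h: "smooth_on S h" for S
    unfolding h_def by (intro smooth_intros)
  have D: "(h has_derivative (\<lambda>u. ((of_real (2 * (fst y \<bullet> fst u)), 0), 0))) (at y)" for y
    unfolding h_def power2_norm_eq_inner
    by (auto intro!: derivative_eq_intros simp: inner_commute)
  have rng: "range (frechet_derivative h (at y)) = K" if "y \<in> disk_total" for y
  proof -
    have y: "fst y \<bullet> fst y = 1"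
      using that by (auto simp: disk_total_def dot_square_norm)
    have "((complex_of_real r, 0::complex), 0::complex) \<in>
      range (\<lambda>u::(complex \<times> complex) \<times> complex. ((of_real (2 * (fst y \<bullet> fst u)), 0), 0))" for r
      by (rule image_eqI[of _ _ "((r / 2) *\<^sub>R fst y, 0)"]) (simp_all add: y)
    then show ?thesis
      unfolding frechet_derivative_at[OF D, symmetric] K_def by (intro subset_antisym image_subsetI rangeI)
  qed
  have inter: "disk_total \<inter> (UNIV \<times> ball 0 1) = {y \<in> UNIV \<times> ball 0 1. h y = 0}"
  proof -
    have "h y = 0 \<longleftrightarrow> norm (fst y) = 1" for y
    proof -
      have "h y = 0 \<longleftrightarrow> complex_of_real ((norm (fst y))\<^sup>2 - 1) = 0"
        by (simp only: h_def zero_prod_def prod.inject) simp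
      also have "\<dots> \<longleftrightarrow> (norm (fst y))\<^sup>2 = 1"
        by (simp only: of_real_eq_0_iff) simp
      also have "\<dots> \<longleftrightarrow> norm (fst y) = 1"
        using power2_eq_iff_nonneg[of "norm (fst y)" 1] by simp
      finally show ?thesis .
    qed
    then show ?thesis
      by (auto simp: disk_total_def)
  qed
  have im: "h ` (UNIV \<times> ball 0 1) \<subseteq> K"
    unfolding h_def K_def by (intro image_subsetI rangeI)
  show "\<exists>W (h :: (complex \<times> complex) \<times> complex \<Rightarrow> (complex \<times> complex) \<times> complex) K.
      open W \<and> x \<in> W \<and> subspace K \<and> smooth_on W h \<and> h ` W \<subseteq> K \<and>
      disk_total \<inter> W = {y \<in> W. h y = 0} \<and> (\<forall>y\<in>disk_total \<inter> W. range (frechet_derivative h (at y)) = K)"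
  proof (rule exI[of _ "UNIV \<times> ball 0 1"], rule exI[of _ h], rule exI[of _ K], intro conjI K h im inter ballI)
    show "open (UNIV \<times> ball 0 1 :: ((complex \<times> complex) \<times> complex) set)"
      by (simp add: open_Times)
    show "x \<in> UNIV \<times> ball 0 1"
      using \<open>x \<in> disk_total\<close> by (auto simp: disk_total_def)
  qed (use rng in simp)
qed

definition disk_rot :: "nat \<Rightarrow> complex \<Rightarrow> (complex \<times> complex) \<times> complex \<Rightarrow> (complex \<times> complex) \<times> complex" where
  "disk_rot s \<tau> = (\<lambda>((v1, v2), \<alpha>). ((\<tau> * v1, \<tau> * v2), \<tau> ^ s * \<alpha>))"

lemma disk_orbit_eq: "disk_orbit s x = {disk_rot s \<tau> x | \<tau>. norm \<tau> = 1}"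
  by (cases x) (auto simp: disk_orbit_def disk_rot_def split: prod.splits)

lemma disk_rot_mult: "disk_rot s \<tau> (disk_rot s \<tau>' x) = disk_rot s (\<tau> * \<tau>') x"
  by (auto simp: disk_rot_def power_mult_distrib mult_ac split: prod.splits)

lemma disk_rot_1 [simp]: "disk_rot s 1 x = x"
  by (auto simp: disk_rot_def split: prod.splits)

lemma unit_orbit_eq_iff:
  fixes act :: "complex \<Rightarrow> 'a \<Rightarrow> 'a"
  assumes mult: "\<And>\<tau> \<tau>' x. act \<tau> (act \<tau>' x) = act (\<tau> * \<tau>') x" and one: "\<And>x. act 1 x = x"
  shows "{act \<tau> x | \<tau>. norm \<tau> = 1} = {act \<tau> y | \<tau>. norm \<tau> = 1} \<longleftrightarrow> (\<exists>\<tau>. norm \<tau> = 1 \<and> y = act \<tau> x)"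
proof
  assume "{act \<tau> x | \<tau>. norm \<tau> = 1} = {act \<tau> y | \<tau>. norm \<tau> = 1}"
  moreover have "y \<in> {act \<tau> y | \<tau>. norm \<tau> = 1}"
    by (rule CollectI, rule exI[of _ 1]) (simp add: one)
  ultimately have "y \<in> {act \<tau> x | \<tau>. norm \<tau> = 1}"
    by simp
  then show "\<exists>\<tau>. norm \<tau> = 1 \<and> y = act \<tau> x"
    by auto
next
  assume "\<exists>\<tau>. norm \<tau> = 1 \<and> y = act \<tau> x"
  then obtain \<tau> where t: "norm \<tau> = 1" "y = act \<tau> x"
    by (elim exE conjE)
  then have t0: "\<tau> \<noteq> 0"
    by auto
  have "\<exists>\<tau>''. act \<tau>' x = act (\<tau>'' * \<tau>) x \<and> norm \<tau>'' = 1" if "norm \<tau>' = 1" for \<tau>'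
    by (rule exI[of _ "\<tau>' / \<tau>"]) (use that t t0 in \<open>simp add: norm_divide\<close>)
  moreover have "\<exists>\<tau>''. act (\<tau>' * \<tau>) x = act \<tau>'' x \<and> norm \<tau>'' = 1" if "norm \<tau>' = 1" for \<tau>'
    by (rule exI[of _ "\<tau>' * \<tau>"]) (use that t in \<open>simp add: norm_mult\<close>)
  ultimately show "{act \<tau> x | \<tau>. norm \<tau> = 1} = {act \<tau> y | \<tau>. norm \<tau> = 1}"
    unfolding t(2) mult by (intro Set.set_eqI) (simp only: mem_Collect_eq, metis)
qed

lemma disk_orbit_eq_iff: "disk_orbit s x = disk_orbit s y \<longleftrightarrow> (\<exists>\<tau>. norm \<tau> = 1 \<and> y = disk_rot s \<tau> x)"
  unfolding disk_orbit_eq by (rule unit_orbit_eq_iff[OF disk_rot_mult disk_rot_1])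

lemma disk_orbit_rot: "norm \<tau> = 1 \<Longrightarrow> disk_orbit s (disk_rot s \<tau> x) = disk_orbit s x"
  by (metis disk_orbit_eq_iff)

lemma disk_rot_total: "norm \<tau> = 1 \<Longrightarrow> x \<in> disk_total \<Longrightarrow> disk_rot s \<tau> x \<in> disk_total"
  by (cases x) (auto simp: disk_rot_def mem_disk_total norm_mult norm_power)

lemma complex_unit_cnj: "norm (\<tau>::complex) = 1 \<Longrightarrow> \<tau> * cnj \<tau> = 1"
  by (simp add: complex_norm_square[symmetric])

lemma complex_unit_cnj_power: "norm (\<tau>::complex) = 1 \<Longrightarrow> \<tau> ^ s * cnj \<tau> ^ s = 1"
  by (simp add: power_mult_distrib[symmetric] complex_unit_cnj)

text \<open>Invariants separating the orbits: the Hopf map of \<open>v\<close> and the coordinates of the fibre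
  component relative to the two standard trivializations, cleared of denominators.\<close>

definition disk_invariants :: "nat \<Rightarrow> (complex \<times> complex) \<times> complex \<Rightarrow> (real \<times> complex) \<times> complex \<times> complex" where
  "disk_invariants s = (\<lambda>((v1, v2), \<alpha>). (((norm v1)\<^sup>2, v1 * cnj v2), \<alpha> * cnj v1 ^ s, \<alpha> * cnj v2 ^ s))"

lemma smooth_disk_invariants: "smooth_on S (disk_invariants s)"
  unfolding disk_invariants_def case_prod_beta by (intro smooth_intros)

lemma disk_invariants_rot:
  assumes t: "norm \<tau> = 1"
  shows "disk_invariants s (disk_rot s \<tau> x) = disk_invariants s x"
proof -
  have *: "\<tau> * a * (cnj \<tau> * b) = a * b" for a b
    using complex_unit_cnj[OF t] by (metis mult.assoc mult.commute mult.left_neutral)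
  have **: "\<tau> ^ s * a * (cnj \<tau> ^ s * b) = a * b" for a b
    using complex_unit_cnj_power[OF t] by (metis mult.assoc mult.commute mult.left_neutral)
  show ?thesis
    by (cases x) (auto simp: disk_invariants_def disk_rot_def norm_mult t power_mult_distrib * **)
qed

text \<open>If \<open>v\<^sub>1 \<noteq> 0\<close>, the only candidate for the circle element is the quotient of the first components.\<close>

lemma disk_invariants_separate:
  assumes x: "((v1, v2), \<alpha>) \<in> disk_total" and y: "((w1, w2), \<beta>) \<in> disk_total"
    and 1: "norm v1 = norm w1" and 2: "v1 * cnj v2 = w1 * cnj w2"
    and 3: "\<alpha> * cnj v1 ^ s = \<beta> * cnj w1 ^ s" and 0: "v1 \<noteq> 0"
  shows "((w1, w2), \<beta>) = disk_rot s (w1 / v1) ((v1, v2), \<alpha>)" "norm (w1 / v1) = 1"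
proof -
  let ?t = "w1 / v1"
  show t: "norm ?t = 1"
    using 0 1 by (simp add: norm_divide flip: 1)
  have w1: "w1 = ?t * v1"
    using 0 by simp
  have "v1 * cnj v2 = ?t * v1 * cnj w2"
    using 2 w1 by simp
  then have "cnj v2 = ?t * cnj w2"
    using 0 by (simp add: field_simps)
  then have "v2 = cnj ?t * w2"
    by (metis complex_cnj_cnj complex_cnj_mult)
  then have w2: "w2 = ?t * v2"
    using complex_unit_cnj[OF t] by (metis mult.assoc mult.left_neutral)
  have "cnj w1 = cnj ?t * cnj v1"
    using w1 by (metis complex_cnj_mult)
  then have "cnj w1 ^ s = cnj ?t ^ s * cnj v1 ^ s"
    by (metis power_mult_distrib)
  then have "\<alpha> * cnj v1 ^ s = (\<beta> * cnj ?t ^ s) * cnj v1 ^ s"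
    using 3 by (metis mult.assoc)
  moreover have "cnj v1 ^ s \<noteq> 0"
    using 0 by simp
  ultimately have "\<alpha> = \<beta> * cnj ?t ^ s"
    using mult_right_cancel by blast
  then have "\<beta> = ?t ^ s * \<alpha>"
    using complex_unit_cnj_power[OF t, of s] by (metis mult.assoc mult.commute mult.right_neutral)
  then show "((w1, w2), \<beta>) = disk_rot s ?t ((v1, v2), \<alpha>)"
    using w1 w2 by (simp add: disk_rot_def)
qed

lemma disk_invariants_iff:
  assumes "x \<in> disk_total" "y \<in> disk_total"
  shows "disk_invariants s x = disk_invariants s y \<longleftrightarrow> disk_orbit s x = disk_orbit s y"
proof
  assume "disk_orbit s x = disk_orbit s y"
  then show "disk_invariants s x = disk_invariants s y"
    unfolding disk_orbit_eq_iff by (elim exE conjE) (simp add: disk_invariants_rot)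
next
  assume eq: "disk_invariants s x = disk_invariants s y"
  obtain v1 v2 \<alpha> where x: "x = ((v1, v2), \<alpha>)"
    by (metis surj_pair)
  obtain w1 w2 \<beta> where y: "y = ((w1, w2), \<beta>)"
    by (metis surj_pair)
  have n1: "(norm v1)\<^sup>2 = (norm w1)\<^sup>2" and 2: "v1 * cnj v2 = w1 * cnj w2"
    and 3: "\<alpha> * cnj v1 ^ s = \<beta> * cnj w1 ^ s" "\<alpha> * cnj v2 ^ s = \<beta> * cnj w2 ^ s"
    using eq by (simp_all add: x y disk_invariants_def)
  have n2: "(norm v2)\<^sup>2 = (norm w2)\<^sup>2"
    using assms n1 unfolding x y mem_disk_total by linarith
  have "\<exists>\<tau>. norm \<tau> = 1 \<and> y = disk_rot s \<tau> x"
  proof (cases "v1 = 0")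
    case False
    then show ?thesis
      using disk_invariants_separate[of v1 v2 \<alpha> w1 w2 \<beta> s] assms n1 2 3 unfolding x y
      by (intro exI[of _ "w1 / v1"]) simp
  next
    case True
    then have "v2 \<noteq> 0"
      using assms(1) by (auto simp: x mem_disk_total)
    moreover have "((v2, v1), \<alpha>) \<in> disk_total" "((w2, w1), \<beta>) \<in> disk_total"
      using assms by (simp_all add: x y mem_disk_total)
    moreover have "v2 * cnj v1 = w2 * cnj w1"
      using 2 by (metis complex_cnj_cnj complex_cnj_mult mult.commute)
    ultimately have "((w2, w1), \<beta>) = disk_rot s (w2 / v2) ((v2, v1), \<alpha>)" "norm (w2 / v2) = 1"
      using disk_invariants_separate[of v2 v1 \<alpha> w2 w1 \<beta> s] n2 3 by simp_all
    then show ?thesis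
      unfolding x y by (intro exI[of _ "w2 / v2"]) (simp add: disk_rot_def)
  qed
  then show "disk_orbit s x = disk_orbit s y"
    by (simp add: disk_orbit_eq_iff)
qed

text \<open>The chart \<open>False\<close> covers \<open>v\<^sub>1 \<noteq> 0\<close>, the chart \<open>True\<close> covers \<open>v\<^sub>2 \<noteq> 0\<close>.\<close>

definition disk_swap :: "bool \<Rightarrow> (complex \<times> complex) \<times> complex \<Rightarrow> (complex \<times> complex) \<times> complex" where
  "disk_swap b x = (if b then (prod.swap (fst x), snd x) else x)"

definition disk_dom :: "bool \<Rightarrow> ((complex \<times> complex) \<times> complex) set" where
  "disk_dom b = {x \<in> disk_total. fst (fst (disk_swap b x)) \<noteq> 0}"

definition disk_phase :: "bool \<Rightarrow> (complex \<times> complex) \<times> complex \<Rightarrow> complex" where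
  "disk_phase b x = sgn (fst (fst (disk_swap b x)))"

definition disk_coord :: "nat \<Rightarrow> bool \<Rightarrow> (complex \<times> complex) \<times> complex \<Rightarrow> complex \<times> complex" where
  "disk_coord s b x =
     (snd (fst (disk_swap b x)) / fst (fst (disk_swap b x)), snd x * cnj (disk_phase b x) ^ s)"

text \<open>The section picks the point of the orbit at which the first component of \<open>v\<close> is positive.\<close>

definition disk_section :: "bool \<Rightarrow> complex \<times> complex \<Rightarrow> (complex \<times> complex) \<times> complex" where
  "disk_section b y = disk_swap b (inverse (sqrt (1 + (norm (fst y))\<^sup>2)) *\<^sub>R (1, fst y), snd y)"

lemma disk_swap_swap [simp]: "disk_swap b (disk_swap b x) = x"
  by (simp add: disk_swap_def)

lemma disk_swap_rot: "disk_swap b (disk_rot s \<tau> x) = disk_rot s \<tau> (disk_swap b x)"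
  by (cases x) (auto simp: disk_swap_def disk_rot_def)

lemma disk_swap_total: "disk_swap b x \<in> disk_total \<longleftrightarrow> x \<in> disk_total"
  by (cases x) (auto simp: disk_swap_def mem_disk_total)

lemma snd_disk_swap [simp]: "snd (disk_swap b x) = snd x"
  by (simp add: disk_swap_def)

lemma smooth_on_disk_swap [smooth_intros]: "smooth_on S f \<Longrightarrow> smooth_on S (\<lambda>x. disk_swap b (f x))"
  by (cases b) (auto simp: disk_swap_def prod.swap_def intro!: smooth_intros)

text \<open>A point is recovered from its coordinates and the phase of the first component of \<open>v\<close>.  This
  identifies the fibres of the coordinate map with the orbits and supplies sections through all points.\<close>

lemma disk_section_phase:
  assumes x: "x \<in> disk_dom b"
  shows "disk_rot s (disk_phase b x) (disk_section b (disk_coord s b x)) = x"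
proof -
  obtain v1 v2 \<alpha> where sx: "disk_swap b x = ((v1, v2), \<alpha>)"
    by (metis surj_pair)
  then have xs: "x = disk_swap b ((v1, v2), \<alpha>)" and \<alpha>: "snd x = \<alpha>"
    by (metis disk_swap_swap, metis snd_disk_swap snd_conv)
  have v1: "v1 \<noteq> 0" and n: "(norm v1)\<^sup>2 + (norm v2)\<^sup>2 = 1"
    using x disk_swap_total[of b x] by (auto simp: disk_dom_def sx mem_disk_total)
  have "1 + (norm (v2 / v1))\<^sup>2 = (inverse (norm v1))\<^sup>2"
    using n v1 by (simp add: norm_divide field_simps)
  then have sq: "inverse (sqrt (1 + (norm (v2 / v1))\<^sup>2)) = norm v1"
    by (simp only: real_sqrt_abs) simp
  have sg: "sgn v1 * of_real (norm v1) = v1"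
    using v1 by (simp add: sgn_div_norm scaleR_conv_of_real)
  have "norm (sgn v1) = 1"
    using v1 by (simp add: norm_sgn)
  from complex_unit_cnj_power[OF this, of s]
  have a: "sgn v1 ^ s * (\<alpha> * cnj (sgn v1) ^ s) = \<alpha>"
    by (metis mult.assoc mult.commute mult.right_neutral)
  have "disk_rot s (sgn v1) (norm v1 *\<^sub>R (1, v2 / v1), \<alpha> * cnj (sgn v1) ^ s) = ((v1, v2), \<alpha>)"
    using a sg v1 by (auto simp: disk_rot_def scaleR_conv_of_real mult.assoc[symmetric])
  then show ?thesis
    unfolding disk_section_def disk_coord_def disk_phase_def disk_swap_rot[symmetric] sx fst_conv snd_conv \<alpha> sq
    using xs by simp
qed

lemma norm_disk_phase: "x \<in> disk_dom b \<Longrightarrow> norm (disk_phase b x) = 1"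
  by (simp add: disk_dom_def disk_phase_def norm_sgn)

lemma disk_coord_rot:
  assumes t: "norm \<tau> = 1"
  shows "disk_coord s b (disk_rot s \<tau> x) = disk_coord s b x"
proof -
  have t0: "\<tau> \<noteq> 0"
    using t by auto
  have sg: "sgn (\<tau> * a) = \<tau> * sgn a" for a
    using t by (simp add: sgn_mult sgn_div_norm[of \<tau>])
  have **: "\<tau> ^ s * a * (cnj \<tau> ^ s * b) = a * b" for a b
    using complex_unit_cnj_power[OF t] by (metis mult.assoc mult.commute mult.left_neutral)
  show ?thesis
    by (cases x) (auto simp: disk_coord_def disk_phase_def disk_swap_def disk_rot_def t0 sg
        power_mult_distrib **)
qed

lemma disk_dom_rot: "norm \<tau> = 1 \<Longrightarrow> x \<in> disk_dom b \<Longrightarrow> disk_rot s \<tau> x \<in> disk_dom b"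
  by (auto simp: disk_dom_def disk_rot_total disk_swap_rot) (auto simp: disk_rot_def split: prod.splits)

lemma one_plus_square_pos [simp]: "0 < 1 + (norm a)\<^sup>2" "1 + (norm a)\<^sup>2 \<noteq> 0"
  by (simp_all add: add_pos_nonneg add_nonneg_eq_0_iff)

lemma disk_section_dom:
  assumes "y \<in> UNIV \<times> ball 0 1"
  shows "disk_section b y \<in> disk_dom b"
proof -
  let ?r = "inverse (sqrt (1 + (norm (fst y))\<^sup>2))"
  have r: "?r > 0" "?r\<^sup>2 * (1 + (norm (fst y))\<^sup>2) = 1"
    by (simp_all add: power_inverse)
  have "(?r *\<^sub>R (1, fst y), snd y) \<in> disk_total"
    using assms r by (auto simp: mem_disk_total power_mult_distrib algebra_simps)
  then show ?thesis
    using r(1) unfolding disk_dom_def disk_section_def by (simp add: disk_swap_total)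
qed

lemma disk_coord_section: "disk_coord s b (disk_section b y) = y"
proof -
  let ?r = "inverse (sqrt (1 + (norm (fst y))\<^sup>2))"
  have r: "?r > 0"
    by simp
  have 1: "sgn (?r *\<^sub>R (1::complex)) = 1"
    using r by (simp only: sgn_scaleR) simp
  have 2: "(?r *\<^sub>R fst y) / (?r *\<^sub>R (1::complex)) = fst y"
    using r by (simp add: scaleR_conv_of_real)
  show ?thesis
    unfolding disk_coord_def disk_section_def disk_phase_def disk_swap_swap fst_conv snd_conv scaleR_Pair 1 2
    by simp
qed

lemma smooth_disk_section: "smooth_on S (disk_section b)"
  unfolding disk_section_def scaleR_Pair by (intro smooth_intros) simp_all

lemma smooth_disk_coord: "smooth_on (disk_dom b) (disk_coord s b)"
  unfolding disk_coord_def disk_phase_def by (intro smooth_intros) (simp_all add: disk_dom_def)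

lemma smooth_disk_phase: "smooth_on (disk_dom b) (disk_phase b)"
  unfolding disk_phase_def by (intro smooth_intros) (simp_all add: disk_dom_def)

lemma smooth_disk_rot:
  assumes "smooth_on S f" "smooth_on S g"
  shows "smooth_on S (\<lambda>x. disk_rot s (f x) (g x))"
  unfolding disk_rot_def case_prod_beta by (intro smooth_intros assms)

theorem disk_bundle_charts:
  "quotient_charts disk_total (disk_orbit s) (UNIV \<times> ball 0 1) UNIV (disk_coord s) disk_section disk_dom"
proof
  show "Hausdorff_space (quotient_topology disk_total (disk_orbit s))"
    by (rule Hausdorff_quotient_topology[OF smooth_on_continuous[OF smooth_disk_invariants]
        disk_invariants_iff])
  show "open (UNIV \<times> ball 0 1 :: (complex \<times> complex) set)"
    by (simp add: open_Times)
  fix b :: bool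
  show "openin (top_of_set disk_total) (disk_dom b)"
  proof -
    have "continuous_on disk_total (\<lambda>x. fst (fst (disk_swap b x)))"
      by (intro smooth_on_continuous smooth_intros)
    from continuous_openin_preimage_gen[OF this open_Compl[OF closed_singleton], of 0] show ?thesis
      by (simp add: disk_dom_def vimage_def Int_def)
  qed
  show "smooth_on (disk_dom b) (disk_coord s b)"
    by (rule smooth_disk_coord)
  show "smooth_on (UNIV \<times> ball 0 1) (disk_section b)"
    by (rule smooth_disk_section)
  show "disk_section b y \<in> disk_dom b" if "y \<in> UNIV \<times> ball 0 1" for y
    by (rule disk_section_dom[OF that])
  show "disk_coord s b (disk_section b y) = y" for y
    by (rule disk_coord_section)
  fix x assume x: "x \<in> disk_dom b"
  show "disk_coord s b x \<in> UNIV \<times> ball 0 1"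
    using x norm_disk_phase[OF x]
    by (cases x) (auto simp: disk_coord_def norm_mult norm_power disk_dom_def mem_disk_total)
  show "x' \<in> disk_dom b" if eq: "disk_orbit s x' = disk_orbit s x" for x'
  proof -
    obtain \<tau> where "norm \<tau> = 1" "x' = disk_rot s \<tau> x"
      using eq[symmetric] unfolding disk_orbit_eq_iff by (elim exE conjE)
    then show ?thesis
      using disk_dom_rot[OF _ x] by simp
  qed
  show "disk_orbit s x = disk_orbit s x' \<longleftrightarrow> disk_coord s b x = disk_coord s b x'" if x': "x' \<in> disk_dom b" for x'
  proof
    assume "disk_orbit s x = disk_orbit s x'"
    then show "disk_coord s b x = disk_coord s b x'"
      unfolding disk_orbit_eq_iff by (elim exE conjE) (simp add: disk_coord_rot)
  next
    assume "disk_coord s b x = disk_coord s b x'"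
    then show "disk_orbit s x = disk_orbit s x'"
      using disk_section_phase[OF x, of s] disk_section_phase[OF x', of s]
        disk_orbit_rot[OF norm_disk_phase[OF x]] disk_orbit_rot[OF norm_disk_phase[OF x']] by metis
  qed
  show "\<exists>\<sigma>. smooth_on (UNIV \<times> ball 0 1) \<sigma> \<and> \<sigma> ` (UNIV \<times> ball 0 1) \<subseteq> disk_total \<and> \<sigma> (disk_coord s b x) = x \<and>
      (\<forall>y\<in>UNIV \<times> ball 0 1. \<sigma> y \<in> disk_dom b \<and> disk_coord s b (\<sigma> y) = y)"
  proof (intro exI[of _ "\<lambda>y. disk_rot s (disk_phase b x) (disk_section b y)"] conjI ballI)
    show "smooth_on (UNIV \<times> ball 0 1) (\<lambda>y. disk_rot s (disk_phase b x) (disk_section b y))"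
      by (intro smooth_disk_rot smooth_disk_section smooth_intros)
    fix y :: "complex \<times> complex" assume "y \<in> UNIV \<times> ball 0 1"
    from disk_dom_rot[OF norm_disk_phase[OF x] disk_section_dom[OF this]]
    show "disk_rot s (disk_phase b x) (disk_section b y) \<in> disk_dom b" .
    show "disk_coord s b (disk_rot s (disk_phase b x) (disk_section b y)) = y"
      by (simp add: disk_coord_rot[OF norm_disk_phase[OF x]] disk_coord_section)
  next
    show "(\<lambda>y. disk_rot s (disk_phase b x) (disk_section b y)) ` (UNIV \<times> ball 0 1) \<subseteq> disk_total"
      using disk_dom_rot[OF norm_disk_phase[OF x] disk_section_dom] by (auto simp: disk_dom_def)
    show "disk_rot s (disk_phase b x) (disk_section b (disk_coord s b x)) = x"
      by (rule disk_section_phase[OF x])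
  qed
next
  fix x assume x: "x \<in> disk_total"
  show "\<exists>b\<in>UNIV. x \<in> disk_dom b"
  proof (cases "fst (fst x) = 0")
    case True
    then have "snd (fst x) \<noteq> 0"
      using x by (cases x) (auto simp: mem_disk_total)
    then show ?thesis
      using x by (intro bexI[of _ True]) (auto simp: disk_dom_def disk_swap_def)
  next
    case False
    then show ?thesis
      using x by (intro bexI[of _ False]) (auto simp: disk_dom_def disk_swap_def)
  qed
qed (auto simp: embedded_submanifold_disk_total)

section \<open>The zero level of the moment map\<close>

lemma quat_moment:
  "qcnj (a, b) \<odot> qi \<odot> (a, b) = (\<i> * of_real ((norm a)\<^sup>2 - (norm b)\<^sup>2), 2 * \<i> * (cnj a * b))"
  by (simp add: qmult_def qcnj_def qi_def complex_norm_square of_real_diff del: of_real_power)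
    (simp add: algebra_simps)

lemma norm_quat_pair_square:
  "(norm ((a1, b1), (a2, b2) :: quat))\<^sup>2 = (norm a1)\<^sup>2 + (norm a2)\<^sup>2 + ((norm b1)\<^sup>2 + (norm b2)\<^sup>2)"
  for a1 b1 a2 b2 :: complex
  by (simp add: norm_Pair)

locale level_weights =
  fixes p :: int
  assumes p_gt_1: "p > 1"
begin

abbreviation "P \<equiv> (p - 1, p, p) :: weights"
abbreviation "q \<equiv> real_of_int p"
abbreviation "Z \<equiv> zero_level P"
abbreviation "s \<equiv> nat (2 * p)"
abbreviation "e \<equiv> nat (2 * p - 1)"

text \<open>The value of \<open>\<bar>a\<bar>\<^sup>2 - \<bar>b\<bar>\<^sup>2\<close> on the zero level.\<close>

definition c :: real where "c = 1 - 1 / q"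

lemma q_gt_1: "q > 1"
  using p_gt_1 by simp

lemma c_pos: "c > 0"
  using q_gt_1 by (simp add: c_def)

lemma s_eq: "s = Suc e"
  using p_gt_1 by simp

lemma moment_map_coords:
  "moment_map P = (\<lambda>y.
     (\<i> * of_real (q * ((norm (fst (fst y)))\<^sup>2 + (norm (fst (snd y)))\<^sup>2
        - ((norm (snd (fst y)))\<^sup>2 + (norm (snd (snd y)))\<^sup>2)) - (q - 1)),
      2 * \<i> * q * (cnj (fst (fst y)) * snd (fst y) + cnj (fst (snd y)) * snd (snd y))))"
proof
  fix y :: "quat \<times> quat"
  obtain a1 b1 a2 b2 where "y = ((a1, b1), (a2, b2))"
    by (metis surj_pair)
  then show "moment_map P y =
     (\<i> * of_real (q * ((norm (fst (fst y)))\<^sup>2 + (norm (fst (snd y)))\<^sup>2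
        - ((norm (snd (fst y)))\<^sup>2 + (norm (snd (snd y)))\<^sup>2)) - (q - 1)),
      2 * \<i> * q * (cnj (fst (fst y)) * snd (fst y) + cnj (fst (snd y)) * snd (snd y)))"
    unfolding moment_map_def by (simp only: prod.case quat_moment)
      (simp add: qi_def scaleR_conv_of_real algebra_simps)
qed

lemma moment_map_eq:
  "moment_map P ((a1, b1), (a2, b2)) =
     (\<i> * of_real (q * ((norm a1)\<^sup>2 + (norm a2)\<^sup>2 - ((norm b1)\<^sup>2 + (norm b2)\<^sup>2)) - (q - 1)),
      2 * \<i> * q * (cnj a1 * b1 + cnj a2 * b2))"
  unfolding moment_map_coords fst_conv snd_conv ..

lemma moment_map_zero_iff:
  "moment_map P ((a1, b1), (a2, b2)) = 0 \<longleftrightarrow>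
     (norm a1)\<^sup>2 + (norm a2)\<^sup>2 = c + ((norm b1)\<^sup>2 + (norm b2)\<^sup>2) \<and> cnj a1 * b1 + cnj a2 * b2 = 0"
proof -
  have 1: "\<i> * complex_of_real r = 0 \<longleftrightarrow> r = 0" for r
    by simp
  have 2: "2 * \<i> * complex_of_real q * w = 0 \<longleftrightarrow> w = 0" for w
    using p_gt_1 by simp
  have 3: "q * (A - B) - (q - 1) = 0 \<longleftrightarrow> A = c + B" for A B
    using q_gt_1 by (simp add: c_def field_simps)
  show ?thesis
    by (simp only: moment_map_eq zero_prod_def prod.inject 1 2 3)
qed

lemma mem_Z:
  "((a1, b1), (a2, b2)) \<in> Z \<longleftrightarrow>
     (norm a1)\<^sup>2 + (norm a2)\<^sup>2 = c + ((norm b1)\<^sup>2 + (norm b2)\<^sup>2) \<and>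
     cnj a1 * b1 + cnj a2 * b2 = 0 \<and> 2 * q * ((norm b1)\<^sup>2 + (norm b2)\<^sup>2) < 1"
proof -
  let ?A = "(norm a1)\<^sup>2 + (norm a2)\<^sup>2" and ?B = "(norm b1)\<^sup>2 + (norm b2)\<^sup>2"
  have "((a1, b1), (a2, b2)) \<in> ball 0 1 \<longleftrightarrow> ?A + ?B < 1"
    using norm_quat_pair_square[of a1 b1 a2 b2] abs_square_less_1[of "norm ((a1, b1), (a2, b2))"] by simp
  moreover have "?A + ?B < 1 \<longleftrightarrow> 2 * q * ?B < 1" if "?A = c + ?B"
    using q_gt_1 unfolding that by (simp add: c_def field_simps)
  ultimately show ?thesis
    unfolding zero_level_def mem_Collect_eq moment_map_zero_iff by blast
qed

lemma moment_map_zero_a_nonzero: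
  assumes "moment_map P ((a1, b1), (a2, b2)) = 0"
  shows "(norm a1)\<^sup>2 + (norm a2)\<^sup>2 > 0"
proof -
  have "(norm b1)\<^sup>2 + (norm b2)\<^sup>2 \<ge> 0"
    by simp
  then show ?thesis
    using assms c_pos unfolding moment_map_zero_iff by linarith
qed

lemma a_nonzero: "((a1, b1), (a2, b2)) \<in> Z \<Longrightarrow> (norm a1)\<^sup>2 + (norm a2)\<^sup>2 > 0"
  by (rule moment_map_zero_a_nonzero[of a1 b1 a2 b2]) (simp add: zero_level_def)

text \<open>On the zero level \<open>b\<close> is orthogonal to \<open>a\<close> and \<open>a \<noteq> 0\<close>, so moving \<open>a\<close> and \<open>b\<close> in the direction
  of \<open>a\<close> changes the two components of the moment map independently.\<close>

lemma embedded_submanifold_Z: "embedded_submanifold Z"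
  unfolding embedded_submanifold_def
proof
  fix x assume x: "x \<in> Z"
  define h :: "quat \<times> quat \<Rightarrow> quat \<times> quat" where "h y = (moment_map P y, 0)" for y
  define D :: "quat \<times> quat \<Rightarrow> quat \<times> quat \<Rightarrow> quat \<times> quat" where
    "D y u = ((\<i> * of_real (2 * q * (fst (fst y) \<bullet> fst (fst u) + fst (snd y) \<bullet> fst (snd u)
          - (snd (fst y) \<bullet> snd (fst u) + snd (snd y) \<bullet> snd (snd u)))),
        2 * \<i> * q * (cnj (fst (fst u)) * snd (fst y) + cnj (fst (fst y)) * snd (fst u)
          + (cnj (fst (snd u)) * snd (snd y) + cnj (fst (snd y)) * snd (snd u)))), 0)" for y u
  define K :: "(quat \<times> quat) set" where "K = {k. Re (fst (fst k)) = 0 \<and> snd k = 0}"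
  have K: "subspace K"
    by (simp add: K_def subspace_def)
  have h: "smooth_on S h" for S
    unfolding h_def moment_map_coords by (intro smooth_intros)
  have D: "(h has_derivative D y) (at y)" for y
    unfolding h_def moment_map_coords D_def[abs_def] power2_norm_eq_inner
    by (auto intro!: derivative_eq_intros simp: inner_commute algebra_simps)
  have im: "h ` ball 0 1 \<subseteq> K"
    by (rule image_subsetI) (simp add: h_def moment_map_coords K_def)
  have inter: "Z \<inter> ball 0 1 = {y \<in> ball 0 1. h y = 0}"
    by (auto simp: zero_level_def h_def zero_prod_def)
  have rng: "range (frechet_derivative h (at y)) = K" if "y \<in> Z" for y
    unfolding frechet_derivative_at[OF D, symmetric]
  proof (intro subset_antisym subsetI)
    show "k \<in> K" if "k \<in> range (D y)" for k
      using that by (auto simp: D_def K_def)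
  next
    fix k assume "k \<in> K"
    then obtain r w where k: "k = ((\<i> * of_real r, w), 0)"
      by (intro that[of "Im (fst (fst k))" "snd (fst k)"]) (auto simp: K_def prod_eq_iff complex_eq_iff)
    obtain a1 b1 a2 b2 where y: "y = ((a1, b1), (a2, b2))"
      by (metis surj_pair)
    let ?N = "(norm a1)\<^sup>2 + (norm a2)\<^sup>2"
    have N: "?N > 0"
      using a_nonzero that unfolding y by blast
    have orth: "cnj a1 * b1 + cnj a2 * b2 = 0"
      using that unfolding y mem_Z by blast
    define l where "l = r / (2 * q * ?N)"
    define m where "m = w / (2 * \<i> * q * ?N)"
    have "b1 \<bullet> (m * a1) + b2 \<bullet> (m * a2) = Re (cnj m * (cnj a1 * b1 + cnj a2 * b2))"
      by (simp add: inner_complex_def algebra_simps)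
    then have 1: "b1 \<bullet> (m * a1) + b2 \<bullet> (m * a2) = 0"
      unfolding orth by simp
    have 2: "a1 \<bullet> (l *\<^sub>R a1) + a2 \<bullet> (l *\<^sub>R a2) = l * ?N"
      by (simp add: power2_norm_eq_inner distrib_left)
    have "cnj (l *\<^sub>R a1) * b1 + cnj a1 * (m * a1) + (cnj (l *\<^sub>R a2) * b2 + cnj a2 * (m * a2)) =
        of_real l * (cnj a1 * b1 + cnj a2 * b2) + m * (a1 * cnj a1 + a2 * cnj a2)"
      by (simp add: scaleR_conv_of_real algebra_simps)
    then have 3: "cnj (l *\<^sub>R a1) * b1 + cnj a1 * (m * a1) + (cnj (l *\<^sub>R a2) * b2 + cnj a2 * (m * a2))
        = m * of_real ?N"
      unfolding orth by (simp add: complex_norm_square del: of_real_power)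
    have m: "2 * \<i> * q * (m * of_real ?N) = w"
    proof -
      define M where "M = complex_of_real ?N"
      have "M \<noteq> 0"
        unfolding M_def using N by (simp only: of_real_eq_0_iff)
      then show ?thesis
        unfolding m_def M_def[symmetric] using p_gt_1 by simp
    qed
    have l: "2 * q * (l * ?N) = r"
    proof -
      have "2 * q * (r / (2 * q * M) * M) = r" if "M > 0" for M
        using p_gt_1 that by simp
      then show ?thesis
        unfolding l_def using N by blast
    qed
    have "D y ((l *\<^sub>R a1, m * a1), (l *\<^sub>R a2, m * a2)) = k"
      unfolding D_def y k fst_conv snd_conv 1 2 3 m using l by simp
    then show "k \<in> range (D y)"
      by (metis rangeI)
  qed
  show "\<exists>W (h :: quat \<times> quat \<Rightarrow> quat \<times> quat) K. open W \<and> x \<in> W \<and> subspace K \<and> smooth_on W h \<and> h ` W \<subseteq> K \<and>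
      Z \<inter> W = {y \<in> W. h y = 0} \<and> (\<forall>y\<in>Z \<inter> W. range (frechet_derivative h (at y)) = K)"
    by (rule exI[of _ "ball 0 1"], rule exI[of _ h], rule exI[of _ K], intro conjI K h im inter ballI)
      (use x rng in \<open>auto simp: zero_level_def\<close>)
qed

definition rot :: "complex \<Rightarrow> quat \<times> quat \<Rightarrow> quat \<times> quat" where
  "rot \<tau> = (\<lambda>((a1, b1), (a2, b2)). ((\<tau> * a1, \<tau> ^ e * b1), (\<tau> * a2, \<tau> ^ e * b2)))"

lemma rot_mult: "rot \<tau> (rot \<tau>' x) = rot (\<tau> * \<tau>') x"
  by (auto simp: rot_def power_mult_distrib mult_ac split: prod.splits)

lemma rot_1 [simp]: "rot 1 x = x"
  by (auto simp: rot_def split: prod.splits)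

lemma circle_act_rot: "circle_act P t x = rot (cis (2 * pi * t)) x"
proof -
  have 1: "exp (2 * pi * \<i> * of_int p * of_real t) = cis (2 * pi * q * t)"
    and 2: "exp (- 2 * pi * \<i> * of_int (p - 1) * of_real t) = cis (- (2 * pi * (q - 1) * t))"
    by (simp_all add: cis_conv_exp mult_ac)
  have 3: "cis (2 * pi * q * t) * a * cis (- (2 * pi * (q - 1) * t)) = cis (2 * pi * t) * a" for a
    by (simp add: mult.commute[of _ a] mult.assoc cis_mult algebra_simps)
  have "cis (2 * pi * q * t) * cis (2 * pi * (q - 1) * t) = cis (2 * pi * t) ^ e"
  proof -
    have "real e = 2 * q - 1"
      using p_gt_1 by simp
    then show ?thesis
      by (simp only: Complex.DeMoivre cis_mult) (simp add: algebra_simps)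
  qed
  then have 4: "cis (2 * pi * q * t) * b * cis (2 * pi * (q - 1) * t) = cis (2 * pi * t) ^ e * b" for b
    by (metis mult.assoc mult.commute)
  obtain a1 b1 a2 b2 where x: "x = ((a1, b1), (a2, b2))"
    by (metis surj_pair)
  show ?thesis
    unfolding circle_act_def x prod.case 1 2
    by (simp only: rot_def qmult_def cq_def prod.case fst_conv snd_conv cis_cnj minus_minus) (simp add: 3 4)
qed

lemma circle_orbit_eq: "circle_orbit P x = {rot \<tau> x | \<tau>. norm \<tau> = 1}"
proof (intro subset_antisym subsetI)
  fix y assume "y \<in> circle_orbit P x"
  then obtain t where "y = rot (cis (2 * pi * t)) x"
    unfolding circle_orbit_def circle_act_rot by auto
  then show "y \<in> {rot \<tau> x | \<tau>. norm \<tau> = 1}"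
    by auto
next
  fix y assume "y \<in> {rot \<tau> x | \<tau>. norm \<tau> = 1}"
  then obtain \<tau> where t: "norm \<tau> = 1" "y = rot \<tau> x"
    by auto
  let ?t = "Arg2pi \<tau> / (2 * pi)"
  have "\<tau> = cis (2 * pi * ?t)"
    using Arg2pi_eq[of \<tau>] t(1) by (simp add: cis_conv_exp)
  then have "y = circle_act P ?t x"
    unfolding circle_act_rot t(2) by (rule arg_cong)
  moreover have "?t \<in> {0..<1}"
    using Arg2pi_ge_0[of \<tau>] Arg2pi_lt_2pi[of \<tau>] by simp
  ultimately show "y \<in> circle_orbit P x"
    unfolding circle_orbit_def by (rule image_eqI)
qed

lemma circle_orbit_eq_iff: "circle_orbit P x = circle_orbit P y \<longleftrightarrow> (\<exists>\<tau>. norm \<tau> = 1 \<and> y = rot \<tau> x)"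
  unfolding circle_orbit_eq by (rule unit_orbit_eq_iff[OF rot_mult rot_1])

text \<open>Since \<open>b\<close> is orthogonal to \<open>a\<close>, it is a multiple of \<open>(- cnj a\<^sub>2, cnj a\<^sub>1)\<close>.  The factor and the
  direction of \<open>a\<close> are the coordinates on \<open>S\<^sup>3\<close> times a disk; the length of \<open>a\<close> is then determined.  The
  circle acts on the factor with weight \<open>e + 1 = 2 p\<close>, one more than on \<open>b\<close>.\<close>

definition \<Psi> :: "(complex \<times> complex) \<times> complex \<Rightarrow> quat \<times> quat" where
  "\<Psi> = (\<lambda>((v1, v2), \<alpha>).
     ((sqrt (c + (norm \<alpha>)\<^sup>2 / (2 * q)) *\<^sub>R v1, - ((1 / sqrt (2 * q)) *\<^sub>R (\<alpha> * cnj v2))),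
      (sqrt (c + (norm \<alpha>)\<^sup>2 / (2 * q)) *\<^sub>R v2, (1 / sqrt (2 * q)) *\<^sub>R (\<alpha> * cnj v1))))"

definition \<Phi> :: "quat \<times> quat \<Rightarrow> (complex \<times> complex) \<times> complex" where
  "\<Phi> = (\<lambda>((a1, b1), (a2, b2)). let r = inverse (sqrt ((norm a1)\<^sup>2 + (norm a2)\<^sup>2)) in
     ((r *\<^sub>R a1, r *\<^sub>R a2), (sqrt (2 * q) * r) *\<^sub>R (a1 * b2 - a2 * b1)))"

lemma A_pos: "c + (norm \<alpha>)\<^sup>2 / (2 * q) > 0"
  using c_pos q_gt_1 by (simp add: add_pos_nonneg)

lemma smooth_\<Psi>: "smooth_on S \<Psi>"
  unfolding \<Psi>_def case_prod_beta by (intro smooth_intros) (use A_pos q_gt_1 in simp_all)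

lemma smooth_\<Phi>: "smooth_on {x. (norm (fst (fst x)))\<^sup>2 + (norm (fst (snd x)))\<^sup>2 > 0} \<Phi>"
  unfolding \<Phi>_def case_prod_beta Let_def by (intro smooth_intros) auto

lemma Z_subset: "Z \<subseteq> {x. (norm (fst (fst x)))\<^sup>2 + (norm (fst (snd x)))\<^sup>2 > 0}"
  using a_nonzero by auto

lemma \<Psi>_into:
  assumes "x \<in> disk_total"
  shows "\<Psi> x \<in> Z"
proof -
  obtain v1 v2 \<alpha> where x: "x = ((v1, v2), \<alpha>)"
    by (metis surj_pair)
  have n: "(norm v1)\<^sup>2 + (norm v2)\<^sup>2 = 1" and \<alpha>: "norm \<alpha> < 1"
    using assms unfolding x mem_disk_total by auto
  let ?A = "c + (norm \<alpha>)\<^sup>2 / (2 * q)" and ?k = "1 / sqrt (2 * q)"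
  have A: "(norm (sqrt ?A *\<^sub>R v1))\<^sup>2 + (norm (sqrt ?A *\<^sub>R v2))\<^sup>2 = ?A"
    using n A_pos[of \<alpha>] by (simp add: power_mult_distrib distrib_left[symmetric])
  have B: "(norm (- (?k *\<^sub>R (\<alpha> * cnj v2))))\<^sup>2 + (norm (?k *\<^sub>R (\<alpha> * cnj v1)))\<^sup>2 = (norm \<alpha>)\<^sup>2 / (2 * q)"
  proof -
    have "(norm (- (?k *\<^sub>R (\<alpha> * cnj v2))))\<^sup>2 + (norm (?k *\<^sub>R (\<alpha> * cnj v1)))\<^sup>2 =
        (norm \<alpha>)\<^sup>2 / (2 * q) * ((norm v1)\<^sup>2 + (norm v2)\<^sup>2)"
      using q_gt_1 by (simp add: power_mult_distrib norm_mult power_divide field_simps)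
    then show ?thesis
      unfolding n by simp
  qed
  have "(norm \<alpha>)\<^sup>2 < 1"
    using \<alpha> by (simp add: abs_square_less_1)
  then have "2 * q * ((norm \<alpha>)\<^sup>2 / (2 * q)) < 1"
    using q_gt_1 by simp
  moreover have "cnj (sqrt ?A *\<^sub>R v1) * - (?k *\<^sub>R (\<alpha> * cnj v2)) + cnj (sqrt ?A *\<^sub>R v2) * (?k *\<^sub>R (\<alpha> *
      cnj v1)) = 0"
    by (simp add: scaleR_conv_of_real)
  ultimately show ?thesis
    unfolding x \<Psi>_def prod.case mem_Z A B by simp
qed

text \<open>The determinant \<open>B\<close> of \<open>a\<close> and \<open>b\<close> is \<open>\<bar>a\<bar>\<close> times the factor, because \<open>b\<close> is orthogonal to \<open>a\<close>.\<close>

lemma Z_identities: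
  assumes "((a1, b1), (a2, b2)) \<in> Z"
  defines "N \<equiv> (norm a1)\<^sup>2 + (norm a2)\<^sup>2" and "B \<equiv> a1 * b2 - a2 * b1"
  shows "B * cnj a2 = - (of_real N * b1)" "B * cnj a1 = of_real N * b2"
    and "(norm B)\<^sup>2 = N * ((norm b1)\<^sup>2 + (norm b2)\<^sup>2)"
proof -
  have orth: "cnj a1 * b1 + cnj a2 * b2 = 0"
    using assms(1) unfolding mem_Z by blast
  have N: "complex_of_real N = a1 * cnj a1 + a2 * cnj a2"
    unfolding N_def by (simp add: complex_norm_square del: of_real_power)
  have "B * cnj a2 + of_real N * b1 = a1 * (cnj a1 * b1 + cnj a2 * b2)"
    unfolding N B_def by (simp add: algebra_simps)
  then show 1: "B * cnj a2 = - (of_real N * b1)"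
    unfolding orth by (simp add: eq_neg_iff_add_eq_0)
  have "B * cnj a1 - of_real N * b2 = - a2 * (cnj a1 * b1 + cnj a2 * b2)"
    unfolding N B_def by (simp add: algebra_simps)
  then show 2: "B * cnj a1 = of_real N * b2"
    unfolding orth by simp
  have N0: "N > 0"
    using a_nonzero[OF assms(1)] by (simp add: N_def)
  have "(norm B)\<^sup>2 * N = (norm (B * cnj a1))\<^sup>2 + (norm (B * cnj a2))\<^sup>2"
    by (simp add: norm_mult power_mult_distrib N_def distrib_left)
  also have "\<dots> = N * (N * ((norm b1)\<^sup>2 + (norm b2)\<^sup>2))"
    unfolding 1 2 using N0 by (simp add: norm_mult power_mult_distrib power2_eq_square algebra_simps)
  finally show "(norm B)\<^sup>2 = N * ((norm b1)\<^sup>2 + (norm b2)\<^sup>2)"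
    using N0 by simp
qed

lemma \<Phi>_into:
  assumes "x \<in> Z"
  shows "\<Phi> x \<in> disk_total"
proof -
  obtain a1 b1 a2 b2 where x: "x = ((a1, b1), (a2, b2))"
    by (metis surj_pair)
  let ?N = "(norm a1)\<^sup>2 + (norm a2)\<^sup>2" and ?B = "a1 * b2 - a2 * b1"
  let ?r = "inverse (sqrt ?N)"
  have N: "?N > 0"
    using a_nonzero assms unfolding x by blast
  have r: "?r\<^sup>2 = 1 / ?N"
    using N by (simp add: power_inverse divide_inverse)
  have "(norm (?r *\<^sub>R a1))\<^sup>2 + (norm (?r *\<^sub>R a2))\<^sup>2 = ?r\<^sup>2 * ?N"
    by (simp add: power_mult_distrib distrib_left)
  also have "\<dots> = 1"
  proof -
    have "1 / M * M = 1" if "M > 0" for M :: real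
      using that by simp
    then show ?thesis
      unfolding r using N by blast
  qed
  finally have 1: "(norm (?r *\<^sub>R a1))\<^sup>2 + (norm (?r *\<^sub>R a2))\<^sup>2 = 1" .
  have "(norm ((sqrt (2 * q) * ?r) *\<^sub>R ?B))\<^sup>2 = 2 * q * ?r\<^sup>2 * (norm ?B)\<^sup>2"
    using q_gt_1 by (simp add: power_mult_distrib)
  also have "\<dots> = 2 * q * ((norm b1)\<^sup>2 + (norm b2)\<^sup>2)"
  proof -
    have "2 * q * (1 / M) * (M * b) = 2 * q * b" if "M > 0" for M b :: real
      using that by simp
    then show ?thesis
      unfolding Z_identities(3)[OF assms[unfolded x]] r using N by blast
  qed
  also have "\<dots> < 1"
    using assms unfolding x mem_Z by blast
  finally have "norm ((sqrt (2 * q) * ?r) *\<^sub>R ?B) < 1"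
    by (simp only: abs_square_less_1 abs_norm_cancel)
  then show ?thesis
    unfolding x \<Phi>_def prod.case Let_def mem_disk_total using 1 by blast
qed

lemma \<Phi>_\<Psi>:
  assumes "x \<in> disk_total"
  shows "\<Phi> (\<Psi> x) = x"
proof -
  obtain v1 v2 \<alpha> where x: "x = ((v1, v2), \<alpha>)"
    by (metis surj_pair)
  have n: "(norm v1)\<^sup>2 + (norm v2)\<^sup>2 = 1"
    using assms unfolding x mem_disk_total by auto
  let ?A = "c + (norm \<alpha>)\<^sup>2 / (2 * q)" and ?k = "1 / sqrt (2 * q)"
  have A0: "sqrt ?A > 0"
    using A_pos[of \<alpha>] by simp
  have A: "(norm (sqrt ?A *\<^sub>R v1))\<^sup>2 + (norm (sqrt ?A *\<^sub>R v2))\<^sup>2 = ?A"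
    using n A_pos[of \<alpha>] by (simp add: power_mult_distrib distrib_left[symmetric])
  have n': "v1 * cnj v1 + v2 * cnj v2 = 1"
    using n by (metis complex_norm_square of_real_1 of_real_add)
  have "(sqrt ?A *\<^sub>R v1) * (?k *\<^sub>R (\<alpha> * cnj v1)) - (sqrt ?A *\<^sub>R v2) * - (?k *\<^sub>R (\<alpha> * cnj v2)) =
      (sqrt ?A * ?k) *\<^sub>R (\<alpha> * (v1 * cnj v1 + v2 * cnj v2))"
    by (simp add: scaleR_conv_of_real algebra_simps add_divide_distrib)
  then have B: "(sqrt ?A *\<^sub>R v1) * (?k *\<^sub>R (\<alpha> * cnj v1)) - (sqrt ?A *\<^sub>R v2) * - (?k *\<^sub>R (\<alpha> * cnj v2)) =
      (sqrt ?A * ?k) *\<^sub>R \<alpha>"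
    unfolding n' by simp
  have 1: "inverse (sqrt ?A) *\<^sub>R sqrt ?A *\<^sub>R v = v" for v :: complex
    using A0 by simp
  have "sqrt (2 * q) * inverse (sqrt ?A) * (sqrt ?A * ?k) = 1"
    using A0 q_gt_1 by (simp add: field_simps)
  then have 2: "(sqrt (2 * q) * inverse (sqrt ?A)) *\<^sub>R (sqrt ?A * ?k) *\<^sub>R \<alpha> = \<alpha>"
    by (simp only: scaleR_scaleR scaleR_one)
  show ?thesis
    unfolding x \<Psi>_def prod.case \<Phi>_def Let_def A B 1 2 ..
qed

lemma \<Psi>_\<Phi>:
  assumes "x \<in> Z"
  shows "\<Psi> (\<Phi> x) = x"
proof -
  obtain a1 b1 a2 b2 where x: "x = ((a1, b1), (a2, b2))"
    by (metis surj_pair)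
  define N where "N = (norm a1)\<^sup>2 + (norm a2)\<^sup>2"
  define B where "B = a1 * b2 - a2 * b1"
  define r where "r = inverse (sqrt N)"
  note id = Z_identities[OF assms[unfolded x], folded N_def B_def]
  have N: "N > 0"
    using a_nonzero assms unfolding x N_def by blast
  have r0: "r > 0"
    using N by (simp add: r_def)
  have r: "r * r * N = 1"
  proof -
    have "r\<^sup>2 = 1 / N"
      using N by (simp add: r_def power_inverse divide_inverse)
    then show ?thesis
      using N by (simp add: power2_eq_square[symmetric])
  qed
  let ?\<alpha> = "(sqrt (2 * q) * r) *\<^sub>R B"
  have "(norm ?\<alpha>)\<^sup>2 / (2 * q) = (r * r) * (norm B)\<^sup>2"
    using q_gt_1 by (simp add: power_mult_distrib power2_eq_square[of r])
  also have "\<dots> = (r * r * N) * ((norm b1)\<^sup>2 + (norm b2)\<^sup>2)"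
    unfolding id(3) by simp
  finally have "(norm ?\<alpha>)\<^sup>2 / (2 * q) = (norm b1)\<^sup>2 + (norm b2)\<^sup>2"
    unfolding r by simp
  then have "c + (norm ?\<alpha>)\<^sup>2 / (2 * q) = N"
    using assms unfolding x mem_Z N_def by simp
  then have A: "sqrt (c + (norm ?\<alpha>)\<^sup>2 / (2 * q)) *\<^sub>R r *\<^sub>R a = a" for a :: complex
    using N by (simp add: r_def)
  have k: "(1 / sqrt (2 * q)) *\<^sub>R (?\<alpha> * cnj (r *\<^sub>R a)) = (r * r) *\<^sub>R (B * cnj a)" for a
    using q_gt_1 by (simp add: scaleR_conv_of_real field_simps)
  have b: "(r * r) *\<^sub>R (of_real N * b) = b" for b :: complex
    using r by (simp add: scaleR_conv_of_real flip: of_real_mult mult.assoc)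
  show ?thesis
    unfolding x \<Phi>_def prod.case Let_def N_def[symmetric] B_def[symmetric] r_def[symmetric] \<Psi>_def A k
    by (simp only: id scaleR_minus_right b minus_minus)
qed

lemma \<Psi>_rot:
  assumes "norm \<tau> = 1"
  shows "\<Psi> (disk_rot s \<tau> x) = rot \<tau> (\<Psi> x)"
proof -
  have *: "\<tau> ^ s * \<alpha> * cnj (\<tau> * v) = \<tau> ^ e * (\<alpha> * cnj v)" for \<alpha> v
  proof -
    have "\<tau> ^ s * \<alpha> * cnj (\<tau> * v) = \<tau> ^ e * (\<alpha> * cnj v) * (\<tau> * cnj \<tau>)"
      unfolding s_eq by (simp add: algebra_simps)
    then show ?thesis
      unfolding complex_unit_cnj[OF assms] by simp
  qed
  obtain v1 v2 \<alpha> where x: "x = ((v1, v2), \<alpha>)"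
    by (metis surj_pair)
  have n: "norm (\<tau> ^ s * \<alpha>) = norm \<alpha>"
    using assms by (simp add: norm_mult norm_power)
  show ?thesis
    unfolding x disk_rot_def prod.case \<Psi>_def rot_def * n
    by (simp only: prod.case mult_scaleR_right mult_minus_right)
qed

lemma \<Phi>_rot:
  assumes "norm \<tau> = 1"
  shows "\<Phi> (rot \<tau> x) = disk_rot s \<tau> (\<Phi> x)"
proof -
  obtain a1 b1 a2 b2 where x: "x = ((a1, b1), (a2, b2))"
    by (metis surj_pair)
  have n: "norm (\<tau> * a) = norm a" for a
    using assms by (simp add: norm_mult)
  have B: "\<tau> * a1 * (\<tau> ^ e * b2) - \<tau> * a2 * (\<tau> ^ e * b1) = \<tau> ^ s * (a1 * b2 - a2 * b1)"
    unfolding s_eq by (simp add: algebra_simps)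
  show ?thesis
    unfolding x rot_def prod.case \<Phi>_def Let_def disk_rot_def n B
    by (simp only: prod.case mult_scaleR_right)
qed

lemma orbit_\<Phi>:
  assumes x: "x \<in> Z" and y: "y \<in> Z"
  shows "circle_orbit P x = circle_orbit P y \<longleftrightarrow> disk_orbit s (\<Phi> x) = disk_orbit s (\<Phi> y)"
proof -
  have "y = rot \<tau> x \<longleftrightarrow> \<Phi> y = disk_rot s \<tau> (\<Phi> x)" if t: "norm \<tau> = 1" for \<tau>
    using \<Psi>_\<Phi>[OF x] \<Psi>_\<Phi>[OF y] \<Phi>_rot[OF t] \<Psi>_rot[OF t] by metis
  then show ?thesis
    unfolding circle_orbit_eq_iff disk_orbit_eq_iff by blast
qed

lemma rot_Z: "norm \<tau> = 1 \<Longrightarrow> x \<in> Z \<Longrightarrow> rot \<tau> x \<in> Z"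
  by (metis \<Phi>_into \<Psi>_\<Phi> \<Psi>_into \<Psi>_rot disk_rot_total)

definition F :: "quat \<times> quat \<Rightarrow> (real \<times> complex) \<times> complex \<times> complex" where
  "F x = disk_invariants s (\<Phi> x)"

lemma smooth_F: "smooth_on {x. (norm (fst (fst x)))\<^sup>2 + (norm (fst (snd x)))\<^sup>2 > 0} F"
  unfolding F_def by (rule smooth_on_compose[OF smooth_disk_invariants smooth_\<Phi> subset_UNIV])

lemma F_iff: "x \<in> Z \<Longrightarrow> y \<in> Z \<Longrightarrow> F x = F y \<longleftrightarrow> circle_orbit P x = circle_orbit P y"
  unfolding F_def by (simp add: disk_invariants_iff \<Phi>_into orbit_\<Phi>)

lemma F_rot: "norm \<tau> = 1 \<Longrightarrow> F (rot \<tau> x) = F x"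
  by (simp add: F_def \<Phi>_rot disk_invariants_rot)

abbreviation "T \<equiv> UNIV \<times> ball 0 1 :: (complex \<times> complex) set"

definition "coord b x = disk_coord s b (\<Phi> x)"
definition "sect b y = \<Psi> (disk_section b y)"
definition "ldom b = {x \<in> Z. \<Phi> x \<in> disk_dom b}"

sublocale D: quotient_charts disk_total "disk_orbit s" T UNIV "disk_coord s" disk_section disk_dom
  by (rule disk_bundle_charts)

sublocale M: quotient_charts Z "circle_orbit P" T UNIV coord sect ldom
  unfolding coord_def[abs_def] sect_def[abs_def] ldom_def[abs_def]
  by (rule D.quotient_charts_transfer[OF embedded_submanifold_Z
        Hausdorff_quotient_topology[OF smooth_on_continuous[OF smooth_on_subset[OF smooth_F Z_subset]] F_iff]
        smooth_\<Psi> \<Psi>_into \<Phi>_\<Psi> smooth_on_subset[OF smooth_\<Phi> Z_subset] \<Phi>_into \<Psi>_\<Phi> orbit_\<Phi>])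

definition to_disk :: "(quat \<times> quat) set \<Rightarrow> ((complex \<times> complex) \<times> complex) set" where
  "to_disk m = disk_orbit s (\<Phi> (inv_into Z (circle_orbit P) m))"

definition of_disk :: "((complex \<times> complex) \<times> complex) set \<Rightarrow> (quat \<times> quat) set" where
  "of_disk m = circle_orbit P (\<Psi> (inv_into disk_total (disk_orbit s) m))"

lemma to_disk_orbit:
  assumes "x \<in> Z"
  shows "to_disk (circle_orbit P x) = disk_orbit s (\<Phi> x)"
proof -
  let ?y = "inv_into Z (circle_orbit P) (circle_orbit P x)"
  have "?y \<in> Z" "circle_orbit P ?y = circle_orbit P x"
    by (rule inv_into_into f_inv_into_f, rule imageI[OF assms])+
  then show ?thesis
    using orbit_\<Phi>[OF _ assms] by (simp add: to_disk_def)
qed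

lemma of_disk_orbit:
  assumes "x \<in> disk_total"
  shows "of_disk (disk_orbit s x) = circle_orbit P (\<Psi> x)"
proof -
  let ?y = "inv_into disk_total (disk_orbit s) (disk_orbit s x)"
  have "?y \<in> disk_total" "disk_orbit s ?y = disk_orbit s x"
    by (rule inv_into_into f_inv_into_f, rule imageI[OF assms])+
  then show ?thesis
    using orbit_\<Phi>[OF \<Psi>_into \<Psi>_into, of ?y x] assms by (simp add: of_disk_def \<Phi>_\<Psi>)
qed

sublocale MD: quotient_charts_pair Z "circle_orbit P" T UNIV coord sect ldom
    disk_total "disk_orbit s" T UNIV "disk_coord s" disk_section disk_dom \<Phi> to_disk
  by unfold_locales (rule smooth_on_subset[OF smooth_\<Phi> Z_subset] \<Phi>_into to_disk_orbit, assumption?)+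

sublocale DM: quotient_charts_pair disk_total "disk_orbit s" T UNIV "disk_coord s" disk_section disk_dom
    Z "circle_orbit P" T UNIV coord sect ldom \<Psi> of_disk
  by unfold_locales (rule smooth_\<Psi> \<Psi>_into of_disk_orbit, assumption?)+

theorem diffeomorphism_to_disk:
  "diffeomorphism (qk_quotient P) M.atlas (disk_bundle s) D.atlas to_disk"
  unfolding diffeomorphism_def qk_quotient_def disk_bundle_def
proof (intro conjI exI[of _ of_disk] ballI)
  show "of_disk (to_disk m) = m" if "m \<in> topspace (quotient_topology Z (circle_orbit P))" for m
    using that by (auto simp: to_disk_orbit of_disk_orbit \<Phi>_into \<Psi>_\<Phi>)
  show "to_disk (of_disk m) = m" if "m \<in> topspace (quotient_topology disk_total (disk_orbit s))" for m
    using that by (auto simp: to_disk_orbit of_disk_orbit \<Psi>_into \<Phi>_\<Psi>)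
qed (rule MD.smooth_map_induced DM.smooth_map_induced)+

end

section \<open>The hyperbolic metric\<close>

lemma qinner_eq:
  "qinner v x =
     (cnj (fst (fst v)) * fst (fst x) + snd (fst v) * cnj (snd (fst x)) +
        (cnj (fst (snd v)) * fst (snd x) + snd (snd v) * cnj (snd (snd x))),
      cnj (fst (fst v)) * snd (fst x) - snd (fst v) * cnj (fst (fst x)) +
        (cnj (fst (snd v)) * snd (snd x) - snd (snd v) * cnj (fst (snd x))))"
  by (simp add: qinner_def qmult_def qcnj_def)

lemma linear_qinner: "linear (\<lambda>v. qinner v x)"
  by (rule linearI) (simp_all add: qinner_eq scaleR_conv_of_real algebra_simps)

lemma bilinear_hyp_metric: "bilinear (hyp_metric x)"
  unfolding bilinear_def
proof (intro conjI allI)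
  show "linear (\<lambda>w. hyp_metric x v w)" for v
    unfolding hyp_metric_def
    by (rule linearI) (simp_all add: linear_add[OF linear_qinner] linear_cmul[OF linear_qinner] inner_add_right
        algebra_simps add_divide_distrib)
  show "linear (\<lambda>v. hyp_metric x v w)" for w
    unfolding hyp_metric_def
    by (rule linearI) (simp_all add: linear_add[OF linear_qinner] linear_cmul[OF linear_qinner] inner_add_left
        algebra_simps add_divide_distrib)
qed

lemmas hyp_metric_add_left = bilinear_ladd[OF bilinear_hyp_metric]
  and hyp_metric_add_right = bilinear_radd[OF bilinear_hyp_metric]
  and hyp_metric_scale_left = bilinear_lmul[OF bilinear_hyp_metric]
  and hyp_metric_scale_right = bilinear_rmul[OF bilinear_hyp_metric]

lemma hyp_metric_commute: "hyp_metric x v w = hyp_metric x w v"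
  by (simp add: hyp_metric_def inner_commute)

lemma
  assumes x: "norm x < 1"
  shows hyp_metric_ge_norm: "(norm u)\<^sup>2 \<le> hyp_metric x u u"
    and hyp_metric_ge_radial: "((x \<bullet> u) / (1 - (norm x)\<^sup>2))\<^sup>2 \<le> hyp_metric x u u"
proof -
  define k where "k = 1 / (1 - (norm x)\<^sup>2)"
  have n: "(norm x)\<^sup>2 < 1"
    using x by (simp add: abs_square_less_1)
  then have k: "k \<ge> 1"
    by (simp add: k_def)
  have h: "hyp_metric x u u = k * (norm u)\<^sup>2 + k\<^sup>2 * (norm (qinner u x))\<^sup>2"
    unfolding hyp_metric_quadratic k_def[symmetric] by (simp add: algebra_simps power2_eq_square)
  have "(norm u)\<^sup>2 \<le> k * (norm u)\<^sup>2"
    using mult_right_mono[OF k, of "(norm u)\<^sup>2"] by simp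
  then show "(norm u)\<^sup>2 \<le> hyp_metric x u u"
    unfolding h by (simp add: add_increasing2)
  have "Re (fst (qinner u x)) = x \<bullet> u"
    by (cases x; cases u) (simp add: qinner_eq inner_prod_def inner_complex_def)
  then have "\<bar>x \<bullet> u\<bar> \<le> norm (qinner u x)"
    using abs_Re_le_cmod[of "fst (qinner u x)"] norm_fst_le[of "fst (qinner u x)" "snd (qinner u x)"] by simp
  then have "(x \<bullet> u)\<^sup>2 \<le> (norm (qinner u x))\<^sup>2"
    by (metis abs_ge_zero power2_abs power_mono)
  then have "k\<^sup>2 * (x \<bullet> u)\<^sup>2 \<le> k\<^sup>2 * (norm (qinner u x))\<^sup>2"
    by (simp add: mult_left_mono)
  also have "\<dots> \<le> hyp_metric x u u"
    unfolding h using k by simp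
  finally show "((x \<bullet> u) / (1 - (norm x)\<^sup>2))\<^sup>2 \<le> hyp_metric x u u"
    by (simp add: k_def power_divide)
qed

lemma hyp_metric_pos: "norm x < 1 \<Longrightarrow> u \<noteq> 0 \<Longrightarrow> hyp_metric x u u > 0"
  using hyp_metric_ge_norm[of x u] by (metis less_le_trans zero_less_norm_iff zero_less_power)

lemma smooth_on_hyp_metric [smooth_intros]:
  assumes "smooth_on S f" "smooth_on S u" "smooth_on S w" "\<And>y. y \<in> S \<Longrightarrow> norm (f y) < 1"
  shows "smooth_on S (\<lambda>y. hyp_metric (f y) (u y) (w y))"
proof -
  have "1 - (norm (f y))\<^sup>2 \<noteq> 0" if "y \<in> S" for y
    using assms(4)[OF that] by (metis abs_norm_cancel abs_square_less_1 eq_iff_diff_eq_0 less_irrefl)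
  then show ?thesis
    unfolding hyp_metric_def qinner_eq by (intro smooth_intros assms(1-3))
qed

lemma inner_complex_unit:
  assumes "norm (\<tau>::complex) = 1"
  shows "(\<tau> * a) \<bullet> (\<tau> * b) = a \<bullet> b"
proof -
  have inner: "x \<bullet> y = Re (cnj x * y)" for x y :: complex
    by (simp add: inner_complex_def)
  have "cnj (\<tau> * a) * (\<tau> * b) = (\<tau> * cnj \<tau>) * (cnj a * b)"
    by (simp add: mult_ac)
  then have "cnj (\<tau> * a) * (\<tau> * b) = cnj a * b"
    unfolding complex_unit_cnj[OF assms] by simp
  then show ?thesis
    by (simp only: inner)
qed

section \<open>The quotient metric\<close>

context level_weights
begin

text \<open>The generator of the circle action.\<close>

definition vert :: "quat \<times> quat \<Rightarrow> quat \<times> quat" where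
  "vert x = ((\<i> * fst (fst x), of_nat e * \<i> * snd (fst x)), (\<i> * fst (snd x), of_nat e * \<i> * snd (snd x)))"

text \<open>The hyperbolic inner product of the components orthogonal to the orbit.\<close>

definition transverse :: "quat \<times> quat \<Rightarrow> quat \<times> quat \<Rightarrow> quat \<times> quat \<Rightarrow> real" where
  "transverse x u w = hyp_metric x u w -
     hyp_metric x u (vert x) * hyp_metric x w (vert x) / hyp_metric x (vert x) (vert x)"

lemma Z_norm: "x \<in> Z \<Longrightarrow> norm x < 1"
  by (simp add: zero_level_def)

lemma vert_pos: "x \<in> Z \<Longrightarrow> hyp_metric x (vert x) (vert x) > 0"
proof (rule hyp_metric_pos[OF Z_norm])
  assume x: "x \<in> Z"
  then have "(norm (fst (fst x)))\<^sup>2 + (norm (fst (snd x)))\<^sup>2 > 0"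
    using Z_subset by blast
  then show "vert x \<noteq> 0"
    by (auto simp: vert_def zero_prod_def)
qed

lemma bilinear_transverse: "bilinear (transverse x)"
  unfolding bilinear_def
proof (intro conjI allI)
  show "linear (\<lambda>w. transverse x v w)" for v
    unfolding transverse_def
    by (rule linearI) (simp_all add: hyp_metric_add_left hyp_metric_add_right hyp_metric_scale_left
        hyp_metric_scale_right algebra_simps add_divide_distrib)
  show "linear (\<lambda>v. transverse x v w)" for w
    unfolding transverse_def
    by (rule linearI) (simp_all add: hyp_metric_add_left hyp_metric_add_right hyp_metric_scale_left
        hyp_metric_scale_right algebra_simps add_divide_distrib)
qed

lemma transverse_commute: "transverse x u w = transverse x w u"
  by (simp add: transverse_def hyp_metric_commute[of x u w] mult.commute)

lemma transverse_vert_left: "x \<in> Z \<Longrightarrow> transverse x (r *\<^sub>R vert x) w = 0"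
  using vert_pos[of x]
  by (simp add: transverse_def hyp_metric_scale_left hyp_metric_commute[of x w])

lemma transverse_shift:
  assumes "x \<in> Z"
  shows "transverse x (r *\<^sub>R vert x + u) (r' *\<^sub>R vert x + w) = transverse x u w"
  using transverse_vert_left[OF assms]
  by (simp add: bilinear_ladd[OF bilinear_transverse] bilinear_radd[OF bilinear_transverse]
      transverse_commute[of x _ "r' *\<^sub>R vert x"])

lemma transverse_horizontal:
  "hyp_metric x (vert x) u = 0 \<Longrightarrow> transverse x u w = hyp_metric x u w"
  by (simp add: transverse_def hyp_metric_commute[of x u])

text \<open>Subtracting the vertical component leaves the transverse length unchanged and makes it the full
  length.\<close>

lemma transverse_projection:
  assumes x: "x \<in> Z"
  obtains r where "transverse x u u = hyp_metric x (u + r *\<^sub>R vert x) (u + r *\<^sub>R vert x)"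
proof -
  define r where "r = - (hyp_metric x u (vert x) / hyp_metric x (vert x) (vert x))"
  have 0: "hyp_metric x (vert x) (u + r *\<^sub>R vert x) = 0"
    unfolding hyp_metric_add_right hyp_metric_scale_right
    using vert_pos[OF x] by (simp add: r_def hyp_metric_commute[of x u])
  have "transverse x u u = transverse x (u + r *\<^sub>R vert x) (u + r *\<^sub>R vert x)"
    using transverse_shift[OF x, of r u r u] by (simp add: add.commute)
  then show thesis
    using transverse_horizontal[OF 0] that by simp
qed

lemma transverse_invariant:
  assumes "\<And>u w. hyp_metric (L x) (L u) (L w) = hyp_metric x u w" and "vert (L x) = L (vert x)"
  shows "transverse (L x) (L u) (L w) = transverse x u w"
  by (simp add: transverse_def assms)

lemma smooth_on_vert [smooth_intros]: "smooth_on S f \<Longrightarrow> smooth_on S (\<lambda>y. vert (f y))"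
  unfolding vert_def by (intro smooth_intros)

lemma smooth_on_transverse [smooth_intros]:
  assumes "smooth_on S f" "smooth_on S u" "smooth_on S w" "\<And>y. y \<in> S \<Longrightarrow> f y \<in> Z"
  shows "smooth_on S (\<lambda>y. transverse (f y) (u y) (w y))"
proof -
  have "hyp_metric (f y) (vert (f y)) (vert (f y)) \<noteq> 0" if "y \<in> S" for y
    using vert_pos[OF assms(4)[OF that]] by simp
  then show ?thesis
    unfolding transverse_def by (intro smooth_intros assms(1-3)) (auto intro: Z_norm assms(4))
qed

lemma hyp_metric_rot:
  assumes t: "norm \<tau> = 1"
  shows "hyp_metric (rot \<tau> x) (rot \<tau> u) (rot \<tau> w) = hyp_metric x u w"
proof -
  have te: "norm (\<tau> ^ e) = 1"
    using t by (simp add: norm_power)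
  have inner: "rot \<tau> u \<bullet> rot \<tau> w = u \<bullet> w" for u w
    by (cases u; cases w)
      (auto simp: rot_def inner_prod_def inner_complex_unit[OF t] inner_complex_unit[OF te])
  have n: "(norm (rot \<tau> x))\<^sup>2 = (norm x)\<^sup>2"
    by (simp only: power2_norm_eq_inner inner)
  have "qinner (rot \<tau> v) (rot \<tau> x) = (fst (qinner v x), cnj \<tau> * \<tau> ^ e * snd (qinner v x))" for v
  proof -
    have 1: "cnj (\<tau> * a) * (\<tau> * b) = cnj a * b" for a b
      using complex_unit_cnj[OF t] by (simp add: mult_ac)
    have 2: "(\<tau> ^ e * a) * cnj (\<tau> ^ e * b) = a * cnj b" for a b
      using complex_unit_cnj[OF te] by (simp add: mult_ac)
    have 3: "cnj (\<tau> * a) * (\<tau> ^ e * b) = cnj \<tau> * \<tau> ^ e * (cnj a * b)"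
      and 4: "(\<tau> ^ e * b) * cnj (\<tau> * a) = cnj \<tau> * \<tau> ^ e * (b * cnj a)" for a b
      by simp_all
    obtain a1 b1 a2 b2 where v: "v = ((a1, b1), (a2, b2))"
      by (metis surj_pair)
    obtain a1' b1' a2' b2' where x: "x = ((a1', b1'), (a2', b2'))"
      by (metis surj_pair)
    show ?thesis
      unfolding v x qinner_eq rot_def prod.case fst_conv snd_conv 1 2 3 4
      by (simp only: right_diff_distrib distrib_left)
  qed
  moreover have "norm (cnj \<tau> * \<tau> ^ e) = 1"
    using t te by (simp add: norm_mult)
  ultimately have "qinner (rot \<tau> u) (rot \<tau> x) \<bullet> qinner (rot \<tau> w) (rot \<tau> x) = qinner u x \<bullet> qinner w x"
    by (simp add: inner_prod_def inner_complex_unit)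
  then show ?thesis
    unfolding hyp_metric_def n inner by simp
qed

lemma vert_rot: "vert (rot \<tau> x) = rot \<tau> (vert x)"
  by (cases x) (auto simp: vert_def rot_def)

lemma transverse_rot: "norm \<tau> = 1 \<Longrightarrow> transverse (rot \<tau> x) (rot \<tau> u) (rot \<tau> w) = transverse x u w"
  by (rule transverse_invariant[OF hyp_metric_rot vert_rot])

lemma e_pos: "e > 0"
  using p_gt_1 by simp

text \<open>If the phase rotates with speed \<open>r\<close>, the product rule splits the velocity into a multiple of
  the generator and the rotated velocity.\<close>

lemma rot_has_vector_derivative:
  assumes \<tau>: "(\<tau> has_vector_derivative (of_real r * \<i> * \<tau> 0)) (at 0)"
    and y: "(y has_vector_derivative v) (at 0)"
  shows "((\<lambda>t. rot (\<tau> t) (y t)) has_vector_derivative r *\<^sub>R vert (rot (\<tau> 0) (y 0)) + rot (\<tau> 0) v) (at 0)"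
proof -
  have pw: "\<tau> 0 * \<tau> 0 ^ (e - Suc 0) = \<tau> 0 ^ e"
    using e_pos by (simp add: power_eq_if)
  have "((\<lambda>t. rot (\<tau> t) (y t)) has_derivative
    (\<lambda>h. h *\<^sub>R (((of_real r * \<i> * \<tau> 0) * fst (fst (y 0)) + \<tau> 0 * fst (fst v),
        of_nat e * (of_real r * \<i> * (\<tau> 0 * \<tau> 0 ^ (e - Suc 0))) * snd (fst (y 0)) + \<tau> 0 ^ e * snd (fst v)),
       ((of_real r * \<i> * \<tau> 0) * fst (snd (y 0)) + \<tau> 0 * fst (snd v),
        of_nat e * (of_real r * \<i> * (\<tau> 0 * \<tau> 0 ^ (e - Suc 0))) * snd (snd (y 0)) + \<tau> 0 ^ e * snd (snd
            v))))) (at 0)"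
    unfolding rot_def case_prod_beta
    by (rule has_derivative_eq_rhs,
        (rule derivative_intros \<tau>[unfolded has_vector_derivative_def] y[unfolded has_vector_derivative_def])+)
      (auto simp: scaleR_conv_of_real algebra_simps)
  then show ?thesis
    unfolding pw has_vector_derivative_def
    by (rule has_derivative_eq_rhs)
      (auto simp: fun_eq_iff vert_def rot_def case_prod_beta scaleR_conv_of_real algebra_simps)
qed

lemma smooth_rot: "smooth_on S f \<Longrightarrow> smooth_on S g \<Longrightarrow> smooth_on S (\<lambda>x. rot (f x) (g x))"
  unfolding rot_def case_prod_beta by (intro smooth_intros)

lemma rot_0 [simp]: "rot \<tau> 0 = 0"
  by (simp add: rot_def zero_prod_def)

lemma vert_curve: "((\<lambda>t. rot (cis t) x) has_vector_derivative vert x) (at 0)"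
proof -
  have "(cis has_vector_derivative (of_real 1 * \<i> * cis 0)) (at 0)"
    unfolding has_vector_derivative_def
    using has_derivative_cis[OF has_derivative_ident[of "at 0"]] by simp
  from rot_has_vector_derivative[OF this has_vector_derivative_const[of x]] show ?thesis
    by simp
qed

lemma vert_tangent: "x \<in> Z \<Longrightarrow> vert x \<in> tangent_space Z x"
  unfolding tangent_space_def
  by (intro CollectI exI[of _ "\<lambda>t. rot (cis t) x"] exI[of _ 1] conjI vert_curve smooth_rot smooth_intros
      image_subsetI rot_Z) simp_all

text \<open>The orbit of \<open>x\<close> is a curve in the zero level with velocity \<open>vert x\<close> on which \<open>f\<close> is constant.\<close>

lemma derivative_vert_zero:
  assumes x: "x \<in> Z" and f: "(f has_derivative D) (at x within Z)"
    and inv: "\<And>\<tau>. norm \<tau> = 1 \<Longrightarrow> f (rot \<tau> x) = f x"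
  shows "D (vert x) = 0"
proof -
  have "((\<lambda>t. f (rot (cis t) x)) has_derivative (\<lambda>h. D (h *\<^sub>R vert x))) (at 0)"
  proof (rule has_derivative_compose_into[where g = "\<lambda>t. rot (cis t) x" and g' = "\<lambda>h. h *\<^sub>R vert x"
        and f = f and f' = D, OF _ open_UNIV UNIV_I])
    show "((\<lambda>t. rot (cis t) x) has_derivative (\<lambda>h. h *\<^sub>R vert x)) (at 0)"
      using vert_curve by (simp add: has_vector_derivative_def)
    show "range (\<lambda>t. rot (cis t) x) \<subseteq> Z"
      by (intro image_subsetI rot_Z x) simp
    show "(f has_derivative D) (at (rot (cis 0) x) within Z)"
      using f by simp
  qed
  moreover have "(\<lambda>t. f (rot (cis t) x)) = (\<lambda>t. f x)"
    by (rule ext) (simp add: inv)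
  ultimately have "((\<lambda>t::real. f x) has_derivative (\<lambda>h. D (h *\<^sub>R vert x))) (at 0)"
    by simp
  from fun_cong[OF has_derivative_unique[OF this has_derivative_const], of 1] show ?thesis
    by simp
qed

abbreviation "\<pi> \<equiv> circle_orbit P"

lemma orbit_rot: "norm \<tau> = 1 \<Longrightarrow> \<pi> (rot \<tau> x) = \<pi> x"
  by (metis circle_orbit_eq_iff)

lemma ldom_Z: "x \<in> ldom b \<Longrightarrow> x \<in> Z"
  by (simp add: ldom_def)

lemma sect_phase: "x \<in> ldom b \<Longrightarrow> rot (disk_phase b (\<Phi> x)) (sect b (coord b x)) = x"
  unfolding sect_def coord_def ldom_def
  by (simp add: \<Psi>_rot[symmetric] norm_disk_phase disk_section_phase \<Psi>_\<Phi>)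

lemma orthogonal_unit: "norm (\<theta>::complex) = 1 \<Longrightarrow> \<theta> \<bullet> w = 0 \<Longrightarrow> \<exists>r. w = of_real r * \<i> * \<theta>"
proof -
  assume t: "norm \<theta> = 1" and 0: "\<theta> \<bullet> w = 0"
  have "Re (cnj \<theta> * w) = 0"
    using 0 by (simp add: inner_complex_def)
  then have "cnj \<theta> * w = of_real (Im (cnj \<theta> * w)) * \<i>"
    by (simp add: complex_eq_iff)
  then have "\<theta> * (cnj \<theta> * w) = of_real (Im (cnj \<theta> * w)) * \<i> * \<theta>"
    by (metis mult.commute)
  moreover have "\<theta> * (cnj \<theta> * w) = w"
    using complex_unit_cnj[OF t] by (metis mult.assoc mult.left_neutral)
  ultimately show ?thesis
    by metis
qed

text \<open>A curve in the domain of a chart is the section over its projection, rotated by the phase.  Its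
  velocity is therefore, up to a vertical vector, the rotated image of the projected velocity under the
  section.\<close>

lemma tangent_decomposition:
  assumes x: "x \<in> ldom b" and u: "u \<in> tangent_space Z x"
    and D: "((snd (M.chart b) \<circ> \<pi>) has_derivative D) (at x within Z)"
  obtains r where "u = r *\<^sub>R vert x +
    rot (disk_phase b (\<Phi> x)) (frechet_derivative (sect b) (at (coord b x)) (D u))"
proof -
  let ?ph = "\<lambda>x. disk_phase b (\<Phi> x)"
  have xZ: "x \<in> Z"
    by (rule ldom_Z[OF x])
  have od: "openin (top_of_set Z) (ldom b)"
    by (rule M.openin_dom) simp
  have "smooth_on (ldom b) ?ph"
    by (rule smooth_on_compose[OF smooth_disk_phase smooth_on_subset[OF smooth_\<Phi>]])
      (use Z_subset in \<open>auto simp: ldom_def\<close>)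
  then obtain E where "(?ph has_derivative E) (at x within ldom b)"
    by (rule smooth_on_has_derivative_within[OF _ x]) (rule that)
  from has_derivative_within_openin[OF this od x]
  have "((\<lambda>x. (?ph x, (snd (M.chart b) \<circ> \<pi>) x)) has_derivative (\<lambda>u. (E u, D u))) (at x within Z)"
    using D by (rule has_derivative_Pair)
  then obtain \<gamma> \<epsilon> where g: "\<epsilon> > 0" "smooth_on {-\<epsilon><..<\<epsilon>} \<gamma>" "\<gamma> ` {-\<epsilon><..<\<epsilon>} \<subseteq> Z" "\<gamma> (0::real) = x"
    "(\<gamma> has_vector_derivative u) (at 0)"
    "((\<lambda>t. (?ph (\<gamma> t), (snd (M.chart b) \<circ> \<pi>) (\<gamma> t))) has_vector_derivative (E u, D u)) (at 0)"
    by (rule tangent_space_chain[OF u]) (rule that)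
  have ph': "((\<lambda>t. ?ph (\<gamma> t)) has_vector_derivative E u) (at 0)"
    using bounded_linear.has_vector_derivative[OF bounded_linear_fst g(6)] by simp
  have co': "((\<lambda>t. (snd (M.chart b) \<circ> \<pi>) (\<gamma> t)) has_vector_derivative D u) (at 0)"
    using bounded_linear.has_vector_derivative[OF bounded_linear_snd g(6)] by simp
  obtain W where W: "open W" "ldom b = Z \<inter> W"
    using od unfolding openin_open by (elim exE conjE)
  have "continuous_on {-\<epsilon><..<\<epsilon>} \<gamma>"
    by (rule smooth_on_continuous[OF g(2)])
  then have oN: "open ({-\<epsilon><..<\<epsilon>} \<inter> \<gamma> -` W)"
    using W(1) by (intro continuous_open_preimage) simp_all
  let ?N = "{-\<epsilon><..<\<epsilon>} \<inter> \<gamma> -` W"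
  have 0: "0 \<in> ?N"
    using g(1,4) x unfolding W(2) by simp
  have near: "\<gamma> t \<in> ldom b" if "t \<in> ?N" for t
    using that g(3) unfolding W(2) by auto
  have coord: "(snd (M.chart b) \<circ> \<pi>) (\<gamma> t) = coord b (\<gamma> t)" if "t \<in> ?N" for t
    using M.chart_coord[OF UNIV_I near[OF that]] by simp
  have nph: "norm (?ph (\<gamma> t)) = 1" if "t \<in> ?N" for t
    using near[OF that] norm_disk_phase by (simp add: ldom_def)
  have co: "((\<lambda>t. coord b (\<gamma> t)) has_vector_derivative D u) (at 0)"
    by (rule has_vector_derivative_transform_within_open[OF co' oN 0 coord])
  have "?ph x \<bullet> E u = 0"
  proof -
    have "((\<lambda>t. ?ph (\<gamma> t) \<bullet> ?ph (\<gamma> t)) has_derivative (\<lambda>h. ?ph (\<gamma> 0) \<bullet> (h *\<^sub>R E u) + (h *\<^sub>R E u) \<bullet> ?ph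
        (\<gamma> 0))) (at 0)"
      using ph' unfolding has_vector_derivative_def by (intro has_derivative_inner)
    then have "((\<lambda>t. 1) has_derivative (\<lambda>h. ?ph (\<gamma> 0) \<bullet> (h *\<^sub>R E u) + (h *\<^sub>R E u) \<bullet> ?ph (\<gamma> 0))) (at 0)"
      by (rule has_derivative_transform_within_open[OF _ oN 0]) (use nph in \<open>simp add: dot_square_norm\<close>)
    from fun_cong[OF has_derivative_unique[OF this has_derivative_const], of 1] show ?thesis
      by (simp add: g(4) inner_commute)
  qed
  moreover have "norm (?ph x) = 1"
    using nph[OF 0] g(4) by simp
  ultimately obtain r where r: "E u = of_real r * \<i> * ?ph x"
    using orthogonal_unit by blast
  have q: "coord b x \<in> T"
    by (rule M.Q_into[OF UNIV_I x])
  let ?S = "frechet_derivative (sect b) (at (coord b x))"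
  have S: "(sect b has_derivative ?S) (at (coord b x))"
    by (rule smooth_on_has_derivative[OF M.smooth_\<sigma>[OF UNIV_I] M.open_T q])
  have "((\<lambda>t. coord b (\<gamma> t)) has_derivative (\<lambda>h. h *\<^sub>R D u)) (at 0)"
    using co by (simp add: has_vector_derivative_def)
  from has_derivative_compose[OF this, of "sect b" ?S] S g(4)
  have "((\<lambda>t. sect b (coord b (\<gamma> t))) has_derivative (\<lambda>h. ?S (h *\<^sub>R D u))) (at 0)"
    by simp
  then have "((\<lambda>t. sect b (coord b (\<gamma> t))) has_vector_derivative ?S (D u)) (at 0)"
    unfolding has_vector_derivative_def linear_cmul[OF has_derivative_linear[OF S]] .
  from rot_has_vector_derivative[OF ph'[unfolded r g(4)[symmetric]] this]
  have "((\<lambda>t. rot (?ph (\<gamma> t)) (sect b (coord b (\<gamma> t)))) has_vector_derivative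
      r *\<^sub>R vert x + rot (?ph x) (?S (D u))) (at 0)"
    using sect_phase[OF x] g(4) by simp
  then have "(\<gamma> has_vector_derivative r *\<^sub>R vert x + rot (?ph x) (?S (D u))) (at 0)"
    by (rule has_vector_derivative_transform_within_open[OF _ oN 0]) (use sect_phase near in simp)
  from vector_derivative_unique_at[OF g(5) this] show thesis
    by (rule that)
qed

text \<open>A metric field receives a chart and not its index; the index is recovered by comparing with the
  chart \<open>M.chart True\<close>.\<close>

definition hmet :: "((quat \<times> quat) set, complex \<times> complex) metric_field" where
  "hmet ch m v w = (let b = (ch = M.chart True); y = snd ch m in
     transverse (sect b y) (frechet_derivative (sect b) (at y) v) (frechet_derivative (sect b) (at y) w))"

lemma chart_index: "(M.chart b = M.chart True) = b"
proof -
  have "M.chart False \<noteq> M.chart True"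
  proof
    assume eq: "M.chart False = M.chart True"
    let ?x = "\<Psi> ((1, 0), 0)"
    have d: "((1, 0), 0) \<in> disk_total"
      by (simp add: mem_disk_total)
    have Z: "?x \<in> Z" and \<Phi>: "\<Phi> ?x = ((1, 0), 0)"
      by (rule \<Psi>_into[OF d], rule \<Phi>_\<Psi>[OF d])
    have F: "?x \<in> ldom False" and T: "?x \<notin> ldom True"
      using Z d by (simp_all add: ldom_def \<Phi> disk_dom_def disk_swap_def)
    have "\<pi> ` ldom False = \<pi> ` ldom True"
      using arg_cong[OF eq, of fst] by simp
    then have "\<pi> ?x \<in> \<pi> ` ldom True"
      using F by blast
    then show False
      using T M.projection_in_chart[OF UNIV_I Z, of True] by simp
  qed
  then show ?thesis
    by (cases b) auto
qed

lemma hmet_chart: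
  "x \<in> ldom b \<Longrightarrow> hmet (M.chart b) (\<pi> x) v w =
     transverse (sect b (coord b x)) (frechet_derivative (sect b) (at (coord b x)) v)
       (frechet_derivative (sect b) (at (coord b x)) w)"
  by (simp add: hmet_def Let_def chart_index M.chart_coord)

lemma hmet_sect:
  "y \<in> T \<Longrightarrow> hmet (M.chart b) (\<pi> (sect b y)) v w =
     transverse (sect b y) (frechet_derivative (sect b) (at y) v) (frechet_derivative (sect b) (at y) w)"
  using hmet_chart[OF M.\<sigma>_into[OF UNIV_I]] M.Q_\<sigma>[OF UNIV_I] by simp

text \<open>By the decomposition, the chart expression of the metric may be evaluated on any lifts of
  tangent vectors at any point of the orbit.\<close>

lemma hmet_projection:
  assumes x: "x \<in> ldom b" and u: "u \<in> tangent_space Z x" and w: "w \<in> tangent_space Z x"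
    and D: "((snd (M.chart b) \<circ> \<pi>) has_derivative D) (at x within Z)"
  shows "hmet (M.chart b) (\<pi> x) (D u) (D w) = transverse x u w"
proof -
  let ?S = "frechet_derivative (sect b) (at (coord b x))" and ?\<tau> = "disk_phase b (\<Phi> x)"
  obtain r where r: "u = r *\<^sub>R vert x + rot ?\<tau> (?S (D u))"
    by (rule tangent_decomposition[OF x u D]) (rule that)
  obtain r' where r': "w = r' *\<^sub>R vert x + rot ?\<tau> (?S (D w))"
    by (rule tangent_decomposition[OF x w D]) (rule that)
  have t: "norm ?\<tau> = 1"
    using x norm_disk_phase by (simp add: ldom_def)
  have "transverse x u w = transverse x (r *\<^sub>R vert x + rot ?\<tau> (?S (D u))) (r' *\<^sub>R vert x + rot ?\<tau> (?S (D w)))"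
    using r r' by metis
  also have "\<dots> = transverse x (rot ?\<tau> (?S (D u))) (rot ?\<tau> (?S (D w)))"
    by (rule transverse_shift[OF ldom_Z[OF x]])
  also have "\<dots> = transverse (rot ?\<tau> (sect b (coord b x))) (rot ?\<tau> (?S (D u))) (rot ?\<tau> (?S (D w)))"
    unfolding sect_phase[OF x] ..
  also have "\<dots> = transverse (sect b (coord b x)) (?S (D u)) (?S (D w))"
    by (rule transverse_rot[OF t])
  finally show ?thesis
    unfolding hmet_chart[OF x] by simp
qed

lemma sect_Z: "y \<in> T \<Longrightarrow> sect b y \<in> Z"
  by (rule ldom_Z[OF M.\<sigma>_into[OF UNIV_I]])

lemma sect_derivative: "y \<in> T \<Longrightarrow> (sect b has_derivative frechet_derivative (sect b) (at y)) (at y)"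
  by (rule smooth_on_has_derivative[OF M.smooth_\<sigma>[OF UNIV_I] M.open_T])

text \<open>A vector of transverse length zero is vertical and has projection zero, but the section is a right
  inverse of the projection.\<close>

lemma hmet_pos:
  assumes y: "y \<in> T" and v: "v \<noteq> 0"
  shows "hmet (M.chart b) (\<pi> (sect b y)) v v > 0"
proof -
  let ?x = "sect b y" and ?u = "frechet_derivative (sect b) (at y) v"
  have x: "?x \<in> ldom b" and xZ: "?x \<in> Z"
    using M.\<sigma>_into[OF UNIV_I y] sect_Z[OF y] by auto
  obtain D where D: "((snd (M.chart b) \<circ> \<pi>) has_derivative D) (at ?x within Z)"
    by (rule M.derivative_chart_projection[OF UNIV_I x]) (rule that)
  obtain r where r: "transverse ?x ?u ?u = hyp_metric ?x (?u + r *\<^sub>R vert ?x) (?u + r *\<^sub>R vert ?x)"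
    by (rule transverse_projection[OF xZ]) (rule that)
  have "D ?u = v"
    by (rule M.derivative_section[OF UNIV_I D M.smooth_\<sigma>[OF UNIV_I]])
      (use y sect_Z M.\<sigma>_into M.Q_\<sigma> in auto)
  moreover have "D (vert ?x) = 0"
    by (rule derivative_vert_zero[OF xZ D]) (simp add: orbit_rot)
  ultimately have "D (?u + r *\<^sub>R vert ?x) = v"
    by (simp add: linear_add[OF has_derivative_linear[OF D]] linear_cmul[OF has_derivative_linear[OF D]])
  then have "?u + r *\<^sub>R vert ?x \<noteq> 0"
    using v linear_0[OF has_derivative_linear[OF D]] by auto
  then show ?thesis
    unfolding hmet_sect[OF y] r by (rule hyp_metric_pos[OF Z_norm[OF xZ]])
qed

text \<open>The linear map \<open>L\<close> carries lifts of tangent vectors to lifts of their images, so both sides can be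
  compared upstairs.  For \<open>L\<close> the identity this is the transformation rule under a change of charts.\<close>

lemma preserves_metric_induced:
  assumes L: "bounded_linear L" and LZ: "\<And>x. x \<in> Z \<Longrightarrow> L x \<in> Z" and f: "\<And>x. x \<in> Z \<Longrightarrow> f (\<pi> x) = \<pi> (L x)"
    and tr: "\<And>x u w. x \<in> Z \<Longrightarrow> transverse (L x) (L u) (L w) = transverse x u w"
  shows "preserves_metric M.atlas hmet M.atlas hmet f"
  unfolding preserves_metric_def
proof (intro ballI impI)
  interpret quotient_charts_pair Z \<pi> T UNIV coord sect ldom Z \<pi> T UNIV coord sect ldom L f
    by unfold_locales (use smooth_on_linear[OF L smooth_on_id] LZ f in auto)
  fix ch ch' m assume "ch \<in> M.atlas" "ch' \<in> M.atlas" and m: "m \<in> fst ch" "f m \<in> fst ch'"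
  then obtain i j where ij: "ch = M.chart i" "ch' = M.chart j"
    by (auto simp: M.atlas_def)
  obtain y where y: "y \<in> T" "m = \<pi> (sect i y)"
    using m(1) M.chart_dom_eq[OF UNIV_I, of i] by (auto simp: ij)
  let ?x = "sect i y" and ?S = "frechet_derivative (sect i) (at y)"
  have xZ: "?x \<in> Z"
    by (rule sect_Z[OF y(1)])
  have Lx: "L ?x \<in> ldom j"
    using m(2) M.projection_in_chart[OF UNIV_I LZ[OF xZ], of j] unfolding ij y(2) f[OF xZ] by simp
  have coord: "snd ch m = y"
    unfolding ij y(2) by (rule M.chart_\<sigma>[OF UNIV_I y(1)])
  obtain D where D: "((snd (M.chart j) \<circ> \<pi>) has_derivative D) (at (L ?x) within Z)"
    by (rule M.derivative_chart_projection[OF UNIV_I Lx]) (rule that)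
  have s: "smooth_on T (\<lambda>y. L (sect i y))"
    by (rule smooth_on_linear[OF L M.smooth_\<sigma>[OF UNIV_I]])
  have sZ: "(\<lambda>y. L (sect i y)) ` T \<subseteq> Z"
    by (intro image_subsetI LZ sect_Z)
  have ds: "((\<lambda>y. L (sect i y)) has_derivative (\<lambda>v. L (?S v))) (at y)"
    by (rule bounded_linear.has_derivative[OF L sect_derivative[OF y(1)]])
  have "((\<lambda>y. (snd (M.chart j) \<circ> \<pi>) (L (sect i y))) has_derivative (\<lambda>v. D (L (?S v)))) (at y)"
    by (rule has_derivative_compose_into[OF ds M.open_T y(1) sZ D])
  then have "(local_rep ch ch' f has_derivative (\<lambda>v. D (L (?S v)))) (at y)"
  proof (rule has_derivative_transform_within_open[OF _ open_local_dom[of i j]])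
    show "y \<in> {y \<in> T. L (sect i y) \<in> ldom j}"
      using y(1) Lx by simp
    fix z assume z: "z \<in> {y \<in> T. L (sect i y) \<in> ldom j}"
    then show "(snd (M.chart j) \<circ> \<pi>) (L (sect i z)) = local_rep ch ch' f z"
      unfolding ij using local_rep_induced[OF UNIV_I UNIV_I, of z i j] M.chart_coord[OF UNIV_I, of "L
          (sect i z)" j] by simp
  qed simp_all
  moreover have "hmet ch' (f m) (D (L (?S v))) (D (L (?S w))) = hmet ch m v w" for v w
  proof -
    have tan: "L (?S v) \<in> tangent_space Z (L ?x)" for v
      using tangent_space_image[OF s M.open_T sZ y(1), of v] unfolding frechet_derivative_at[OF ds, symmetric] .
    have "hmet ch' (f m) (D (L (?S v))) (D (L (?S w))) = transverse (L ?x) (L (?S v)) (L (?S w))"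
      unfolding ij y(2) f[OF xZ] by (rule hmet_projection[OF Lx tan tan D])
    also have "\<dots> = hmet ch m v w"
      unfolding tr[OF xZ] ij y(2) hmet_sect[OF y(1)] ..
    finally show ?thesis .
  qed
  ultimately show "\<exists>D. (local_rep ch ch' f has_derivative D) (at (snd ch m)) \<and>
      (\<forall>v w. hmet ch' (f m) (D v) (D w) = hmet ch m v w)"
    unfolding coord by (intro exI[of _ "\<lambda>v. D (L (?S v))"]) simp
qed

theorem riemannian_metric_hmet: "riemannian_metric M.atlas hmet"
  unfolding riemannian_metric_def
proof (intro conjI ballI allI impI)
  show "preserves_metric M.atlas hmet M.atlas hmet (\<lambda>m. m)"
    by (rule preserves_metric_induced[of "\<lambda>x. x"]) (simp_all add: bounded_linear_ident)
  fix ch assume "ch \<in> M.atlas"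
  then obtain b where b: "ch = M.chart b"
    by (auto simp: M.atlas_def)
  show "smooth_on (snd ch ` fst ch) (\<lambda>y. hmet ch (inv_into (fst ch) (snd ch) y) v w)" for v w
  proof -
    have "smooth_on T (\<lambda>y. transverse (sect b y) (frechet_derivative (sect b) (at y) v)
        (frechet_derivative (sect b) (at y) w))"
      by (intro smooth_on_transverse M.smooth_\<sigma> UNIV_I smooth_on_frechet_derivative M.open_T sect_Z)
    then have "smooth_on T (\<lambda>y. hmet ch (inv_into (\<pi> ` ldom b) (snd ch) y) v w)"
      by (rule smooth_on_cong) (simp add: b M.inv_chart[OF UNIV_I] hmet_sect)
    then show ?thesis
      using M.chart_image[OF UNIV_I, of b] by (simp add: b)
  qed
  fix m assume "m \<in> fst ch"
  then obtain y where y: "y \<in> T" "m = \<pi> (sect b y)"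
    using M.chart_dom_eq[OF UNIV_I, of b] by (auto simp: b)
  note h = hmet_sect[OF y(1), of b, folded y(2) b]
  have S: "linear (frechet_derivative (sect b) (at y))"
    by (rule has_derivative_linear[OF sect_derivative[OF y(1)]])
  show "bilinear (hmet ch m)"
    unfolding bilinear_def
    by (intro conjI allI linearI) (simp_all add: h linear_add[OF S] linear_cmul[OF S] bilinear_ladd[OF
        bilinear_transverse]
        bilinear_radd[OF bilinear_transverse] bilinear_lmul[OF bilinear_transverse] bilinear_rmul[OF
            bilinear_transverse])
  show "hmet ch m v w = hmet ch m w v" for v w
    unfolding h by (rule transverse_commute)
  show "hmet ch m v v > 0" if "v \<noteq> 0" for v
    unfolding b y(2) by (rule hmet_pos[OF y(1) that])
qed

theorem riemannian_submersion_hmet: "riemannian_submersion Z hyp_metric \<pi> M.atlas hmet"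
  unfolding riemannian_submersion_def
proof (intro conjI ballI impI M.quotient_smooth_structure_atlas riemannian_metric_hmet)
  fix ch x assume "ch \<in> M.atlas" and x: "x \<in> Z" "\<pi> x \<in> fst ch"
  then obtain b where b: "ch = M.chart b"
    by (auto simp: M.atlas_def)
  have xb: "x \<in> ldom b"
    using x M.projection_in_chart[OF UNIV_I x(1), of b] by (simp add: b)
  obtain D where D: "((snd (M.chart b) \<circ> \<pi>) has_derivative D) (at x within Z)"
    by (rule M.derivative_chart_projection[OF UNIV_I xb]) (rule that)
  have "D (vert x) = 0"
    by (rule derivative_vert_zero[OF x(1) D]) (simp add: orbit_rot)
  then have hor: "v \<in> tangent_space Z x \<and> hyp_metric x (vert x) v = 0" if "v \<in> horizontal_space Z
      hyp_metric D x" for v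
    using that vert_tangent[OF x(1)] unfolding horizontal_space_def by blast
  have "hmet ch (\<pi> x) (D v) (D w) = hyp_metric x v w"
    if v: "v \<in> horizontal_space Z hyp_metric D x" and w: "w \<in> horizontal_space Z hyp_metric D x" for v w
    unfolding b using hmet_projection[OF xb _ _ D, of v w] hor[OF v] hor[OF w]
        transverse_horizontal[of x v w] by simp
  then show "\<exists>D. (snd ch \<circ> \<pi> has_derivative D) (at x within Z) \<and>
      (\<forall>v\<in>horizontal_space Z hyp_metric D x. \<forall>w\<in>horizontal_space Z hyp_metric D x.
         hmet ch (\<pi> x) (D v) (D w) = hyp_metric x v w)"
    using D unfolding b by (intro exI[of _ D]) simp
qed

end

section \<open>Completeness of the quotient metric\<close>

lemma smooth_on_derivative_bounded:
  assumes f: "smooth_on U f" "open U" and K: "compact K" "K \<subseteq> U"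
  obtains L where "L \<ge> 0" "\<And>x u. x \<in> K \<Longrightarrow> norm (frechet_derivative f (at x) u) \<le> L * norm u"
proof -
  let ?D = "\<lambda>x. frechet_derivative f (at x)"
  let ?B = "\<lambda>x. \<Sum>b\<in>Basis. norm (?D x b)"
  have "continuous_on K ?B"
    by (intro continuous_intros
        continuous_on_subset[OF smooth_on_continuous[OF smooth_on_frechet_derivative[OF f]] K(2)])
  from compact_imp_bounded[OF compact_continuous_image[OF this K(1)]]
  obtain M where M: "M > 0" "\<forall>x\<in>K. \<bar>?B x\<bar> \<le> M"
    by (auto simp: bounded_pos)
  have "norm (?D x u) \<le> M * norm u" if x: "x \<in> K" for x u
  proof -
    have lin: "linear (?D x)"
      using smooth_on_has_derivative[OF f, of x] K(2) x by (auto intro: has_derivative_linear)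
    have "?D x u = ?D x (\<Sum>b\<in>Basis. (u \<bullet> b) *\<^sub>R b)"
      by (simp add: euclidean_representation)
    also have "\<dots> = (\<Sum>b\<in>Basis. (u \<bullet> b) *\<^sub>R ?D x b)"
      by (simp only: linear_sum[OF lin] linear_cmul[OF lin])
    also have "norm \<dots> \<le> (\<Sum>b\<in>Basis. norm u * norm (?D x b))"
      by (rule sum_norm_le) (simp add: Basis_le_norm mult_right_mono)
    also have "\<dots> = norm u * ?B x"
      by (simp add: sum_distrib_left)
    also have "\<dots> \<le> norm u * M"
      using M(2) x by (intro mult_left_mono) auto
    finally show ?thesis
      by (simp add: mult.commute)
  qed
  then show thesis
    using M(1) that[of M] by simp
qed

context level_weights
begin

abbreviation "X \<equiv> quotient_topology Z \<pi>"

sublocale R: riemannian_manifold X M.atlas hmet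
  by unfold_locales (rule M.smooth_manifold_atlas, rule riemannian_metric_hmet)

lemma inv_orbit:
  assumes "x \<in> Z"
  obtains \<tau> where "norm \<tau> = 1" "inv_into Z \<pi> (\<pi> x) = rot \<tau> x"
proof -
  have "\<pi> (inv_into Z \<pi> (\<pi> x)) = \<pi> x"
    by (rule f_inv_into_f) (rule imageI[OF assms])
  then have "\<pi> x = \<pi> (inv_into Z \<pi> (\<pi> x))"
    by simp
  then show thesis
    unfolding circle_orbit_eq_iff by (elim exE conjE) (rule that)
qed

text \<open>An invariant function on the zero level with differential bounded by the hyperbolic metric
  descends to one with the same bound: since its differential annihilates the orbit direction, only the
  transverse part of a vector counts.\<close>

lemma lipschitz_gradient_invariant:
  fixes f :: "quat \<times> quat \<Rightarrow> 'b::euclidean_space"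
  assumes f: "\<And>x. x \<in> Z \<Longrightarrow> (f has_derivative E x) (at x)"
    and inv: "\<And>\<tau> x. norm \<tau> = 1 \<Longrightarrow> f (rot \<tau> x) = f x"
    and bound: "\<And>x u. x \<in> Z \<Longrightarrow> norm (E x u) \<le> L * sqrt (hyp_metric x u u)"
  shows "R.lipschitz_gradient L (\<lambda>m. f (inv_into Z \<pi> m))"
  unfolding R.lipschitz_gradient_def
proof (intro conjI ballI)
  have down: "f (inv_into Z \<pi> (\<pi> x)) = f x" if x: "x \<in> Z" for x
  proof -
    obtain \<tau> where "norm \<tau> = 1" "inv_into Z \<pi> (\<pi> x) = rot \<tau> x"
      by (rule inv_orbit[OF x]) (rule that)
    then show ?thesis
      using inv by simp
  qed
  have "continuous_on Z f"
    by (intro continuous_at_imp_continuous_on ballI has_derivative_continuous[OF f])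
  then have "continuous_on Z (\<lambda>x. f (inv_into Z \<pi> (\<pi> x)))"
    using down by (simp cong: continuous_on_cong)
  then show "continuous_map X euclidean (\<lambda>m. f (inv_into Z \<pi> m))"
    by (intro continuous_map_quotient) simp
  fix ch m assume "ch \<in> M.atlas" and m: "m \<in> fst ch"
  then obtain b where b: "ch = M.chart b"
    by (auto simp: M.atlas_def)
  obtain y where y: "y \<in> T" "m = \<pi> (sect b y)"
    using m M.chart_dom_eq[OF UNIV_I, of b] by (auto simp: b)
  let ?x = "sect b y" and ?S = "frechet_derivative (sect b) (at y)"
  have x: "?x \<in> Z"
    by (rule sect_Z[OF y(1)])
  have coord: "snd ch m = y"
    unfolding b y(2) by (rule M.chart_\<sigma>[OF UNIV_I y(1)])
  have "((\<lambda>y. f (sect b y)) has_derivative (\<lambda>v. E ?x (?S v))) (at y)"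
    by (rule has_derivative_compose[OF sect_derivative[OF y(1)] f[OF x]])
  then have "((\<lambda>y. f (inv_into Z \<pi> (inv_into (fst ch) (snd ch) y))) has_derivative (\<lambda>v. E ?x (?S v))) (at y)"
  proof (rule has_derivative_transform_within_open[OF _ M.open_T y(1)])
    fix z assume z: "z \<in> T"
    show "f (sect b z) = f (inv_into Z \<pi> (inv_into (fst ch) (snd ch) z))"
      using M.inv_chart[OF UNIV_I z, of b] down[OF sect_Z[OF z, of b]] by (simp add: b)
  qed
  moreover have "norm (E ?x (?S v)) \<le> L * sqrt (hmet ch m v v)" for v
  proof -
    have lin: "linear (E ?x)"
      by (rule has_derivative_linear[OF f[OF x]])
    have 0: "E ?x (vert ?x) = 0"
      by (rule derivative_vert_zero[OF x has_derivative_at_withinI[OF f[OF x]] inv])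
    obtain r where r: "transverse ?x (?S v) (?S v) =
        hyp_metric ?x (?S v + r *\<^sub>R vert ?x) (?S v + r *\<^sub>R vert ?x)"
      by (rule transverse_projection[OF x]) (rule that)
    have "E ?x (?S v) = E ?x (?S v + r *\<^sub>R vert ?x)"
      by (simp only: linear_add[OF lin] linear_cmul[OF lin] 0 scaleR_zero_right add_0_right)
    also have "norm \<dots> \<le> L * sqrt (transverse ?x (?S v) (?S v))"
      unfolding r by (rule bound[OF x])
    finally show ?thesis
      unfolding b y(2) hmet_sect[OF y(1)] .
  qed
  ultimately show "\<exists>D. ((\<lambda>y. f (inv_into Z \<pi> (inv_into (fst ch) (snd ch) y))) has_derivative D) (at
      (snd ch m)) \<and>
      (\<forall>v. norm (D v) \<le> L * sqrt (hmet ch m v v))"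
    unfolding coord by (intro exI[of _ "\<lambda>v. E ?x (?S v)"]) simp
qed

text \<open>Adding the points on the unit sphere makes the zero level compact.  On this larger set \<open>a\<close> still
  does not vanish, so derivatives of functions smooth for \<open>a \<noteq> 0\<close> are bounded on the zero level.\<close>

definition closed_level :: "(quat \<times> quat) set" where
  "closed_level = {x \<in> cball 0 1. moment_map P x = 0}"

lemma continuous_on_moment_map: "continuous_on S (moment_map P)"
  unfolding moment_map_coords by (intro continuous_intros)

lemma compact_closed_level: "compact closed_level"
proof -
  have "closed {x. moment_map P x = 0}"
    by (rule closed_Collect_eq[OF continuous_on_moment_map continuous_on_const])
  then have "compact (cball 0 1 \<inter> {x. moment_map P x = 0})"
    by (intro compact_Int_closed compact_cball)
  then show ?thesis
    by (simp add: closed_level_def Int_def)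
qed

lemma Z_eq: "Z = {x \<in> closed_level. norm x < 1}"
  by (auto simp: zero_level_def closed_level_def)

lemma closed_level_subset: "closed_level \<subseteq> {x. (norm (fst (fst x)))\<^sup>2 + (norm (fst (snd x)))\<^sup>2 > 0}"
proof
  fix x assume x: "x \<in> closed_level"
  obtain a1 b1 a2 b2 where "x = ((a1, b1), (a2, b2))"
    by (metis surj_pair)
  then show "x \<in> {x. (norm (fst (fst x)))\<^sup>2 + (norm (fst (snd x)))\<^sup>2 > 0}"
    using x moment_map_zero_a_nonzero[of a1 b1 a2 b2] by (simp add: closed_level_def)
qed

lemma lipschitz_gradient_F: "\<exists>L. R.lipschitz_gradient L (\<lambda>m. F (inv_into Z \<pi> m))"
proof -
  let ?U = "{x::quat \<times> quat. (norm (fst (fst x)))\<^sup>2 + (norm (fst (snd x)))\<^sup>2 > 0}"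
  have U: "open ?U"
    by (intro open_Collect_less continuous_intros)
  obtain L where L: "L \<ge> 0" "\<And>x u. x \<in> closed_level \<Longrightarrow> norm (frechet_derivative F (at x) u) \<le> L * norm u"
    by (rule smooth_on_derivative_bounded[OF smooth_F U compact_closed_level closed_level_subset]) (rule that)
  have "R.lipschitz_gradient L (\<lambda>m. F (inv_into Z \<pi> m))"
  proof (rule lipschitz_gradient_invariant)
    fix x assume x: "x \<in> Z"
    then show "(F has_derivative frechet_derivative F (at x)) (at x)"
      using Z_subset by (intro smooth_on_has_derivative[OF smooth_F U]) blast
    fix u
    have "norm (frechet_derivative F (at x) u) \<le> L * norm u"
      using x by (intro L(2)) (simp add: Z_eq)
    also have "\<dots> \<le> L * sqrt (hyp_metric x u u)"
      using hyp_metric_ge_norm[OF Z_norm[OF x], of u] L(1) by (intro mult_left_mono real_le_rsqrt) simp_all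
    finally show "norm (frechet_derivative F (at x) u) \<le> L * sqrt (hyp_metric x u u)" .
  qed (rule F_rot)
  then show ?thesis
    by (rule exI[of _ L])
qed

lemma inj_on_F: "inj_on (\<lambda>m. F (inv_into Z \<pi> m)) (topspace X)"
proof (rule inj_onI)
  fix m m' assume m: "m \<in> topspace X" "m' \<in> topspace X" and eq: "F (inv_into Z \<pi> m) = F (inv_into Z \<pi> m')"
  have m': "m \<in> \<pi> ` Z" "m' \<in> \<pi> ` Z"
    using m by (simp_all only: topspace_quotient_topology)
  show "m = m'"
    using eq F_iff[OF inv_into_into[OF m'(1)] inv_into_into[OF m'(2)]] f_inv_into_f[OF m'(1)]
        f_inv_into_f[OF m'(2)]
    by simp
qed

text \<open>A function tending to infinity at the boundary of the ball: the hyperbolic distance from the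
  origin up to a bounded error.\<close>

definition \<rho> :: "quat \<times> quat \<Rightarrow> real" where
  "\<rho> x = - (ln (1 - (norm x)\<^sup>2) / 2)"

lemma norm_square_less_1: "norm x < 1 \<Longrightarrow> (norm x)\<^sup>2 < 1"
  by (simp add: abs_square_less_1)

lemma norm_rot: "norm \<tau> = 1 \<Longrightarrow> norm (rot \<tau> x) = norm x"
  by (cases x) (auto simp: rot_def norm_Pair norm_mult norm_power)

lemma lipschitz_gradient_\<rho>: "R.lipschitz_gradient 1 (\<lambda>m. \<rho> (inv_into Z \<pi> m))"
proof (rule lipschitz_gradient_invariant)
  fix x assume x: "x \<in> Z"
  have n: "1 - (norm x)\<^sup>2 > 0"
    using norm_square_less_1[OF Z_norm[OF x]] by simp
  show "(\<rho> has_derivative (\<lambda>u. (x \<bullet> u) / (1 - (norm x)\<^sup>2))) (at x)"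
    using n unfolding \<rho>_def[abs_def] power2_norm_eq_inner
    by (auto intro!: derivative_eq_intros simp: inner_commute field_simps)
  fix u
  have "norm ((x \<bullet> u) / (1 - (norm x)\<^sup>2)) = sqrt (((x \<bullet> u) / (1 - (norm x)\<^sup>2))\<^sup>2)"
    by (simp only: real_sqrt_abs real_norm_def)
  also have "\<dots> \<le> sqrt (hyp_metric x u u)"
    by (rule real_sqrt_le_mono[OF hyp_metric_ge_radial[OF Z_norm[OF x]]])
  finally show "norm ((x \<bullet> u) / (1 - (norm x)\<^sup>2)) \<le> 1 * sqrt (hyp_metric x u u)"
    by simp
qed (simp add: \<rho>_def norm_rot)

lemma proper_\<rho>: "compactin X {m \<in> topspace X. \<rho> (inv_into Z \<pi> m) \<le> B}"
proof -
  let ?K = "{x \<in> Z. \<rho> x \<le> B}"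
  have "?K = closed_level \<inter> {x. (norm x)\<^sup>2 \<le> 1 - exp (- (2 * B))}"
  proof (intro Set.set_eqI iffI)
    fix x assume x: "x \<in> ?K"
    then have n: "1 - (norm x)\<^sup>2 > 0"
      using norm_square_less_1[OF Z_norm] by simp
    have "ln (1 - (norm x)\<^sup>2) \<ge> - (2 * B)"
      using x by (simp add: \<rho>_def)
    then have "1 - (norm x)\<^sup>2 \<ge> exp (- (2 * B))"
      using n by (simp add: ln_ge_iff)
    then show "x \<in> closed_level \<inter> {x. (norm x)\<^sup>2 \<le> 1 - exp (- (2 * B))}"
      using x by (simp add: Z_eq)
  next
    fix x assume x: "x \<in> closed_level \<inter> {x. (norm x)\<^sup>2 \<le> 1 - exp (- (2 * B))}"
    then have e: "1 - (norm x)\<^sup>2 \<ge> exp (- (2 * B))"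
      by simp
    moreover have "exp (- (2 * B)) > 0"
      by simp
    ultimately have n: "1 - (norm x)\<^sup>2 > 0"
      by linarith
    then have "(norm x)\<^sup>2 < 1"
      by simp
    then have "norm x < 1"
      by (simp only: abs_square_less_1 abs_norm_cancel)
    moreover have "ln (1 - (norm x)\<^sup>2) \<ge> - (2 * B)"
      using e n by (simp add: ln_ge_iff)
    ultimately show "x \<in> ?K"
      using x by (simp add: Z_eq \<rho>_def)
  qed
  moreover have "closed {x::quat \<times> quat. (norm x)\<^sup>2 \<le> 1 - exp (- (2 * B))}"
    by (intro closed_Collect_le continuous_intros)
  ultimately have "compact ?K"
    using compact_Int_closed[OF compact_closed_level] by simp
  then have "compactin (top_of_set Z) ?K"
    unfolding compactin_subtopology by auto
  from image_compactin[OF this continuous_map_projection]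
  have "compactin X (\<pi> ` ?K)" .
  moreover have "\<pi> ` ?K = {m \<in> topspace X. \<rho> (inv_into Z \<pi> m) \<le> B}"
  proof -
    have "\<rho> (inv_into Z \<pi> (\<pi> x)) = \<rho> x" if x: "x \<in> Z" for x
    proof -
      obtain \<tau> where "norm \<tau> = 1" "inv_into Z \<pi> (\<pi> x) = rot \<tau> x"
        by (rule inv_orbit[OF x]) (rule that)
      then show ?thesis
        by (simp add: \<rho>_def norm_rot)
    qed
    then show ?thesis
      by auto
  qed
  ultimately show ?thesis
    by simp
qed

text \<open>Both charts have the convex image \<open>T\<close>, and they overlap.\<close>

lemma joined:
  assumes "m \<in> topspace X" "m' \<in> topspace X"
  shows "\<exists>\<gamma> l. R.joins \<gamma> m m' l"
proof -
  \<comment> \<open>The orbit of a point with both components nonzero lies in the domains of both charts.\<close>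
  define d :: "(complex \<times> complex) \<times> complex" where
    "d = ((of_real (1 / sqrt 2), of_real (1 / sqrt 2)), 0)"
  have d: "d \<in> disk_total"
    by (simp add: d_def mem_disk_total norm_divide power_divide)
  have "fst (fst d) \<noteq> 0" "snd (fst d) \<noteq> 0"
    by (simp_all add: d_def)
  then have center: "\<Psi> d \<in> ldom b" for b
    using \<Psi>_into[OF d] d by (simp add: ldom_def \<Phi>_\<Psi>[OF d] disk_dom_def disk_swap_def)
  have conv: "convex (snd (M.chart b) ` fst (M.chart b))" for b
    using M.chart_image[OF UNIV_I, of b] by (simp add: convex_Times)
  have "\<exists>\<gamma> l. R.joins \<gamma> m (\<pi> (\<Psi> d)) l" if m: "m \<in> topspace X" for m
  proof -
    obtain x where "x \<in> Z" "m = \<pi> x"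
      using m by auto
    then obtain b where b: "x \<in> ldom b" "m = \<pi> x"
      using M.cover by blast
    show ?thesis
      by (rule R.joins_in_convex_chart[OF _ conv[of b]]) (use b center[of b] in \<open>auto simp: M.atlas_def\<close>)
  qed
  from this[OF assms(1)] this[OF assms(2)] show ?thesis
    using R.joins_concat R.joins_reverse by meson
qed

theorem complete_riemannian_hmet: "complete_riemannian X M.atlas hmet"
proof -
  obtain L where "R.lipschitz_gradient L (\<lambda>m. F (inv_into Z \<pi> m))"
    using lipschitz_gradient_F by (elim exE)
  from R.complete_riemannianI[OF joined this inj_on_F lipschitz_gradient_\<rho> proper_\<rho>] show ?thesis .
qed

end

section \<open>Invariance under U(2)\<close>

definition herm :: "complex \<Rightarrow> complex \<Rightarrow> complex \<Rightarrow> complex \<Rightarrow> complex" where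
  "herm z1 z2 w1 w2 = cnj z1 * w1 + cnj z2 * w2"

lemma qinner_herm:
  "qinner ((a1, b1), (a2, b2)) ((c1, d1), (c2, d2)) =
     (herm a1 a2 c1 c2 + herm d1 d2 b1 b2, herm a1 a2 d1 d2 - herm c1 c2 b1 b2)"
  by (simp add: qinner_eq herm_def algebra_simps)

lemma inner_herm:
  "((a1, b1), (a2, b2)) \<bullet> ((c1, d1), (c2, d2)) = Re (herm a1 a2 c1 c2 + herm b1 b2 d1 d2)"
  for a1 a2 b1 b2 c1 c2 d1 d2 :: complex
  by (simp add: inner_prod_def herm_def inner_complex_def)

lemma norm_herm: "(norm z1)\<^sup>2 + (norm z2)\<^sup>2 = Re (herm z1 z2 z1 z2)"
  unfolding cmod_power2 by (simp add: herm_def power2_eq_square)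

lemma U2_act_eq:
  "U2_act U ((a1, b1), (a2, b2)) =
     ((U $ 1 $ 1 * a1 + U $ 1 $ 2 * a2, U $ 1 $ 1 * b1 + U $ 1 $ 2 * b2),
      (U $ 2 $ 1 * a1 + U $ 2 $ 2 * a2, U $ 2 $ 1 * b1 + U $ 2 $ 2 * b2))"
  by (simp add: U2_act_def qmult_def cq_def)

lemma matrix_mult_2:
  fixes A B :: "'a::semiring_1^2^2"
  shows "(A ** B) $ i $ j = A $ i $ 1 * B $ 1 $ j + A $ i $ 2 * B $ 2 $ j"
  by (simp add: matrix_matrix_mult_def sum_2)

lemma U2_act_mult: "U2_act (U ** V) x = U2_act U (U2_act V x)"
proof -
  obtain a1 b1 a2 b2 where "x = ((a1, b1), (a2, b2))"
    by (metis surj_pair)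
  then show ?thesis
    by (simp add: U2_act_eq matrix_mult_2 algebra_simps)
qed

lemma U2_act_one: "U2_act (mat 1) x = x"
proof -
  obtain a1 b1 a2 b2 where "x = ((a1, b1), (a2, b2))"
    by (metis surj_pair)
  then show ?thesis
    by (simp add: U2_act_eq mat_def)
qed

lemma bounded_linear_U2_act: "bounded_linear (U2_act U)"
proof -
  have "linear (U2_act U)"
  proof (rule linearI)
    fix x y :: "quat \<times> quat" and r :: real
    obtain a1 b1 a2 b2 where x: "x = ((a1, b1), (a2, b2))"
      by (metis surj_pair)
    obtain c1 d1 c2 d2 where y: "y = ((c1, d1), (c2, d2))"
      by (metis surj_pair)
    show "U2_act U (x + y) = U2_act U x + U2_act U y"
      unfolding x y by (simp add: U2_act_eq algebra_simps)
    show "U2_act U (r *\<^sub>R x) = r *\<^sub>R U2_act U x"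
      unfolding x by (simp add: U2_act_eq scaleR_right_distrib)
  qed
  then show ?thesis
    by (rule linear_conv_bounded_linear[THEN iffD1])
qed

lemma ctranspose_mult: "ctranspose (A ** B) = ctranspose B ** ctranspose A"
  by (simp add: vec_eq_iff ctranspose_def matrix_mult_2 mult.commute)

lemma ctranspose_ctranspose: "ctranspose (ctranspose A) = A"
  by (simp add: vec_eq_iff ctranspose_def)

lemma ctranspose_U2: "U \<in> carrier U2 \<Longrightarrow> ctranspose U \<in> carrier U2"
  by (simp add: U2_def ctranspose_ctranspose)

lemma group_U2: "group U2"
proof (rule groupI)
  fix A B C assume A: "A \<in> carrier U2" and B: "B \<in> carrier U2"
  show "A \<otimes>\<^bsub>U2\<^esub> B \<in> carrier U2"
  proof -
    let ?A = "ctranspose A" and ?B = "ctranspose B"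
    have "A ** B ** (?B ** ?A) = A ** (B ** ?B) ** ?A" "?B ** ?A ** (A ** B) = ?B ** (?A ** A) ** B"
      by (simp_all only: matrix_mul_assoc)
    then show ?thesis
      using A B by (simp add: U2_def ctranspose_mult)
  qed
  show "A \<otimes>\<^bsub>U2\<^esub> B \<otimes>\<^bsub>U2\<^esub> C = A \<otimes>\<^bsub>U2\<^esub> (B \<otimes>\<^bsub>U2\<^esub> C)"
    by (simp add: U2_def matrix_mul_assoc)
  show "\<one>\<^bsub>U2\<^esub> \<otimes>\<^bsub>U2\<^esub> A = A"
    by (simp add: U2_def)
  show "\<exists>B\<in>carrier U2. B \<otimes>\<^bsub>U2\<^esub> A = \<one>\<^bsub>U2\<^esub>"
    by (rule bexI[OF _ ctranspose_U2[OF A]]) (use A in \<open>simp add: U2_def\<close>)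
next
  have "ctranspose (mat 1) = (mat 1 :: complex^2^2)"
    by (simp add: vec_eq_iff ctranspose_def mat_def)
  then show "\<one>\<^bsub>U2\<^esub> \<in> carrier U2"
    by (simp add: U2_def)
qed

text \<open>The hyperbolic metric and the moment map depend on \<open>a\<close> and \<open>b\<close> only through Hermitian products.\<close>

lemma herm_U2:
  assumes "U \<in> carrier U2"
  shows "herm (U $ 1 $ 1 * z1 + U $ 1 $ 2 * z2) (U $ 2 $ 1 * z1 + U $ 2 $ 2 * z2)
     (U $ 1 $ 1 * w1 + U $ 1 $ 2 * w2) (U $ 2 $ 1 * w1 + U $ 2 $ 2 * w2) = herm z1 z2 w1 w2"
proof -
  have "ctranspose U ** U = mat 1"
    using assms by (simp add: U2_def)
  then have e: "cnj (U $ 1 $ i) * U $ 1 $ j + cnj (U $ 2 $ i) * U $ 2 $ j = (if i = j then 1 else 0)" for i j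
    using matrix_mult_2[of "ctranspose U" U i j] by (simp add: ctranspose_def mat_def)
  have "herm (U $ 1 $ 1 * z1 + U $ 1 $ 2 * z2) (U $ 2 $ 1 * z1 + U $ 2 $ 2 * z2)
     (U $ 1 $ 1 * w1 + U $ 1 $ 2 * w2) (U $ 2 $ 1 * w1 + U $ 2 $ 2 * w2) =
     (cnj (U $ 1 $ 1) * U $ 1 $ 1 + cnj (U $ 2 $ 1) * U $ 2 $ 1) * (cnj z1 * w1) +
     (cnj (U $ 1 $ 1) * U $ 1 $ 2 + cnj (U $ 2 $ 1) * U $ 2 $ 2) * (cnj z1 * w2) +
     (cnj (U $ 1 $ 2) * U $ 1 $ 1 + cnj (U $ 2 $ 2) * U $ 2 $ 1) * (cnj z2 * w1) +
     (cnj (U $ 1 $ 2) * U $ 1 $ 2 + cnj (U $ 2 $ 2) * U $ 2 $ 2) * (cnj z2 * w2)"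
    by (simp add: herm_def algebra_simps)
  then show ?thesis
    unfolding e by (simp add: herm_def)
qed

lemma hyp_metric_U2:
  assumes U: "U \<in> carrier U2"
  shows "hyp_metric (U2_act U x) (U2_act U u) (U2_act U w) = hyp_metric x u w"
proof -
  have inner: "U2_act U u \<bullet> U2_act U w = u \<bullet> w" for u w
  proof -
    obtain a1 b1 a2 b2 where u: "u = ((a1, b1), (a2, b2))"
      by (metis surj_pair)
    obtain c1 d1 c2 d2 where w: "w = ((c1, d1), (c2, d2))"
      by (metis surj_pair)
    show ?thesis
      unfolding u w U2_act_eq inner_herm herm_U2[OF U] ..
  qed
  have qinner: "qinner (U2_act U u) (U2_act U w) = qinner u w" for u w
  proof -
    obtain a1 b1 a2 b2 where u: "u = ((a1, b1), (a2, b2))"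
      by (metis surj_pair)
    obtain c1 d1 c2 d2 where w: "w = ((c1, d1), (c2, d2))"
      by (metis surj_pair)
    show ?thesis
      unfolding u w U2_act_eq qinner_herm herm_U2[OF U] ..
  qed
  show ?thesis
    unfolding hyp_metric_def power2_norm_eq_inner inner qinner ..
qed

context level_weights
begin

lemma mem_Z_herm:
  "((a1, b1), (a2, b2)) \<in> Z \<longleftrightarrow>
     Re (herm a1 a2 a1 a2) = c + Re (herm b1 b2 b1 b2) \<and> herm a1 a2 b1 b2 = 0 \<and> 2 * q * Re (herm b1 b2
         b1 b2) < 1"
  unfolding mem_Z norm_herm by (simp add: herm_def)

lemma U2_act_Z:
  assumes U: "U \<in> carrier U2" and x: "x \<in> Z"
  shows "U2_act U x \<in> Z"
proof -
  obtain a1 b1 a2 b2 where "x = ((a1, b1), (a2, b2))"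
    by (metis surj_pair)
  then show ?thesis
    using x unfolding U2_act_eq by (simp only: mem_Z_herm U2_act_eq herm_U2[OF U])
qed

lemma U2_act_rot: "U2_act U (rot \<tau> x) = rot \<tau> (U2_act U x)"
proof -
  obtain a1 b1 a2 b2 where "x = ((a1, b1), (a2, b2))"
    by (metis surj_pair)
  then show ?thesis
    by (simp add: U2_act_eq rot_def algebra_simps)
qed

lemma U2_act_vert: "vert (U2_act U x) = U2_act U (vert x)"
proof -
  obtain a1 b1 a2 b2 where "x = ((a1, b1), (a2, b2))"
    by (metis surj_pair)
  then show ?thesis
    by (simp add: U2_act_eq vert_def algebra_simps)
qed

lemma U2_act_orbit: "U2_act U ` \<pi> x = \<pi> (U2_act U x)"
  unfolding circle_orbit_eq by (auto simp: U2_act_rot[symmetric])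

lemma smooth_map_U2:
  assumes "U \<in> carrier U2"
  shows "smooth_map X M.atlas X M.atlas (\<lambda>m. U2_act U ` m)"
proof -
  interpret quotient_charts_pair Z \<pi> T UNIV coord sect ldom Z \<pi> T UNIV coord sect ldom
      "U2_act U" "\<lambda>m. U2_act U ` m"
    by unfold_locales
      (rule smooth_on_linear[OF bounded_linear_U2_act smooth_on_id] U2_act_Z[OF assms] U2_act_orbit,
          assumption?)+
  show ?thesis
    by (rule smooth_map_induced)
qed

lemma U2_act_inverse:
  assumes "U \<in> carrier U2"
  shows "U2_act (ctranspose U) ` (U2_act U ` m) = m" "U2_act U ` (U2_act (ctranspose U) ` m) = m"
  using assms by (simp_all add: image_image U2_act_mult[symmetric] U2_def U2_act_one)

lemma riemannian_isometry_U2: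
  assumes U: "U \<in> carrier U2"
  shows "riemannian_isometry X M.atlas hmet X M.atlas hmet (\<lambda>m. U2_act U ` m)"
  unfolding riemannian_isometry_def diffeomorphism_def
proof (intro conjI exI[of _ "\<lambda>m. U2_act (ctranspose U) ` m"] ballI smooth_map_U2 U ctranspose_U2 U2_act_inverse)
  show "preserves_metric M.atlas hmet M.atlas hmet (\<lambda>m. U2_act U ` m)"
    by (rule preserves_metric_induced[OF bounded_linear_U2_act U2_act_Z[OF U] U2_act_orbit
          transverse_invariant[OF hyp_metric_U2[OF U] U2_act_vert]])
qed

lemma group_action_U2: "group_action U2 (topspace X) (\<lambda>U. \<lambda>m\<in>topspace X. U2_act U ` m)"
proof (rule group_action.intro, rule group_hom.intro[OF group_U2 group_BijGroup], rule
    group_hom_axioms.intro, rule homI)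
  have into: "U2_act U ` m \<in> topspace X" if "U \<in> carrier U2" "m \<in> topspace X" for U m
    using that U2_act_orbit U2_act_Z by auto
  have bij: "(\<lambda>m\<in>topspace X. U2_act U ` m) \<in> Bij (topspace X)" if U: "U \<in> carrier U2" for U
  proof -
    have "bij_betw (\<lambda>m\<in>topspace X. U2_act U ` m) (topspace X) (topspace X)"
      by (rule bij_betw_byWitness[where f' = "\<lambda>m. U2_act (ctranspose U) ` m"])
        (use U2_act_inverse[OF U] into[OF U] into[OF ctranspose_U2[OF U]] in
          \<open>simp_all add: image_subset_iff del: topspace_quotient_topology\<close>)
    then show ?thesis
      unfolding Bij_def by (simp only: IntI restrict_extensional mem_Collect_eq)
  qed
  then show "(\<lambda>m\<in>topspace X. U2_act U ` m) \<in> carrier (BijGroup (topspace X))" if "U \<in> carrier U2" for U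
    using that by (simp add: BijGroup_def)
  fix U V assume U: "U \<in> carrier U2" and V: "V \<in> carrier U2"
  have "(\<lambda>m\<in>topspace X. U2_act (U ** V) ` m) =
      compose (topspace X) (\<lambda>m\<in>topspace X. U2_act U ` m) (\<lambda>m\<in>topspace X. U2_act V ` m)"
  proof
    fix m
    show "(\<lambda>m\<in>topspace X. U2_act (U ** V) ` m) m =
        compose (topspace X) (\<lambda>m\<in>topspace X. U2_act U ` m) (\<lambda>m\<in>topspace X. U2_act V ` m) m"
      using into[OF V, of m] by (cases "m \<in> topspace X") (simp_all add: compose_def image_image U2_act_mult)
  qed
  then show "(\<lambda>m\<in>topspace X. U2_act (U \<otimes>\<^bsub>U2\<^esub> V) ` m) =
      (\<lambda>m\<in>topspace X. U2_act U ` m) \<otimes>\<^bsub>BijGroup (topspace X)\<^esub> (\<lambda>m\<in>topspace X. U2_act V ` m)"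
    using bij[OF U] bij[OF V] by (simp add: BijGroup_def) (simp add: U2_def)
qed

end

section \<open>The quotient as a disk bundle\<close>

theorem theorem3p4:
  fixes p :: int and P :: weights
  assumes "p > 1" and "P = (p - 1, p, p)"
  shows "\<exists>(A :: ((quat \<times> quat) set, complex \<times> complex) chart set) g.
     riemannian_submersion (zero_level P) hyp_metric (circle_orbit P) A g \<and>
     complete_riemannian (qk_quotient P) A g \<and>
     U2_invariant (qk_quotient P) A g \<and>
     (\<exists>(B :: (((complex \<times> complex) \<times> complex) set, complex \<times> complex) chart set) f.
        quotient_smooth_structure disk_total (disk_orbit (nat (2 * p))) B \<and>
        diffeomorphism (qk_quotient P) A (disk_bundle (nat (2 * p))) B f)"
proof -
  interpret level_weights p
    using assms(1) by unfold_locales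
  show ?thesis
    unfolding assms(2)
  proof (rule exI[of _ M.atlas], rule exI[of _ hmet], intro conjI)
    show "riemannian_submersion (zero_level (p - 1, p, p)) hyp_metric (circle_orbit (p - 1, p, p)) M.atlas hmet"
      by (rule riemannian_submersion_hmet)
    show "complete_riemannian (qk_quotient (p - 1, p, p)) M.atlas hmet"
      unfolding qk_quotient_def by (rule complete_riemannian_hmet)
    show "U2_invariant (qk_quotient (p - 1, p, p)) M.atlas hmet"
      unfolding U2_invariant_def qk_quotient_def
      by (intro conjI ballI group_action_U2 riemannian_isometry_U2)
    show "\<exists>(B :: (((complex \<times> complex) \<times> complex) set, complex \<times> complex) chart set) f.
        quotient_smooth_structure disk_total (disk_orbit (nat (2 * p))) B \<and>
        diffeomorphism (qk_quotient (p - 1, p, p)) M.atlas (disk_bundle (nat (2 * p))) B f"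
      by (rule exI[of _ D.atlas], rule exI[of _ to_disk])
        (intro conjI D.quotient_smooth_structure_atlas diffeomorphism_to_disk)
  qed
qed

end
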